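(* For any shifted skew diagram $D$, any field $k$, and any finite sets of positive integers $X,Y$ (with $X\sqcup Y\neq\varnothing$ in the first formula and $X\ne\varnothing$ in the second), one has $$\mathrm{reg}_{k[\mathbf x,\mathbf y]}(I(G^{\mathrm{bip}}_{X,Y}(D)))=\mathrm{rect}(D^{\mathrm{bip}}_{X,Y})+1,$$ $$\mathrm{reg}_{k[\mathbf x]}(I(G^{\mathrm{nonbip}}_{X}(D)))=\mathrm{rect}(D^{\mathrm{nonbip}}_{X})+1.$$
   Context: **Shifted skew diagrams.** Given integers $\lambda_1>\dots>\lambda_\ell>0$ and $\mu_1>\dots>\mu_r>0$ with $0\le r\le \ell$ and $\mu_i<\lambda_i$ for $1\le i\le \ell$ (where $\mu_i:=0$ for $i>r$), the associated shifted skew diagram is $D=\{(i,j)\in\mathbb Z^2: 1\le i\le \ell,\ i+\mu_i+1\le j\le i+\lambda_i\}$. Its elements are called cells; $i$ is the row index (increasing downwards), $j$ the column index (increasing to the right). **Restricted diagrams, ideals.** For finite sets of positive integers $X=\{x_1<\dots<x_m\}$, $Y=\{y_1<\dots<y_n\}$, $D^{\mathrm{bip}}_{X,Y}$ is the diagram with rows indexed by $X$ and columns indexed by $Y$, having a cell in position $(x_i,y_j)$ iff $(x_i,y_j)\in D$; and $D^{\mathrm{nonbip}}_X:=D^{\mathrm{bip}}_{X,X}$. Regarding the $x_i$ and $y_j$ also as distinct variables, $I(G^{\mathrm{bip}}_{X,Y}(D))\subset k[\mathbf x,\mathbf y]=k[x_1,\dots,x_m,y_1,\dots,y_n]$ is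 generated by the monomials $x_iy_j$ for cells $(x_i,y_j)$ of $D^{\mathrm{bip}}_{X,Y}$, and $I(G^{\mathrm{nonbip}}_X(D))\subset k[\mathbf x]=k[x_1,\dots,x_m]$ is generated by the monomials $x_ix_j$ for cells $(x_i,x_j)$ of $D^{\mathrm{nonbip}}_X$. **Regularity.** For a $\mathbb Z$-graded module $M$ over a regular $\mathbb Z$-graded $k$-algebra $S$ (here a standard graded polynomial ring), $\mathrm{reg}_S(M)=\max\{j-i:\dim_k\mathrm{Tor}^S_i(M,k)_j\ne0\}$. **Rectangular decomposition of $D^{\mathrm{bip}}_{X,Y}$** ($X\sqcup Y\ne\varnothing$, one of $X,Y$ possibly empty). The following is iterated, with $X=\{x_1<\dots<x_m\}$, $Y=\{y_1<\dots<y_n\}$ denoting the current row and column sets, until $X\sqcup Y$ is empty or a pedestal is found. The top cell is the cell in position $(x_1,y_n)$, if $X,Y$ are both nonempty and that cell is present. Case 1: no top cell. Let $X'$ be the maximal initial segment of $X$ whose rows contain no cells of $D^{\mathrm{bip}}_{X,Y}$, and $Y'$ the maximal final segment of $Y$ whose columns contain no cells of $D^{\mathrm{bip}}_{X,Y}$ (then $X'\sqcup Y'\neq\varnothing$). Call $D^{\mathrm{bip}}_{X',Y'}$ an empty rectangle. Replace $(X,Y)$ by $(X\setminus X',Y\setminus Y')$ and continue. Case 2: there is a top cell. Let $m'$ be maximal such that $(x_{m'},y_n)$ is a cell, and $n'$ minimal such that $(x_1,y_{n'})$ is a cell; put $X'=\{x_1,\dots,x_{m'}\}$, $Y'=\{y_{n'},\dots,y_n\}$.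 - Subcase 2a: $(x_{m'},y_{n'})$ is a cell. Then call $D^{\mathrm{bip}}_{X',Y'}$ a full rectangle; replace $(X,Y)$ by $(X\setminus X',Y\setminus Y')$ and continue. - Subcase 2b: $(x_{m'},y_{n'})$ is not a cell. Then call $D^{\mathrm{bip}}_{X',Y'}$ the pedestal; terminate. The rectangularity $\mathrm{rect}(D^{\mathrm{bip}}_{X,Y})$ is the number of full rectangles plus the number of pedestals ($0$ or $1$) in this decomposition, and $\mathrm{rect}(D^{\mathrm{nonbip}}_X)=\mathrm{rect}(D^{\mathrm{bip}}_{X,X})$. *)

theory Defs
  imports Complex_Main "HOL-Library.Poly_Mapping" "HOL-Library.Function_Algebras"
begin

section \<open>Shifted skew diagrams\<close>

definition shifted_skew_diagram :: "(nat \<times> nat) set \<Rightarrow> bool" where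
  "shifted_skew_diagram D \<longleftrightarrow>
     (\<exists>(l::nat) (r::nat) (lam :: nat \<Rightarrow> nat) (mu :: nat \<Rightarrow> nat).
        r \<le> l \<and>
        strict_antimono_on {1..l} lam \<and> (\<forall>i\<in>{1..l}. lam i > 0) \<and>
        strict_antimono_on {1..r} mu \<and> (\<forall>i\<in>{1..r}. mu i > 0) \<and> (\<forall>i>r. mu i = 0) \<and>
        (\<forall>i\<in>{1..l}. mu i < lam i) \<and>
        D = {(i, j). i \<in> {1..l} \<and> i + mu i + 1 \<le> j \<and> j \<le> i + lam i})"


section \<open>Rectangular decomposition and rectangularity\<close>

text \<open>A block is recorded by its set of rows and its set of columns.\<close>

datatype block =
    Empty_Rectangle "nat set" "nat set"
  | Full_Rectangle "nat set" "nat set"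
  | Pedestal "nat set" "nat set"

definition has_top_cell :: "(nat \<times> nat) set \<Rightarrow> nat set \<Rightarrow> nat set \<Rightarrow> bool" where
  "has_top_cell D X Y \<longleftrightarrow> X \<noteq> {} \<and> Y \<noteq> {} \<and> (Min X, Max Y) \<in> D"

definition empty_rows :: "(nat \<times> nat) set \<Rightarrow> nat set \<Rightarrow> nat set \<Rightarrow> nat set" where
  "empty_rows D X Y = {x \<in> X. \<forall>x'\<in>X. x' \<le> x \<longrightarrow> (\<forall>y\<in>Y. (x', y) \<notin> D)}"

definition empty_cols :: "(nat \<times> nat) set \<Rightarrow> nat set \<Rightarrow> nat set \<Rightarrow> nat set" where
  "empty_cols D X Y = {y \<in> Y. \<forall>y'\<in>Y. y \<le> y' \<longrightarrow> (\<forall>x\<in>X. (x, y') \<notin> D)}"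

definition last_row :: "(nat \<times> nat) set \<Rightarrow> nat set \<Rightarrow> nat set \<Rightarrow> nat" where
  "last_row D X Y = Max {x \<in> X. (x, Max Y) \<in> D}"

definition first_col :: "(nat \<times> nat) set \<Rightarrow> nat set \<Rightarrow> nat set \<Rightarrow> nat" where
  "first_col D X Y = Min {y \<in> Y. (Min X, y) \<in> D}"

definition top_rows :: "(nat \<times> nat) set \<Rightarrow> nat set \<Rightarrow> nat set \<Rightarrow> nat set" where
  "top_rows D X Y = {x \<in> X. x \<le> last_row D X Y}"

definition top_cols :: "(nat \<times> nat) set \<Rightarrow> nat set \<Rightarrow> nat set \<Rightarrow> nat set" where
  "top_cols D X Y = {y \<in> Y. first_col D X Y \<le> y}"

text \<open>
  The first two stopping conditions only make the recursion total: if X and Y are finite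
  and D is a shifted skew diagram, then in the absence of a top cell at least one of
  the two segments of empty rows and empty columns is nonempty
  (as long as X and Y are not both empty).
\<close>

function rect_decomposition ::
    "(nat \<times> nat) set \<Rightarrow> nat set \<Rightarrow> nat set \<Rightarrow> block list" where
  "rect_decomposition D X Y =
     (if infinite X \<or> infinite Y then []
      else if \<not> has_top_cell D X Y \<and> empty_rows D X Y = {} \<and> empty_cols D X Y = {} then []
      else if X = {} \<and> Y = {} then []
      else if \<not> has_top_cell D X Y then
        Empty_Rectangle (empty_rows D X Y) (empty_cols D X Y) #
        rect_decomposition D (X - empty_rows D X Y) (Y - empty_cols D X Y)
      else if (last_row D X Y, first_col D X Y) \<in> D then
        Full_Rectangle (top_rows D X Y) (top_cols D X Y) #
        rect_decomposition D (X - top_rows D X Y) (Y - top_cols D X Y)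
      else [Pedestal (top_rows D X Y) (top_cols D X Y)])"
  by pat_completeness auto
termination
proof (relation "measure (\<lambda>(D, X, Y). card X + card Y)", goal_cases)
  case 1
  show ?case by simp
next
  case (2 D X Y)
  have sub: "empty_rows D X Y \<subseteq> X" "empty_cols D X Y \<subseteq> Y"
    by (auto simp: empty_rows_def empty_cols_def)
  have fin: "finite X" "finite Y" using 2 by auto
  have le: "card (X - empty_rows D X Y) \<le> card X" "card (Y - empty_cols D X Y) \<le> card Y"
    using fin by (auto intro: card_mono)
  have "empty_rows D X Y \<noteq> {} \<or> empty_cols D X Y \<noteq> {}" using 2 by auto
  then have "card (X - empty_rows D X Y) < card X \<or> card (Y - empty_cols D X Y) < card Y"
  proof
    assume "empty_rows D X Y \<noteq> {}"
    then have "X - empty_rows D X Y \<subset> X" using sub by blast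
    then show ?thesis using fin psubset_card_mono by blast
  next
    assume "empty_cols D X Y \<noteq> {}"
    then have "Y - empty_cols D X Y \<subset> Y" using sub by blast
    then show ?thesis using fin psubset_card_mono by blast
  qed
  with le show ?case by auto
next
  case (3 D X Y)
  have fin: "finite X" "finite Y" using 3 by auto
  have top: "X \<noteq> {}" "(Min X, Max Y) \<in> D" using 3 by (auto simp: has_top_cell_def)
  have inX: "Min X \<in> X" using fin(1) top(1) by (rule Min_in)
  have "Min X \<le> last_row D X Y"
    unfolding last_row_def using fin(1) inX top(2) by (intro Max_ge) simp_all
  with inX have "Min X \<in> top_rows D X Y" by (simp add: top_rows_def)
  with inX have "X - top_rows D X Y \<subset> X" by blast
  then have "card (X - top_rows D X Y) < card X"
    using fin(1) by (rule psubset_card_mono[rotated])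
  moreover have "card (Y - top_cols D X Y) \<le> card Y"
    using fin(2) by (simp add: card_mono)
  ultimately show ?case by simp
qed

declare rect_decomposition.simps [simp del]

definition rect_bip :: "(nat \<times> nat) set \<Rightarrow> nat set \<Rightarrow> nat set \<Rightarrow> nat" where
  "rect_bip D X Y =
     length (filter (\<lambda>B. (\<exists>X' Y'. B = Full_Rectangle X' Y') \<or> (\<exists>X' Y'. B = Pedestal X' Y'))
       (rect_decomposition D X Y))"

definition rect_nonbip :: "(nat \<times> nat) set \<Rightarrow> nat set \<Rightarrow> nat" where
  "rect_nonbip D X = rect_bip D X X"


section \<open>Polynomial rings\<close>

text \<open>
  Monomials are finitely supported exponent vectors; polynomials are finitely supported
  families of coefficients. The type has a variable for every element of the
  type of indices; the polynomial ring in a given set V of variables is the subring \<open>polys V\<close>.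
\<close>

type_synonym ('v, 'k) mpoly = "('v \<Rightarrow>\<^sub>0 nat) \<Rightarrow>\<^sub>0 'k"

definition var :: "'v \<Rightarrow> ('v, 'k::field) mpoly" where
  "var v = Poly_Mapping.single (Poly_Mapping.single v 1) 1"

definition polys :: "'v set \<Rightarrow> ('v, 'k::field) mpoly set" where
  "polys V = {p. \<forall>m\<in>Poly_Mapping.keys p. Poly_Mapping.keys m \<subseteq> V}"

definition mono_degree :: "('v \<Rightarrow>\<^sub>0 nat) \<Rightarrow> nat" where
  "mono_degree m = (\<Sum>v\<in>Poly_Mapping.keys m. Poly_Mapping.lookup m v)"

definition homogeneous :: "int \<Rightarrow> ('v, 'k::field) mpoly \<Rightarrow> bool" where
  "homogeneous d p \<longleftrightarrow> (\<forall>m\<in>Poly_Mapping.keys p. int (mono_degree m) = d)"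

definition const_coeff :: "('v, 'k::field) mpoly \<Rightarrow> 'k" where
  "const_coeff p = Poly_Mapping.lookup p 0"

definition ideal_generated ::
    "'v set \<Rightarrow> ('v, 'k::field) mpoly set \<Rightarrow> ('v, 'k) mpoly set" where
  "ideal_generated V G =
     {(\<Sum>g\<in>A. c g * g) | A c. finite A \<and> A \<subseteq> G \<and> (\<forall>g\<in>A. c g \<in> polys V)}"


section \<open>The ideals of a restricted diagram\<close>

text \<open>\<open>Inl x\<close> is the variable of row \<open>x\<close>, \<open>Inr y\<close> the variable of column \<open>y\<close>.\<close>

definition bip_ideal ::
    "(nat \<times> nat) set \<Rightarrow> nat set \<Rightarrow> nat set \<Rightarrow> (nat + nat, 'k::field) mpoly set" where
  "bip_ideal D X Y =
     ideal_generated (X <+> Y) {var (Inl x) * var (Inr y) | x y. x \<in> X \<and> y \<in> Y \<and> (x, y) \<in> D}"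

definition nonbip_ideal :: "(nat \<times> nat) set \<Rightarrow> nat set \<Rightarrow> (nat, 'k::field) mpoly set" where
  "nonbip_ideal D X =
     ideal_generated X {var x * var x' | x x'. x \<in> X \<and> x' \<in> X \<and> (x, x') \<in> D}"


section \<open>Graded free resolutions\<close>

text \<open>
  Write \<open>S = polys V\<close>. A complex of graded free \<open>S\<close>-modules of finite rank, with an augmentation
  to \<open>S\<close>, is given by matrices. The module \<open>F\<^sub>i\<close> has basis elements \<open>e\<^sub>b\<close> for \<open>b < rk F i\<close>, of
  degree \<open>shift F i b\<close>; \<open>aug F b\<close> is the image of the basis element \<open>e\<^sub>b\<close> of \<open>F\<^sub>0\<close> in \<open>S\<close>; and
  \<open>dmat F i a b\<close> is the coefficient at \<open>e\<^sub>a\<close> (in \<open>F\<^sub>i\<close>) of the image of the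
  basis element \<open>e\<^sub>b\<close> of \<open>F\<^sub>i\<^sub>+\<^sub>1\<close>.
\<close>

record (overloaded) ('v, 'k) graded_free_complex =
  rk :: "nat \<Rightarrow> nat"
  shift :: "nat \<Rightarrow> nat \<Rightarrow> int"
  aug :: "nat \<Rightarrow> ('v, 'k) mpoly"
  dmat :: "nat \<Rightarrow> nat \<Rightarrow> nat \<Rightarrow> ('v, 'k) mpoly"

definition free_module :: "'v set \<Rightarrow> nat \<Rightarrow> (nat \<Rightarrow> ('v, 'k::field) mpoly) set" where
  "free_module V r = {f. (\<forall>a<r. f a \<in> polys V) \<and> (\<forall>a\<ge>r. f a = 0)}"

definition aug_map ::
    "('v, 'k::field) graded_free_complex \<Rightarrow> (nat \<Rightarrow> ('v, 'k) mpoly) \<Rightarrow> ('v, 'k) mpoly" where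
  "aug_map F f = (\<Sum>b<rk F 0. f b * aug F b)"

definition diff_map ::
    "('v, 'k::field) graded_free_complex \<Rightarrow> nat \<Rightarrow> (nat \<Rightarrow> ('v, 'k) mpoly) \<Rightarrow> nat \<Rightarrow> ('v, 'k) mpoly"
  where
  "diff_map F i f = (\<lambda>a. if a < rk F i then \<Sum>b<rk F (Suc i). f b * dmat F i a b else 0)"

text \<open>
  \<open>F\<close> is a graded free resolution of the graded \<open>S\<close>-module \<open>M\<close>, a homogeneous ideal of \<open>S\<close>:
  all maps are homogeneous of degree 0, and
  \<open>\<dots> \<rightarrow> F\<^sub>2 \<rightarrow> F\<^sub>1 \<rightarrow> F\<^sub>0 \<rightarrow> M \<rightarrow> 0\<close> is exact.
\<close>

definition graded_free_resolution ::
    "'v set \<Rightarrow> ('v, 'k::field) mpoly set \<Rightarrow> ('v, 'k) graded_free_complex \<Rightarrow> bool" where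
  "graded_free_resolution V M F \<longleftrightarrow>
     (\<forall>b<rk F 0. aug F b \<in> polys V \<and> homogeneous (shift F 0 b) (aug F b)) \<and>
     (\<forall>i. \<forall>a<rk F i. \<forall>b<rk F (Suc i).
        dmat F i a b \<in> polys V \<and> homogeneous (shift F (Suc i) b - shift F i a) (dmat F i a b)) \<and>
     aug_map F ` free_module V (rk F 0) = M \<and>
     {f \<in> free_module V (rk F 0). aug_map F f = 0} =
       diff_map F 0 ` free_module V (rk F 1) \<and>
     (\<forall>i. {f \<in> free_module V (rk F (Suc i)). diff_map F i f = (\<lambda>a. 0)} =
       diff_map F (Suc i) ` free_module V (rk F (Suc (Suc i))))"


section \<open>Tor and regularity\<close>

text \<open>
  The complex \<open>F \<otimes>\<^sub>S k\<close>, where \<open>k = S / (V)\<close>: the module \<open>F\<^sub>i \<otimes>\<^sub>S k\<close> is the \<open>k\<close>-vector space on the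
  basis of \<open>F\<^sub>i\<close>, and the matrix entries act through their constant coefficients.
  \<open>tensor_part F i j\<close> is its component of degree \<open>j\<close>.
\<close>

definition tensor_part ::
    "('v, 'k::field) graded_free_complex \<Rightarrow> nat \<Rightarrow> int \<Rightarrow> (nat \<Rightarrow> 'k) set" where
  "tensor_part F i j = {w. \<forall>b. w b \<noteq> 0 \<longrightarrow> b < rk F i \<and> shift F i b = j}"

definition tensor_diff ::
    "('v, 'k::field) graded_free_complex \<Rightarrow> nat \<Rightarrow> (nat \<Rightarrow> 'k) \<Rightarrow> nat \<Rightarrow> 'k" where
  "tensor_diff F i w =
     (\<lambda>a. if a < rk F i then \<Sum>b<rk F (Suc i). w b * const_coeff (dmat F i a b) else 0)"

definition tensor_cycles ::
    "('v, 'k::field) graded_free_complex \<Rightarrow> nat \<Rightarrow> int \<Rightarrow> (nat \<Rightarrow> 'k) set" where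
  "tensor_cycles F i j =
     {w \<in> tensor_part F i j. \<forall>i'. i = Suc i' \<longrightarrow> tensor_diff F i' w = (\<lambda>a. 0)}"

definition tensor_boundaries ::
    "('v, 'k::field) graded_free_complex \<Rightarrow> nat \<Rightarrow> int \<Rightarrow> (nat \<Rightarrow> 'k) set" where
  "tensor_boundaries F i j = tensor_diff F i ` tensor_part F (Suc i) j"

definition dim_k :: "(nat \<Rightarrow> 'k::field) set \<Rightarrow> nat" where
  "dim_k W = vector_space.dim (\<lambda>(c::'k) w n. c * w n) W"

text \<open>
  The dimension of the degree \<open>j\<close> component of \<open>Tor\<^sub>i(M, k)\<close>, computed from a
  graded free resolution of \<open>M\<close> (it does not depend on the choice of the resolution).
  The boundaries are a subspace of the finite-dimensional space of cycles, so the
  difference is the dimension of the quotient.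
\<close>

definition tor_dim :: "'v set \<Rightarrow> ('v, 'k::field) mpoly set \<Rightarrow> nat \<Rightarrow> int \<Rightarrow> nat" where
  "tor_dim V M i j =
     (let F = (SOME F. graded_free_resolution V M F)
      in dim_k (tensor_cycles F i j) - dim_k (tensor_boundaries F i j))"

text \<open>
  All Tor modules of the zero ideal vanish, so the maximum is over the empty set. For it we use
  the convention \<open>reg 0 = 1\<close>, which keeps the identity \<open>reg I = reg (S/I) + 1\<close> valid.
\<close>

definition regularity :: "'v set \<Rightarrow> ('v, 'k::field) mpoly set \<Rightarrow> int" where
  "regularity V M =
     (if M = {0} then 1 else Max {j - int i | i j. tor_dim V M i j \<noteq> 0})"

end

theory Submission
  imports Defs
begin

text \<open>
  The rectangularity is the largest size of an induced matching: the top cells of the full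
  rectangles and of the pedestal form one, and of any induced matching at most one edge meets the
  rows or columns of a given rectangle or pedestal.

  Lower bound: sending the variables outside an induced matching to zero makes the complete
  intersection of its \<open>r\<close> edges a retract of the edge ideal, so its
  \<open>Tor\<close>, nonzero in homological degree \<open>r - 1\<close> and internal degree \<open>2 r\<close>, survives.

  Upper bound: for an edge \<open>e = {m, y}\<close> and \<open>I' = I(G - e)\<close>, the ideal \<open>I' : x\<^sub>e\<close> is generated by
  the neighbours of \<open>m\<close> and \<open>y\<close> and by the edges away from them, so a mapping cone gives
  \<open>reg I(G) \<le> max (reg I(G - e)) (reg I(G - N[e]) + 1)\<close>. The leftmost cell of the last nonempty row is
  an edge whose removal creates no new induced matching, and the class of graphs in question is
  closed under this removal; induction bounds the regularity by the induced matching number plus 1.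
\<close>

subsection \<open>Polynomials as families of coefficients\<close>

text \<open>\<open>regularity\<close> is defined through an unspecified resolution, so both bounds
  need \<open>Tor\<close> to be independent of the resolution; the retraction argument for the lower
  bound contains this as the case of equal rings and equal ideals. No minimal resolution is built:
  the shifts of any resolution bound \<open>Tor\<close> from above, and mapping cones provide one.

  An edge costs at most 1 because the second complex enters the cone two degrees higher but one
  homological step later. The neighbours of the edge enter the colon ideal as variables and cost
  nothing.

  Deleting a cell can break the axiom \<open>col\<close> of the shape: from the cells above the
  diagonal on the vertices 1, 2, 3, 4 remove (3,4), then (2,3). So the induction runs over graphs
  with an injective vertex order, closed under transitivity and a corner rule. These two rules yield
  a second edge between any two edges that the removed one would join.

  For the bipartite graph, induced matchings are sets of cells without crossing cells. In the
  nonbipartite graph rows and columns share vertices, and further joining edges are excluded by the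
  order of the four indices.\<close>

definition mono_filter :: "(('v \<Rightarrow>\<^sub>0 nat) \<Rightarrow> bool) \<Rightarrow> ('v, 'k::field) mpoly \<Rightarrow> ('v, 'k) mpoly" where
  "mono_filter P p = Poly_Mapping.mapp (\<lambda>m c. c when P m) p"

lemma lookup_mono_filter:
  "Poly_Mapping.lookup (mono_filter P p) m = (if P m then Poly_Mapping.lookup p m else 0)"
  by (simp add: mono_filter_def lookup_mapp in_keys_iff when_def)

lemma keys_mono_filter: "Poly_Mapping.keys (mono_filter P p) = {m \<in> Poly_Mapping.keys p. P m}"
  by (auto simp: in_keys_iff lookup_mono_filter split: if_splits)

lemma mono_filter_0 [simp]: "mono_filter P 0 = 0"
  by (rule poly_mapping_eqI) (simp add: lookup_mono_filter)

lemma mono_filter_add: "mono_filter P (p + q) = mono_filter P p + mono_filter P q"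
  by (rule poly_mapping_eqI) (simp add: lookup_mono_filter lookup_add)

lemma mono_filter_sum: "mono_filter P (\<Sum>i\<in>A. f i) = (\<Sum>i\<in>A. mono_filter P (f i))"
  by (induction A rule: infinite_finite_induct) (simp_all add: mono_filter_add)

lemma mono_filter_split: "p = mono_filter P p + mono_filter (\<lambda>m. \<not> P m) p"
  by (rule poly_mapping_eqI) (simp add: lookup_mono_filter lookup_add)

lemma mono_filter_id: "(\<And>m. m \<in> Poly_Mapping.keys p \<Longrightarrow> P m) \<Longrightarrow> mono_filter P p = p"
  by (rule poly_mapping_eqI) (auto simp: lookup_mono_filter in_keys_iff)

lemma mono_filter_eq_0: "(\<And>m. m \<in> Poly_Mapping.keys p \<Longrightarrow> \<not> P m) \<Longrightarrow> mono_filter P p = 0"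
  by (rule poly_mapping_eqI) (auto simp: lookup_mono_filter in_keys_iff)

lemma keys_multD:
  "m \<in> Poly_Mapping.keys (p * q) \<Longrightarrow>
    \<exists>a b. m = a + b \<and> a \<in> Poly_Mapping.keys p \<and> b \<in> Poly_Mapping.keys q"
  using keys_mult[of p q] by blast

text \<open>The hypothesis makes the monomials outside \<open>P\<close> span an ideal, with a
  multiplicatively closed complement, so the projection is multiplicative. This serves for setting
  variables to 0 and for taking constant coefficients.\<close>

lemma mono_filter_mult:
  assumes "\<And>m n. P (m + n) \<longleftrightarrow> P m \<and> P n"
  shows "mono_filter P (p * q) = mono_filter P p * mono_filter P q"
proof -
  let ?f = "mono_filter P" and ?g = "mono_filter (\<lambda>m. \<not> P m)"
  have "p * q = ?f p * ?f q + (?f p * ?g q + ?g p * q)"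
    using mono_filter_split[of p P] mono_filter_split[of q P]
    by (metis (no_types, lifting) add.assoc distrib_left distrib_right)
  moreover have "?f (?f p * ?f q) = ?f p * ?f q"
    by (rule mono_filter_id) (auto dest!: keys_multD simp: keys_mono_filter assms)
  moreover have "?f (?f p * ?g q + ?g p * q) = 0"
    by (rule mono_filter_eq_0)
      (auto dest!: subsetD[OF keys_add] keys_multD simp: keys_mono_filter assms)
  ultimately show ?thesis by (metis mono_filter_add add.right_neutral)
qed

lemma keys_nat_add:
  fixes m n :: "'v \<Rightarrow>\<^sub>0 nat"
  shows "Poly_Mapping.keys (m + n) = Poly_Mapping.keys m \<union> Poly_Mapping.keys n"
  by (auto simp: in_keys_iff lookup_add)

lemma mono_degree_add: "mono_degree (m + n) = mono_degree m + mono_degree n"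
proof -
  let ?K = "Poly_Mapping.keys m \<union> Poly_Mapping.keys n"
  have *: "mono_degree k = (\<Sum>v\<in>?K. Poly_Mapping.lookup k v)" if "Poly_Mapping.keys k \<subseteq> ?K"
    for k :: "'a \<Rightarrow>\<^sub>0 nat"
    unfolding mono_degree_def using that by (intro sum.mono_neutral_left) (auto simp: in_keys_iff)
  show ?thesis
    by (subst (1 2 3) *) (auto simp: keys_nat_add lookup_add sum.distrib)
qed

lemma mono_degree_0 [simp]: "mono_degree 0 = 0"
  by (simp add: mono_degree_def)

lemma polys_0 [simp]: "0 \<in> polys V"
  by (simp add: polys_def)

lemma polys_1 [simp]: "1 \<in> polys V"
  by (simp add: polys_def)

lemma polys_add: "p \<in> polys V \<Longrightarrow> q \<in> polys V \<Longrightarrow> p + q \<in> polys V"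
  unfolding polys_def using keys_add[of p q] by blast

lemma polys_uminus: "p \<in> polys V \<Longrightarrow> - p \<in> polys V"
  by (simp add: polys_def in_keys_iff)

lemma polys_diff: "p \<in> polys V \<Longrightarrow> q \<in> polys V \<Longrightarrow> p - q \<in> polys V"
  using polys_add[of p V "- q"] polys_uminus[of q V] by simp

lemma polys_mult: "p \<in> polys V \<Longrightarrow> q \<in> polys V \<Longrightarrow> p * q \<in> polys V"
  unfolding polys_def by (auto dest!: keys_multD simp: keys_nat_add; blast)

lemma polys_sum: "(\<And>i. i \<in> A \<Longrightarrow> f i \<in> polys V) \<Longrightarrow> (\<Sum>i\<in>A. f i) \<in> polys V"
  by (induction A rule: infinite_finite_induct) (simp_all add: polys_add)

lemma polys_mono: "V \<subseteq> W \<Longrightarrow> polys V \<subseteq> polys W"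
  by (auto simp: polys_def)

lemma polys_mono_filter: "p \<in> polys V \<Longrightarrow> mono_filter P p \<in> polys V"
  by (simp add: polys_def keys_mono_filter)

lemma homogeneous_0 [simp]: "homogeneous d 0"
  by (simp add: homogeneous_def)

lemma homogeneous_1 [simp]: "homogeneous 0 1"
  by (simp add: homogeneous_def)

lemma homogeneous_add: "homogeneous d p \<Longrightarrow> homogeneous d q \<Longrightarrow> homogeneous d (p + q)"
  unfolding homogeneous_def using keys_add[of p q] by blast

lemma homogeneous_uminus: "homogeneous d p \<Longrightarrow> homogeneous d (- p)"
  by (simp add: homogeneous_def in_keys_iff)

lemma homogeneous_diff: "homogeneous d p \<Longrightarrow> homogeneous d q \<Longrightarrow> homogeneous d (p - q)"
  using homogeneous_add[of d p "- q"] homogeneous_uminus[of d q] by simp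

lemma homogeneous_mult:
  "homogeneous d p \<Longrightarrow> homogeneous e q \<Longrightarrow> homogeneous (d + e) (p * q)"
  unfolding homogeneous_def by (auto dest!: keys_multD simp: mono_degree_add)

lemma homogeneous_sum:
  "(\<And>i. i \<in> A \<Longrightarrow> homogeneous d (f i)) \<Longrightarrow> homogeneous d (\<Sum>i\<in>A. f i)"
  by (induction A rule: infinite_finite_induct) (simp_all add: homogeneous_add)

lemma homogeneous_mono_filter: "homogeneous d p \<Longrightarrow> homogeneous d (mono_filter P p)"
  by (simp add: homogeneous_def keys_mono_filter)

section \<open>Homogeneous components and constant coefficients\<close>

definition hom_comp :: "int \<Rightarrow> ('v, 'k::field) mpoly \<Rightarrow> ('v, 'k) mpoly" where
  "hom_comp d = mono_filter (\<lambda>m. int (mono_degree m) = d)"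

lemma homogeneous_hom_comp: "homogeneous d (hom_comp d p)"
  by (simp add: homogeneous_def hom_comp_def keys_mono_filter)

lemma hom_comp_id: "homogeneous d p \<Longrightarrow> hom_comp d p = p"
  unfolding hom_comp_def by (rule mono_filter_id) (simp add: homogeneous_def)

lemma hom_comp_sum: "hom_comp d (\<Sum>i\<in>A. f i) = (\<Sum>i\<in>A. hom_comp d (f i))"
  by (simp add: hom_comp_def mono_filter_sum)

lemma hom_comp_mult:
  assumes "homogeneous e q"
  shows "hom_comp d (p * q) = hom_comp (d - e) p * q"
proof -
  let ?P = "\<lambda>m. int (mono_degree m) = d - e"
  have "p * q = hom_comp (d - e) p * q + mono_filter (\<lambda>m. \<not> ?P m) p * q"
    unfolding hom_comp_def by (metis mono_filter_split distrib_right)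
  moreover have "hom_comp d (hom_comp (d - e) p * q) = hom_comp (d - e) p * q"
    using homogeneous_mult[OF homogeneous_hom_comp assms, of "d - e" p] by (simp add: hom_comp_id)
  moreover have "hom_comp d (mono_filter (\<lambda>m. \<not> ?P m) p * q) = 0"
    unfolding hom_comp_def using assms
    by (intro mono_filter_eq_0)
      (auto dest!: keys_multD simp: keys_mono_filter mono_degree_add homogeneous_def)
  ultimately show ?thesis
    by (metis (no_types, lifting) hom_comp_def mono_filter_add add.right_neutral)
qed

lemma const_coeff_0 [simp]: "const_coeff 0 = 0"
  by (simp add: const_coeff_def)

lemma const_coeff_1 [simp]: "const_coeff 1 = 1"
  by (simp add: const_coeff_def)

lemma const_coeff_uminus: "const_coeff (- p) = - const_coeff p"
  by (simp add: const_coeff_def)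

lemma const_coeff_diff: "const_coeff (p - q) = const_coeff p - const_coeff q"
  by (simp add: const_coeff_def lookup_minus)

lemma const_coeff_sum: "const_coeff (\<Sum>i\<in>A. f i) = (\<Sum>i\<in>A. const_coeff (f i))"
  by (simp add: const_coeff_def lookup_sum)

text \<open>A sum of exponent vectors vanishes only if both do, so this is
  \<open>mono_filter_mult\<close> for the monomial 1.\<close>

lemma const_coeff_mult:
  fixes p q :: "('v, 'k::field) mpoly"
  shows "const_coeff (p * q) = const_coeff p * const_coeff q"
proof -
  have z: "m + n = 0 \<longleftrightarrow> m = 0 \<and> n = 0" for m n :: "'v \<Rightarrow>\<^sub>0 nat"
    by (metis Un_empty keys_eq_empty keys_nat_add)
  have *: "mono_filter (\<lambda>m. m = 0) p = Poly_Mapping.single 0 (const_coeff p)"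
    for p :: "('v, 'k) mpoly"
    by (rule poly_mapping_eqI) (auto simp: lookup_mono_filter const_coeff_def lookup_single when_def)
  have "Poly_Mapping.single 0 (const_coeff (p * q)) =
      Poly_Mapping.single (0::'v \<Rightarrow>\<^sub>0 nat) (const_coeff p * const_coeff q)"
    using mono_filter_mult[of "\<lambda>m. m = 0" p q] by (simp add: * z mult_single)
  then show ?thesis by (metis lookup_single_eq)
qed

lemma const_coeff_mono_filter: "P 0 \<Longrightarrow> const_coeff (mono_filter P p) = const_coeff p"
  by (simp add: const_coeff_def lookup_mono_filter)

lemma homogeneous_const_coeff: "homogeneous d p \<Longrightarrow> const_coeff p \<noteq> 0 \<Longrightarrow> d = 0"
  by (auto simp: homogeneous_def const_coeff_def in_keys_iff dest!: bspec[of _ _ 0])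

subsection \<open>Matrices, resolutions and the comparison of resolutions\<close>

definition mm :: "nat \<Rightarrow> (nat \<Rightarrow> nat \<Rightarrow> 'a) \<Rightarrow> (nat \<Rightarrow> nat \<Rightarrow> 'a) \<Rightarrow> nat \<Rightarrow> nat \<Rightarrow> 'a::comm_ring_1" where
  "mm n A B = (\<lambda>a c. \<Sum>b<n. A a b * B b c)"

definition mv :: "nat \<Rightarrow> (nat \<Rightarrow> nat \<Rightarrow> 'a) \<Rightarrow> (nat \<Rightarrow> 'a) \<Rightarrow> nat \<Rightarrow> 'a::comm_ring_1" where
  "mv n A f = (\<lambda>a. \<Sum>b<n. A a b * f b)"

definition idm :: "nat \<Rightarrow> nat \<Rightarrow> nat \<Rightarrow> 'a::comm_ring_1" where
  "idm n = (\<lambda>a b. if a = b \<and> a < n then 1 else 0)"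

lemma mm_assoc: "mm m A (mm n B C) = mm n (mm m A B) C"
proof (intro ext)
  fix a c
  have "(\<Sum>i<m. \<Sum>j<n. A a i * (B i j * C j c)) = (\<Sum>j<n. \<Sum>i<m. A a i * (B i j * C j c))"
    by (rule sum.swap)
  then show "mm m A (mm n B C) a c = mm n (mm m A B) C a c"
    by (simp add: mm_def sum_distrib_left sum_distrib_right mult.assoc)
qed

lemma mv_mm: "mv m A (mv n B f) = mv n (mm m A B) f"
  using mm_assoc[of m A n B "\<lambda>a _. f a"] by (simp add: mm_def mv_def fun_eq_iff)

lemma mm_mv_column: "mm n A B = 0 \<Longrightarrow> mv n A (\<lambda>b. B b c) = 0"
  by (simp add: mm_def mv_def fun_eq_iff)

lemma mm_diff_left: "mm n (A - A') B = mm n A B - mm n A' B"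
  by (simp add: mm_def fun_eq_iff left_diff_distrib sum_subtractf)

lemma mm_diff_right: "mm n A (B - B') = mm n A B - mm n A B'"
  by (simp add: mm_def fun_eq_iff right_diff_distrib sum_subtractf)

lemma mv_add: "mv n A (f + g) = mv n A f + mv n A g"
  by (simp add: mv_def fun_eq_iff distrib_left sum.distrib)

lemma mv_diff: "mv n A (f - g) = mv n A f - mv n A g"
  by (simp add: mv_def fun_eq_iff right_diff_distrib sum_subtractf)

lemma mv_diff_left: "mv n (A - B) f = mv n A f - mv n B f"
  by (simp add: mv_def fun_eq_iff left_diff_distrib sum_subtractf)

lemma mv_uminus: "mv n A (- f) = - mv n A f"
  by (simp add: mv_def fun_eq_iff sum_negf fun_Compl_def)

lemma mv_0_right [simp]: "mv n A 0 = 0"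
  by (simp add: mv_def fun_eq_iff)

lemma mv_0_left [simp]: "mv n 0 f = 0"
  by (simp add: mv_def fun_eq_iff)

lemma mm_0_right [simp]: "mm n A 0 = 0"
  by (simp add: mm_def fun_eq_iff)

lemma mm_0_left [simp]: "mm n 0 A = 0"
  by (simp add: mm_def fun_eq_iff)

lemma mm_idm_left:
  assumes "\<And>a b. A a b \<noteq> 0 \<Longrightarrow> a < n"
  shows "mm n (idm n) A = A"
proof (intro ext)
  fix a c
  have "mm n (idm n) A a c = (\<Sum>b<n. if b = a then A b c else 0)"
    unfolding mm_def idm_def by (intro sum.cong) auto
  also have "\<dots> = A a c" using assms[of a c] by (cases "a < n") auto
  finally show "mm n (idm n) A a c = A a c" .
qed

lemma mm_idm_right:
  assumes "\<And>a b. A a b \<noteq> 0 \<Longrightarrow> b < n"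
  shows "mm n A (idm n) = A"
proof (intro ext)
  fix a c
  have "mm n A (idm n) a c = (\<Sum>b<n. if b = c then A a b else 0)"
    unfolding mm_def idm_def by (intro sum.cong) auto
  also have "\<dots> = A a c" using assms[of a c] by (cases "c < n") auto
  finally show "mm n A (idm n) a c = A a c" .
qed

lemma mv_idm: "(\<And>a. f a \<noteq> 0 \<Longrightarrow> a < n) \<Longrightarrow> mv n (idm n) f = f"
  using mm_idm_left[of "\<lambda>a _. f a" n] by (simp add: mm_def mv_def fun_eq_iff)

text \<open>Matrix of a degree-0 map of graded free modules, with basis degrees \<open>s\<close> in
  the target and \<open>t\<close> in the source. Vanishing outside the \<open>r\<close> by
  \<open>c\<close> block lets identities of maps be plain equations between functions.\<close>

definition hmat :: "'v set \<Rightarrow> nat \<Rightarrow> (nat \<Rightarrow> int) \<Rightarrow> nat \<Rightarrow> (nat \<Rightarrow> int)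
    \<Rightarrow> (nat \<Rightarrow> nat \<Rightarrow> ('v, 'k::field) mpoly) \<Rightarrow> bool" where
  "hmat V r s c t A \<longleftrightarrow> (\<forall>a b. A a b \<in> polys V \<and> homogeneous (t b - s a) (A a b) \<and>
     (A a b \<noteq> 0 \<longrightarrow> a < r \<and> b < c))"

lemma hmatD:
  assumes "hmat V r s c t A"
  shows "A a b \<in> polys V" "homogeneous (t b - s a) (A a b)" "r \<le> a \<Longrightarrow> A a b = 0" "c \<le> b \<Longrightarrow> A a b = 0"
  using assms by (force simp: hmat_def)+

lemma hmat_0 [simp]: "hmat V r s c t 0"
  by (simp add: hmat_def)

lemma hmat_idm: "hmat V n s n s (idm n)"
  by (simp add: hmat_def idm_def)

lemma hmat_diff:
  assumes "hmat V r s c t A" "hmat V r s c t B"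
  shows "hmat V r s c t (A - B)"
  unfolding hmat_def
proof (intro allI conjI impI)
  fix a b
  show "(A - B) a b \<in> polys V" "homogeneous (t b - s a) ((A - B) a b)"
    using assms by (auto simp: hmat_def polys_diff homogeneous_diff)
  assume "(A - B) a b \<noteq> 0"
  then have "A a b \<noteq> 0 \<or> B a b \<noteq> 0" by auto
  with assms show "a < r" "b < c" by (auto simp: hmat_def)
qed

lemma hmat_mm:
  assumes "hmat V r s n t A" "hmat V n t c u B"
  shows "hmat V r s c u (mm n A B)"
  unfolding hmat_def
proof (intro allI conjI impI)
  fix a b
  show "mm n A B a b \<in> polys V"
    using assms unfolding mm_def by (intro polys_sum polys_mult) (auto simp: hmat_def)
  show "homogeneous (u b - s a) (mm n A B a b)"
    unfolding mm_def
  proof (intro homogeneous_sum)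
    fix k
    show "homogeneous (u b - s a) (A a k * B k b)"
      using homogeneous_mult[of "t k - s a" "A a k" "u b - t k" "B k b"] assms
      by (simp add: hmat_def)
  qed
  assume nz: "mm n A B a b \<noteq> 0"
  show "a < r" using nz assms(1) unfolding mm_def hmat_def
    by (metis (no_types, lifting) mult_zero_left sum.neutral)
  show "b < c" using nz assms(2) unfolding mm_def hmat_def
    by (metis (no_types, lifting) mult_zero_right sum.neutral)
qed

lemma hmat_mono: "hmat W r s c t A \<Longrightarrow> W \<subseteq> V \<Longrightarrow> hmat V r s c t A"
  unfolding hmat_def using polys_mono by blast

lemma free_module_0 [simp]: "0 \<in> free_module V r"
  by (simp add: free_module_def)

lemma free_module_diff: "f \<in> free_module V r \<Longrightarrow> g \<in> free_module V r \<Longrightarrow> f - g \<in> free_module V r"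
  by (simp add: free_module_def polys_diff)

lemma free_module_uminus: "f \<in> free_module V r \<Longrightarrow> - f \<in> free_module V r"
  by (simp add: free_module_def polys_uminus)

lemma free_module_polys: "f \<in> free_module V r \<Longrightarrow> f a \<in> polys V"
  by (cases "a < r") (simp_all add: free_module_def)

lemma free_module_less: "f \<in> free_module V r \<Longrightarrow> f a \<noteq> 0 \<Longrightarrow> a < r"
  by (metis (mono_tags, lifting) free_module_def mem_Collect_eq not_le)

lemma mv_free_module:
  assumes "hmat V r s c t A" "f \<in> free_module V c"
  shows "mv c A f \<in> free_module V r"
proof -
  have "mv c A f a \<in> polys V" for a
    unfolding mv_def using assms free_module_polys[OF assms(2)]
    by (intro polys_sum polys_mult) (auto simp: hmat_def)
  moreover have "mv c A f a = 0" if "a \<ge> r" for a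
    unfolding mv_def using hmatD(3)[OF assms(1) that] by simp
  ultimately show ?thesis by (simp add: free_module_def)
qed

lemma column_free_module: "hmat V r s c t A \<Longrightarrow> (\<lambda>a. A a b) \<in> free_module V r"
  by (simp add: free_module_def hmatD)

text \<open>
  Complexes are augmented: position \<open>0\<close> is the ring \<open>S\<close> itself, and position \<open>i + 1\<close>
  is the free module \<open>F\<^sub>i\<close>.
\<close>

definition cpx :: "'v set \<Rightarrow> (nat \<Rightarrow> nat) \<Rightarrow> (nat \<Rightarrow> nat \<Rightarrow> int)
    \<Rightarrow> (nat \<Rightarrow> nat \<Rightarrow> nat \<Rightarrow> ('v, 'k::field) mpoly) \<Rightarrow> bool" where
  "cpx V n s d \<longleftrightarrow> n 0 = 1 \<and>
     (\<forall>i. hmat V (n i) (s i) (n (Suc i)) (s (Suc i)) (d i)) \<and>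
     (\<forall>i. mm (n (Suc i)) (d i) (d (Suc i)) = 0)"

text \<open>Position 0 has no outgoing map. Asking for a value in \<open>M\<close> there makes
  exactness say that \<open>d 0\<close> has image \<open>M\<close>, so \<open>resol\<close>
  describes a resolution of \<open>S/M\<close>, one position ahead of that of
  \<open>M\<close>.\<close>

definition cyc :: "('v, 'k::field) mpoly set \<Rightarrow> (nat \<Rightarrow> nat)
    \<Rightarrow> (nat \<Rightarrow> nat \<Rightarrow> nat \<Rightarrow> ('v, 'k) mpoly) \<Rightarrow> nat \<Rightarrow> (nat \<Rightarrow> ('v, 'k) mpoly) \<Rightarrow> bool" where
  "cyc M n d i f \<longleftrightarrow> (case i of 0 \<Rightarrow> f 0 \<in> M | Suc j \<Rightarrow> mv (n i) (d j) f = 0)"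

definition resol :: "'v set \<Rightarrow> ('v, 'k::field) mpoly set \<Rightarrow> (nat \<Rightarrow> nat)
    \<Rightarrow> (nat \<Rightarrow> nat \<Rightarrow> int) \<Rightarrow> (nat \<Rightarrow> nat \<Rightarrow> nat \<Rightarrow> ('v, 'k) mpoly) \<Rightarrow> bool" where
  "resol V M n s d \<longleftrightarrow> cpx V n s d \<and> s 0 0 = 0 \<and>
     (\<forall>i. \<forall>f\<in>free_module V (n i).
        cyc M n d i f \<longleftrightarrow> (\<exists>g\<in>free_module V (n (Suc i)). f = mv (n (Suc i)) (d i) g))"

lemma resolD:
  assumes "resol V M n s d"
  shows "cpx V n s d" "s 0 0 = 0" "n 0 = 1"
    "hmat V (n i) (s i) (n (Suc i)) (s (Suc i)) (d i)"
    "mm (n (Suc i)) (d i) (d (Suc i)) = 0"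
  using assms by (simp_all add: resol_def cpx_def)

lemma resol_exact:
  assumes "resol V M n s d" "f \<in> free_module V (n i)" "cyc M n d i f"
  obtains g where "g \<in> free_module V (n (Suc i))" "f = mv (n (Suc i)) (d i) g"
  using assms unfolding resol_def by blast

lemma unit_vector:
  assumes "b < n"
  shows "(\<lambda>c. if c = b then 1 else 0) \<in> free_module V n"
    "mv n A (\<lambda>c. if c = b then 1 else 0) = (\<lambda>a. A a b)"
  using assms by (auto simp: free_module_def mv_def if_distrib[of "\<lambda>x. _ * x"] cong: if_cong)

lemma resol_aug_in:
  assumes "resol V M n s d"
  shows "d 0 0 b \<in> M"
proof -
  have *: "mv (n 1) (d 0) g 0 \<in> M" if "g \<in> free_module V (n 1)" for g
  proof -
    have "mv (n 1) (d 0) g \<in> free_module V (n 0)"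
      using mv_free_module[OF resolD(4)[OF assms] that[unfolded One_nat_def]] by simp
    then have "cyc M n d 0 (mv (n 1) (d 0) g)"
      using assms that unfolding resol_def One_nat_def by blast
    then show ?thesis by (simp add: cyc_def)
  qed
  show ?thesis
  proof (cases "b < n 1")
    case True
    show ?thesis using *[OF unit_vector(1)[OF True]] unfolding unit_vector(2)[OF True] .
  next
    case False
    then have "d 0 0 b = 0" using resolD(4)[OF assms, of 0] by (auto simp: hmat_def)
    with *[of 0] show ?thesis by simp
  qed
qed

text \<open>Exactness lifts each column, but possibly not in a graded way. Passing to the component
  of the required degree in every entry keeps the product, because \<open>Z\<close> and
  \<open>d i\<close> are homogeneous.\<close>

lemma lift_matrix:
  assumes R: "resol V M n s d" and Z: "hmat V (n i) (s i) c t Z"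
    and cyc: "\<And>b. b < c \<Longrightarrow> cyc M n d i (\<lambda>a. Z a b)"
  obtains Y where "hmat V (n (Suc i)) (s (Suc i)) c t Y" "mm (n (Suc i)) (d i) Y = Z"
proof -
  have "\<exists>g. g \<in> free_module V (n (Suc i)) \<and> (\<lambda>a. Z a b) = mv (n (Suc i)) (d i) g" if "b < c" for b
    using resol_exact[OF R column_free_module[OF Z] cyc[OF that]] by metis
  then obtain g where g: "\<And>b. b < c \<Longrightarrow> g b \<in> free_module V (n (Suc i))"
    "\<And>b. b < c \<Longrightarrow> (\<lambda>a. Z a b) = mv (n (Suc i)) (d i) (g b)"
    by metis
  define Y where "Y = (\<lambda>k b. if b < c then hom_comp (t b - s (Suc i) k) (g b k) else 0)"
  have "hmat V (n (Suc i)) (s (Suc i)) c t Y"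
    unfolding hmat_def
  proof (intro allI conjI impI)
    fix a b
    show "Y a b \<in> polys V" "homogeneous (t b - s (Suc i) a) (Y a b)"
      using free_module_polys[OF g(1)[of b]]
      by (simp_all add: Y_def homogeneous_hom_comp)
        (simp add: hom_comp_def polys_mono_filter)
    assume "Y a b \<noteq> 0"
    then show "b < c" "a < n (Suc i)"
      using free_module_less[OF g(1), of b a] unfolding Y_def hom_comp_def
      by (metis mono_filter_0)+
  qed
  moreover have "mm (n (Suc i)) (d i) Y = Z"
  proof (intro ext)
    fix a b
    show "mm (n (Suc i)) (d i) Y a b = Z a b"
    proof (cases "b < c")
      case True
      have "Z a b = hom_comp (t b - s i a) (Z a b)"
        using Z by (simp add: hmat_def hom_comp_id)
      also have "\<dots> = hom_comp (t b - s i a) (\<Sum>k<n (Suc i). g b k * d i a k)"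
        using fun_cong[OF g(2)[OF True], of a] by (simp add: mv_def mult.commute)
      also have "\<dots> = (\<Sum>k<n (Suc i). hom_comp (t b - s i a) (g b k * d i a k))"
        by (rule hom_comp_sum)
      also have "\<dots> = (\<Sum>k<n (Suc i). d i a k * Y k b)"
      proof (rule sum.cong)
        fix k
        have "homogeneous (s (Suc i) k - s i a) (d i a k)"
          using resolD(4)[OF R, of i] by (simp add: hmat_def)
        from hom_comp_mult[OF this, of "t b - s i a" "g b k"]
        show "hom_comp (t b - s i a) (g b k * d i a k) = d i a k * Y k b"
          using True by (simp add: Y_def mult.commute)
      qed simp
      finally show ?thesis by (simp add: mm_def)
    next
      case False
      then show ?thesis using Z by (auto simp: mm_def Y_def hmat_def)
    qed
  qed
  ultimately show ?thesis by (rule that)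
qed

section \<open>Comparison of resolutions: chain maps and homotopies\<close>

definition chain_map :: "'v set \<Rightarrow> (nat \<Rightarrow> nat) \<Rightarrow> (nat \<Rightarrow> nat \<Rightarrow> int)
    \<Rightarrow> (nat \<Rightarrow> nat \<Rightarrow> nat \<Rightarrow> ('v, 'k::field) mpoly) \<Rightarrow> (nat \<Rightarrow> nat) \<Rightarrow> (nat \<Rightarrow> nat \<Rightarrow> int)
    \<Rightarrow> (nat \<Rightarrow> nat \<Rightarrow> nat \<Rightarrow> ('v, 'k) mpoly) \<Rightarrow> (nat \<Rightarrow> nat \<Rightarrow> nat \<Rightarrow> ('v, 'k) mpoly) \<Rightarrow> bool" where
  "chain_map V nG sG dG nF sF dF \<phi> \<longleftrightarrow>
     (\<forall>i. hmat V (nF i) (sF i) (nG i) (sG i) (\<phi> i)) \<and>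
     (\<forall>i. mm (nF (Suc i)) (dF i) (\<phi> (Suc i)) = mm (nG i) (\<phi> i) (dG i))"

definition mat1 :: "'a \<Rightarrow> nat \<Rightarrow> nat \<Rightarrow> 'a::comm_ring_1" where
  "mat1 u = (\<lambda>a b. if a = 0 \<and> b = 0 then u else 0)"

text \<open>Comparison theorem: the target is exact, so each composite with the next differential,
  being a cycle, lifts. Multiplication by \<open>u = 1\<close> compares resolutions; a monomial
  \<open>u\<close>, its degree absorbed in \<open>sG\<close>, gives the map whose cone is
  taken.\<close>

lemma chain_map_exists:
  assumes G: "cpx V nG sG dG" and R: "resol V M nF sF dF"
    and u: "u \<in> polys V" "homogeneous (sG 0 0) u" "\<And>b. u * dG 0 0 b \<in> M"
  obtains \<phi> where "chain_map V nG sG dG nF sF dF \<phi>" "\<phi> 0 = mat1 u"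
proof -
  have dG: "hmat V (nG i) (sG i) (nG (Suc i)) (sG (Suc i)) (dG i)"
    and ddG: "mm (nG (Suc i)) (dG i) (dG (Suc i)) = 0" and nG0: "nG 0 = 1" for i
    using G by (simp_all add: cpx_def)
  define P where "P = (\<lambda>i \<phi>. hmat V (nF i) (sF i) (nG i) (sG i) \<phi> \<and>
    (\<forall>b. cyc M nF dF i (\<lambda>a. mm (nG i) \<phi> (dG i) a b)) \<and> (i = 0 \<longrightarrow> \<phi> = mat1 u))"
  define Q where "Q = (\<lambda>i \<phi> \<phi>'. mm (nF (Suc i)) (dF i) \<phi>' = mm (nG i) \<phi> (dG i))"
  have "P 0 (mat1 u)"
    using u resolD(2,3)[OF R] nG0
    by (auto simp: P_def hmat_def mat1_def cyc_def mm_def)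
  moreover have "\<exists>\<phi>'. P (Suc i) \<phi>' \<and> Q i \<phi> \<phi>'" if P: "P i \<phi>" for i \<phi>
  proof -
    have "hmat V (nF i) (sF i) (nG (Suc i)) (sG (Suc i)) (mm (nG i) \<phi> (dG i))"
      using P dG unfolding P_def by (blast intro: hmat_mm)
    then obtain \<phi>' where \<phi>': "hmat V (nF (Suc i)) (sF (Suc i)) (nG (Suc i)) (sG (Suc i)) \<phi>'"
      "mm (nF (Suc i)) (dF i) \<phi>' = mm (nG i) \<phi> (dG i)"
      using lift_matrix[OF R] P unfolding P_def by metis
    have "mm (nF (Suc i)) (dF i) (mm (nG (Suc i)) \<phi>' (dG (Suc i))) = 0"
      by (simp add: mm_assoc \<phi>'(2)) (simp add: mm_assoc[symmetric] ddG)
    then have "cyc M nF dF (Suc i) (\<lambda>a. mm (nG (Suc i)) \<phi>' (dG (Suc i)) a b)" for b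
      by (simp add: cyc_def mm_mv_column)
    with \<phi>' show ?thesis by (auto simp: P_def Q_def)
  qed
  ultimately obtain \<phi> where "\<And>i. P i (\<phi> i) \<and> Q i (\<phi> i) (\<phi> (Suc i))"
    using dependent_nat_choice[of P Q] by metis
  then have "chain_map V nG sG dG nF sF dF \<phi>" "\<phi> 0 = mat1 u"
    by (simp_all add: chain_map_def P_def Q_def)
  then show ?thesis by (rule that)
qed

text \<open>Two lifts of the identity are homotopic. Since \<open>\<theta>\<close> is the identity
  in position 0, the homotopy can start with the zero map.\<close>

lemma homotopy_exists:
  assumes R: "resol V M n s d" and \<theta>: "chain_map V n s d n s d \<theta>" "\<theta> 0 = idm 1"
  obtains h where "\<And>i. hmat V (n (Suc i)) (s (Suc i)) (n i) (s i) (h i)"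
    "\<And>i. mm (n (Suc (Suc i))) (d (Suc i)) (h (Suc i)) =
      \<theta> (Suc i) - idm (n (Suc i)) - mm (n i) (h i) (d i)"
proof -
  note d = resolD(4)[OF R] and dd = resolD(5)[OF R]
  have \<theta>1: "hmat V (n i) (s i) (n i) (s i) (\<theta> i)"
    and \<theta>2: "mm (n (Suc i)) (d i) (\<theta> (Suc i)) = mm (n i) (\<theta> i) (d i)" for i
    using \<theta>(1) by (simp_all add: chain_map_def)
  have dl: "mm (n i) (idm (n i)) (d i) = d i" and dr: "mm (n (Suc i)) (d i) (idm (n (Suc i))) = d i" for i
    using d[of i] by (auto simp: hmat_def intro!: mm_idm_left mm_idm_right)
  \<comment> \<open>The part of \<open>\<theta> - id\<close> in position \<open>i + 1\<close> not
    yet accounted for by the homotopy. It is a cycle, and its lift is the next homotopy.\<close>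
  define E where "E = (\<lambda>i h. \<theta> (Suc i) - idm (n (Suc i)) - mm (n i) h (d i))"
  define P where "P = (\<lambda>i h. hmat V (n (Suc i)) (s (Suc i)) (n i) (s i) h \<and>
    mm (n (Suc i)) (d i) (E i h) = 0)"
  define Q where "Q = (\<lambda>i h h'. mm (n (Suc (Suc i))) (d (Suc i)) h' = E i h)"
  have "P 0 0"
    using dl[of 0] dr[of 0] by (simp add: P_def E_def mm_diff_right \<theta>2 \<theta>(2) resolD(3)[OF R])
  moreover have "\<exists>h'. P (Suc i) h' \<and> Q i h h'" if P: "P i h" for i h
  proof -
    have "hmat V (n (Suc i)) (s (Suc i)) (n (Suc i)) (s (Suc i)) (E i h)"
      using P d unfolding E_def P_def by (blast intro: hmat_diff hmat_idm \<theta>1 hmat_mm)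
    moreover have "cyc M n d (Suc i) (\<lambda>a. E i h a b)" for b
      using P by (simp add: cyc_def P_def mm_mv_column)
    ultimately obtain h' where h': "hmat V (n (Suc (Suc i))) (s (Suc (Suc i))) (n (Suc i)) (s (Suc i)) h'"
      "mm (n (Suc (Suc i))) (d (Suc i)) h' = E i h"
      using lift_matrix[OF R] by metis
    have E: "E (Suc i) h' = \<theta> (Suc (Suc i)) - idm (n (Suc (Suc i))) - mm (n (Suc i)) h' (d (Suc i))"
      by (simp add: E_def)
    have "mm (n (Suc (Suc i))) (d (Suc i)) (E (Suc i) h') =
        mm (n (Suc i)) (\<theta> (Suc i)) (d (Suc i)) - d (Suc i) - mm (n (Suc i)) (E i h) (d (Suc i))"
      unfolding E mm_diff_right \<theta>2 mm_assoc h'(2) dr ..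
    also have "\<dots> = mm (n (Suc i)) (mm (n i) h (d i)) (d (Suc i))"
      by (simp add: E_def mm_diff_left dl)
    also have "\<dots> = 0" by (simp add: mm_assoc[symmetric] dd)
    finally show ?thesis using h' by (auto simp: P_def Q_def)
  qed
  ultimately obtain h where "\<And>i. P i (h i) \<and> Q i (h i) (h (Suc i))"
    using dependent_nat_choice[of P Q] by metis
  then have "hmat V (n (Suc i)) (s (Suc i)) (n i) (s i) (h i)"
    "mm (n (Suc (Suc i))) (d (Suc i)) (h (Suc i)) =
      \<theta> (Suc i) - idm (n (Suc i)) - mm (n i) (h i) (d i)" for i
    by (simp_all add: P_def Q_def E_def)
  then show ?thesis by (rule that)
qed

section \<open>Setting variables to zero and reducing to the residue field\<close>

definition restr :: "'v set \<Rightarrow> ('v, 'k::field) mpoly \<Rightarrow> ('v, 'k) mpoly" where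
  "restr W = mono_filter (\<lambda>m. Poly_Mapping.keys m \<subseteq> W)"

lemma restr_mult: "restr W (p * q) = restr W p * restr W q"
  unfolding restr_def by (rule mono_filter_mult) (simp add: keys_nat_add)

lemma restr_sum: "restr W (\<Sum>i\<in>A. f i) = (\<Sum>i\<in>A. restr W (f i))"
  by (simp add: restr_def mono_filter_sum)

lemma restr_in_polys: "restr W p \<in> polys W"
  by (simp add: restr_def polys_def keys_mono_filter)

lemma restr_id: "p \<in> polys W \<Longrightarrow> restr W p = p"
  unfolding restr_def by (rule mono_filter_id) (simp add: polys_def)

lemma restr_0 [simp]: "restr W 0 = 0"
  by (simp add: restr_def)

lemma const_coeff_restr: "const_coeff (restr W p) = const_coeff p"
  by (simp add: restr_def const_coeff_mono_filter)

lemma homogeneous_restr: "homogeneous d p \<Longrightarrow> homogeneous d (restr W p)"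
  by (simp add: restr_def homogeneous_mono_filter)

definition mrestr :: "'v set \<Rightarrow> (nat \<Rightarrow> nat \<Rightarrow> ('v, 'k::field) mpoly) \<Rightarrow> nat \<Rightarrow> nat \<Rightarrow> ('v, 'k) mpoly" where
  "mrestr W A = (\<lambda>a b. restr W (A a b))"

lemma mrestr_mm: "mrestr W (mm n A B) = mm n (mrestr W A) (mrestr W B)"
  by (simp add: mrestr_def mm_def restr_sum restr_mult)

lemma hmat_mrestr:
  assumes "hmat V r s c t A"
  shows "hmat W r s c t (mrestr W A)"
  unfolding hmat_def mrestr_def
proof (intro allI conjI impI)
  fix a b
  show "restr W (A a b) \<in> polys W" by (rule restr_in_polys)
  show "homogeneous (t b - s a) (restr W (A a b))" by (intro homogeneous_restr hmatD[OF assms])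
  assume "restr W (A a b) \<noteq> 0"
  then have "A a b \<noteq> 0" by auto
  with assms show "a < r" "b < c" by (auto simp: hmat_def)
qed

lemma mrestr_id: "hmat W r s c t A \<Longrightarrow> mrestr W A = A"
  by (simp add: mrestr_def hmat_def restr_id)

definition cc :: "(nat \<Rightarrow> nat \<Rightarrow> ('v, 'k::field) mpoly) \<Rightarrow> nat \<Rightarrow> nat \<Rightarrow> 'k" where
  "cc A = (\<lambda>a b. const_coeff (A a b))"

lemma cc_mm: "cc (mm n A B) = mm n (cc A) (cc B)"
  by (simp add: cc_def mm_def const_coeff_sum const_coeff_mult)

lemma cc_diff: "cc (A - B) = cc A - cc B"
  by (simp add: cc_def fun_eq_iff const_coeff_diff)

lemma cc_idm: "cc (idm n) = idm n"
  by (simp add: cc_def idm_def fun_eq_iff)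

lemma cc_mrestr: "cc (mrestr W A) = cc A"
  by (simp add: cc_def mrestr_def const_coeff_restr)

definition tpart :: "nat \<Rightarrow> (nat \<Rightarrow> int) \<Rightarrow> int \<Rightarrow> (nat \<Rightarrow> 'k::zero) set" where
  "tpart r s j = {w. \<forall>b. w b \<noteq> 0 \<longrightarrow> b < r \<and> s b = j}"

lemma tpart_diff: "v \<in> tpart r s j \<Longrightarrow> w \<in> tpart r s j \<Longrightarrow> v - w \<in> tpart r s j"
  for v w :: "nat \<Rightarrow> 'k::field"
  by (auto simp: tpart_def) (metis diff_0_right)+

text \<open>A homogeneous entry with nonzero constant coefficient has degree 0, so it links basis
  elements of equal degree only.\<close>

lemma cc_tpart:
  assumes A: "hmat V r s c t A" and w: "w \<in> tpart c t j"
  shows "mv c (cc A) w \<in> tpart r s j"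
proof -
  have "a < r \<and> s a = j" if "mv c (cc A) w a \<noteq> 0" for a
  proof -
    obtain b where "cc A a b * w b \<noteq> 0"
      using \<open>mv c (cc A) w a \<noteq> 0\<close> unfolding mv_def by (metis (no_types, lifting) sum.neutral)
    then have *: "cc A a b \<noteq> 0" "w b \<noteq> 0" by auto
    then have "t b = j" using w by (simp add: tpart_def)
    moreover have "t b - s a = 0"
      using hmatD(2)[OF A, of b a] *(1) unfolding cc_def by (rule homogeneous_const_coeff)
    moreover have "a < r"
      using hmatD(3)[OF A, of a b] *(1) by (cases "a < r") (auto simp: cc_def)
    ultimately show ?thesis by simp
  qed
  then show ?thesis by (simp add: tpart_def)
qed

text \<open>In position \<open>p\<close> of the augmented complex this is the vanishing of \<open>Tor\<^sub>p\<^sub>-\<^sub>1(M, k)\<^sub>j\<close>.\<close>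

definition hzero :: "(nat \<Rightarrow> nat) \<Rightarrow> (nat \<Rightarrow> nat \<Rightarrow> int)
    \<Rightarrow> (nat \<Rightarrow> nat \<Rightarrow> nat \<Rightarrow> ('v, 'k::field) mpoly) \<Rightarrow> nat \<Rightarrow> int \<Rightarrow> bool" where
  "hzero n s d p j \<longleftrightarrow> (\<forall>w\<in>tpart (n p) (s p) j.
     (\<forall>q. p = Suc q \<longrightarrow> mv (n p) (cc (d q)) w = 0) \<longrightarrow>
     (\<exists>v\<in>tpart (n (Suc p)) (s (Suc p)) j. w = mv (n (Suc p)) (cc (d p)) v))"

lemma cpx_mrestr:
  assumes "cpx V n s d"
  shows "cpx W n s (\<lambda>i. mrestr W (d i))"
  unfolding cpx_def
proof (intro conjI allI)
  fix i
  show "n 0 = 1" using assms by (simp add: cpx_def)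
  show "hmat W (n i) (s i) (n (Suc i)) (s (Suc i)) (mrestr W (d i))"
    using assms unfolding cpx_def by (blast intro: hmat_mrestr)
  have "mm (n (Suc i)) (d i) (d (Suc i)) = 0" using assms by (simp add: cpx_def)
  then show "mm (n (Suc i)) (mrestr W (d i)) (mrestr W (d (Suc i))) = 0"
    unfolding mrestr_mm[symmetric] by (simp add: mrestr_def fun_eq_iff)
qed

text \<open>
  If \<open>J\<close> is a retract of \<open>I\<close> along \<open>V \<rightarrow> W\<close> (variables outside \<open>W\<close> go to \<open>0\<close>), then
  \<open>Tor(J)\<close> is a direct summand of \<open>Tor(I)\<close>. For \<open>V = W\<close> and \<open>I = J\<close> this is the
  independence of \<open>Tor\<close> from the resolution.
\<close>

theorem hzero_retract:
  assumes F: "resol V I nF sF dF" and C: "resol W J nC sC dC"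
    and WV: "W \<subseteq> V" and JI: "J \<subseteq> I" and IJ: "restr W ` I \<subseteq> J"
    and hz: "hzero nF sF dF (Suc q) j"
  shows "hzero nC sC dC (Suc q) j"
proof -
  note C0 = resolD(1)[OF C] and dC = resolD(4)[OF C] and dF = resolD(4)[OF F]
  \<comment> \<open>The source of a comparison map only has to be a complex. This allows
    \<open>C\<close> over the larger ring here, and below the restriction of \<open>F\<close> to
    \<open>W\<close>, to be used without proving them exact.\<close>
  have CV: "cpx V nC sC dC"
    using C0 WV unfolding cpx_def by (blast intro: hmat_mono)
  obtain \<phi> where \<phi>: "chain_map V nC sC dC nF sF dF \<phi>" "\<phi> 0 = mat1 1"
    by (rule chain_map_exists[OF CV F, of 1]) (use resol_aug_in[OF C] JI resolD(2)[OF C] in auto)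
  obtain \<psi> where \<psi>: "chain_map W nF sF (\<lambda>i. mrestr W (dF i)) nC sC dC \<psi>" "\<psi> 0 = mat1 1"
    by (rule chain_map_exists[OF cpx_mrestr[OF resolD(1)[OF F]] C, of 1])
      (use resol_aug_in[OF F] IJ resolD(2)[OF F] in \<open>auto simp: mrestr_def\<close>)
  have \<phi>1: "hmat V (nF i) (sF i) (nC i) (sC i) (\<phi> i)"
    and \<phi>2: "mm (nF (Suc i)) (dF i) (\<phi> (Suc i)) = mm (nC i) (\<phi> i) (dC i)" for i
    using \<phi>(1) by (simp_all add: chain_map_def)
  have \<psi>1: "hmat W (nC i) (sC i) (nF i) (sF i) (\<psi> i)"
    and \<psi>2: "mm (nC (Suc i)) (dC i) (\<psi> (Suc i)) = mm (nF i) (\<psi> i) (mrestr W (dF i))" for i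
    using \<psi>(1) by (simp_all add: chain_map_def)
  \<comment> \<open>The restriction of \<open>\<phi>\<close>, followed by \<open>\<psi>\<close>: a
    lift of the identity of \<open>J\<close> over \<open>W\<close>.\<close>
  define \<theta> where "\<theta> = (\<lambda>i. mm (nF i) (\<psi> i) (mrestr W (\<phi> i)))"
  have "chain_map W nC sC dC nC sC dC \<theta>"
    unfolding chain_map_def
  proof (intro conjI allI)
    fix i
    show "hmat W (nC i) (sC i) (nC i) (sC i) (\<theta> i)"
      unfolding \<theta>_def by (rule hmat_mm[OF \<psi>1 hmat_mrestr[OF \<phi>1]])
    have "mm (nC (Suc i)) (dC i) (\<theta> (Suc i)) =
        mm (nF i) (\<psi> i) (mrestr W (mm (nF (Suc i)) (dF i) (\<phi> (Suc i))))"
      unfolding \<theta>_def mm_assoc \<psi>2 mrestr_mm ..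
    also have "\<dots> = mm (nC i) (\<theta> i) (dC i)"
      unfolding \<theta>_def \<phi>2 mrestr_mm mm_assoc mrestr_id[OF dC] ..
    finally show "mm (nC (Suc i)) (dC i) (\<theta> (Suc i)) = mm (nC i) (\<theta> i) (dC i)" .
  qed
  moreover have "\<theta> 0 = idm 1"
    using resolD(3)[OF F] by (auto simp: \<theta>_def \<phi>(2) \<psi>(2) mat1_def mm_def mrestr_def restr_id idm_def fun_eq_iff)
  ultimately obtain h where h: "\<And>i. hmat W (nC (Suc i)) (sC (Suc i)) (nC i) (sC i) (h i)"
    "\<And>i. mm (nC (Suc (Suc i))) (dC (Suc i)) (h (Suc i)) =
      \<theta> (Suc i) - idm (nC (Suc i)) - mm (nC i) (h i) (dC i)"
    using homotopy_exists[OF C] by metis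
  show ?thesis
    unfolding hzero_def
  proof (intro ballI impI)
    fix w :: "nat \<Rightarrow> 'b"
    let ?p = "Suc q"
    assume w: "w \<in> tpart (nC ?p) (sC ?p) j"
      and "\<forall>q'. ?p = Suc q' \<longrightarrow> mv (nC ?p) (cc (dC q')) w = 0"
    then have cyc: "mv (nC ?p) (cc (dC q)) w = 0" by simp
    define x where "x = mv (nC ?p) (cc (\<phi> ?p)) w"
    have "x \<in> tpart (nF ?p) (sF ?p) j"
      unfolding x_def by (rule cc_tpart[OF \<phi>1 w])
    moreover have "mv (nF ?p) (cc (dF q)) x = 0"
      unfolding x_def mv_mm cc_mm[symmetric] \<phi>2
      unfolding cc_mm mv_mm[symmetric] cyc by simp
    ultimately obtain v where v: "v \<in> tpart (nF (Suc ?p)) (sF (Suc ?p)) j"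
      "x = mv (nF (Suc ?p)) (cc (dF ?p)) v"
      using hz unfolding hzero_def by blast
    define y where "y = mv (nF (Suc ?p)) (cc (\<psi> (Suc ?p))) v"
    define z where "z = mv (nC ?p) (cc (h ?p)) w"
    have "mv (nC ?p) (cc (\<theta> ?p)) w = mv (nF ?p) (cc (\<psi> ?p)) x"
      unfolding \<theta>_def cc_mm cc_mrestr mv_mm[symmetric] x_def ..
    also have "\<dots> = mv (nF (Suc ?p)) (cc (mm (nF ?p) (\<psi> ?p) (mrestr W (dF ?p)))) v"
      unfolding v(2) mv_mm cc_mm cc_mrestr ..
    also have "\<dots> = mv (nC (Suc ?p)) (cc (dC ?p)) y"
      unfolding \<psi>2[symmetric] cc_mm mv_mm[symmetric] y_def ..
    finally have \<theta>w: "mv (nC ?p) (cc (\<theta> ?p)) w = mv (nC (Suc ?p)) (cc (dC ?p)) y" .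
    \<comment> \<open>The homotopy formula applied to \<open>w\<close>; its last term vanishes as
      \<open>w\<close> is a cycle, so \<open>w\<close> differs from its image under
      \<open>\<theta>\<close> by the boundary of \<open>z\<close>.\<close>
    have "mv (nC (Suc ?p)) (cc (dC ?p)) z =
        mv (nC ?p) (cc (\<theta> ?p - idm (nC ?p) - mm (nC q) (h q) (dC q))) w"
      unfolding z_def mv_mm cc_mm[symmetric] h(2) ..
    also have "\<dots> = mv (nC (Suc ?p)) (cc (dC ?p)) y - mv (nC ?p) (idm (nC ?p)) w
        - mv (nC q) (cc (h q)) (mv (nC ?p) (cc (dC q)) w)"
      unfolding cc_diff cc_idm cc_mm mv_diff_left \<theta>w mv_mm ..
    also have "mv (nC ?p) (idm (nC ?p)) w = w"
      using w by (intro mv_idm) (auto simp: tpart_def)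
    finally have "w = mv (nC (Suc ?p)) (cc (dC ?p)) (y - z)"
      unfolding cyc mv_diff mv_0_right by (simp add: fun_eq_iff)
    moreover have "y - z \<in> tpart (nC (Suc ?p)) (sC (Suc ?p)) j"
      unfolding y_def z_def by (intro tpart_diff cc_tpart[OF \<psi>1 v(1)] cc_tpart[OF h(1) w])
    ultimately show "\<exists>v\<in>tpart (nC (Suc ?p)) (sC (Suc ?p)) j. w = mv (nC (Suc ?p)) (cc (dC ?p)) v"
      by blast
  qed
qed

subsection \<open>Mapping cones\<close>

definition join :: "nat \<Rightarrow> (nat \<Rightarrow> 'a) \<Rightarrow> (nat \<Rightarrow> 'a) \<Rightarrow> nat \<Rightarrow> 'a" where
  "join p f g = (\<lambda>a. if a < p then f a else g (a - p))"

text \<open>Block upper triangular matrix with diagonal blocks \<open>A\<close>, \<open>C\<close>;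
  \<open>p\<close> and \<open>q\<close> are the numbers of rows and columns of
  \<open>A\<close>.\<close>

definition blk :: "nat \<Rightarrow> nat \<Rightarrow> (nat \<Rightarrow> nat \<Rightarrow> 'a) \<Rightarrow> (nat \<Rightarrow> nat \<Rightarrow> 'a) \<Rightarrow> (nat \<Rightarrow> nat \<Rightarrow> 'a)
    \<Rightarrow> nat \<Rightarrow> nat \<Rightarrow> 'a::zero" where
  "blk p q A B C = (\<lambda>a b. if b < q then (if a < p then A a b else 0)
     else if a < p then B a (b - q) else C (a - p) (b - q))"

lemma sum_lessThan_add:
  "(\<Sum>b<p + q. h b) = (\<Sum>b<p. h b) + (\<Sum>b<q. h (p + b))" for h :: "nat \<Rightarrow> 'a::comm_monoid_add"
  by (induction q) (simp_all add: add.assoc)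

lemma mv_blk: "mv (q + r) (blk p q A B C) (join q f g) = join p (mv q A f + mv r B g) (mv r C g)"
  by (auto simp: mv_def blk_def join_def sum_lessThan_add fun_eq_iff)

lemma mm_blk:
  "mm (q + r) (blk p q A B C) (blk q t A' B' C') =
     blk p t (mm q A A') (mm q A B' + mm r B C') (mm r C C')"
  by (auto simp: mm_def blk_def sum_lessThan_add fun_eq_iff)

lemma join_diff: "join p f g - join p f' g' = join p (f - f') (g - g')"
  by (auto simp: join_def fun_eq_iff)

lemma cc_blk: "cc (blk p q A B C) = blk p q (cc A) (cc B) (cc C)"
  by (auto simp: cc_def blk_def fun_eq_iff)

lemma cc_uminus: "cc (- A) = - cc A"
  by (simp add: cc_def fun_eq_iff fun_Compl_def const_coeff_uminus)

lemma mv_uminus_left: "mv n (- A) f = - mv n A f"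
  by (simp add: mv_def fun_eq_iff sum_negf fun_Compl_def)

lemma mm_uminus_left: "mm n (- A) B = - mm n A B"
  by (simp add: mm_def fun_eq_iff sum_negf fun_Compl_def)

lemma mm_uminus_right: "mm n A (- B) = - mm n A B"
  by (simp add: mm_def fun_eq_iff sum_negf fun_Compl_def)

lemma hmat_uminus: "hmat V r s c t A \<Longrightarrow> hmat V r s c t (- A)"
  using hmat_diff[OF hmat_0, of V r s c t A] by simp

lemma hmat_blk:
  assumes A: "hmat V p s q t A" and B: "hmat V p s r t' B" and C: "hmat V p' s' r t' C"
  shows "hmat V (p + p') (join p s s') (q + r) (join q t t') (blk p q A B C)"
  unfolding hmat_def
proof (intro allI conjI impI)
  fix a b
  show "blk p q A B C a b \<in> polys V"
    by (simp add: blk_def hmatD(1)[OF A] hmatD(1)[OF B] hmatD(1)[OF C])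
  show "homogeneous (join q t t' b - join p s s' a) (blk p q A B C a b)"
    by (simp add: blk_def join_def hmatD(2)[OF A] hmatD(2)[OF B] hmatD(2)[OF C])
  assume nz: "blk p q A B C a b \<noteq> 0"
  have C': "a - p < p' \<and> b - q < r" if "C (a - p) (b - q) \<noteq> 0"
    using C that by (simp add: hmat_def)
  have B': "b - q < r" if "B a (b - q) \<noteq> 0"
    using B that by (simp add: hmat_def)
  show "a < p + p'" "b < q + r"
    using nz C' B' by (auto simp: blk_def split: if_splits)
qed

lemma join_free_module:
  "f \<in> free_module V p \<Longrightarrow> g \<in> free_module V q \<Longrightarrow> join p f g \<in> free_module V (p + q)"
  by (auto simp: free_module_def join_def)

lemma free_module_joinE:
  assumes "h \<in> free_module V (p + q)"
  obtains f g where "f \<in> free_module V p" "g \<in> free_module V q" "h = join p f g"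
proof
  show "(\<lambda>a. if a < p then h a else 0) \<in> free_module V p" "(\<lambda>a. h (p + a)) \<in> free_module V q"
    using assms by (auto simp: free_module_def)
  show "h = join p (\<lambda>a. if a < p then h a else 0) (\<lambda>a. h (p + a))"
    by (auto simp: join_def)
qed

lemma join_eq_0D:
  assumes "join p f g = 0"
  shows "g = 0" "\<And>a. a < p \<Longrightarrow> f a = 0"
proof -
  have "join p f g (p + a) = 0" for a using assms by simp
  then show "g = 0" by (simp add: join_def fun_eq_iff)
  show "f a = 0" if "a < p" for a
    using fun_cong[OF assms, of a] that by (simp add: join_def)
qed

section \<open>The mapping cone and its exactness\<close>

definition cone_n :: "(nat \<Rightarrow> nat) \<Rightarrow> (nat \<Rightarrow> nat) \<Rightarrow> nat \<Rightarrow> nat" where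
  "cone_n nF nG i = nF i + (case i of 0 \<Rightarrow> 0 | Suc j \<Rightarrow> nG j)"

definition cone_s :: "(nat \<Rightarrow> nat) \<Rightarrow> (nat \<Rightarrow> nat \<Rightarrow> int) \<Rightarrow> (nat \<Rightarrow> nat \<Rightarrow> int) \<Rightarrow> nat \<Rightarrow> nat \<Rightarrow> int" where
  "cone_s nF sF sG i = join (nF i) (sF i) (case i of 0 \<Rightarrow> (\<lambda>_. 0) | Suc j \<Rightarrow> sG j)"

text \<open>Both maps out of the \<open>G\<close> summand carry a minus sign, so that in the square
  of the differential the terms \<open>- dF \<phi>\<close> and \<open>\<phi> dG\<close>
  cancel.\<close>

definition cone_d :: "(nat \<Rightarrow> nat) \<Rightarrow> (nat \<Rightarrow> nat \<Rightarrow> nat \<Rightarrow> ('v, 'k::field) mpoly)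
    \<Rightarrow> (nat \<Rightarrow> nat \<Rightarrow> nat \<Rightarrow> ('v, 'k) mpoly) \<Rightarrow> (nat \<Rightarrow> nat \<Rightarrow> nat \<Rightarrow> ('v, 'k) mpoly)
    \<Rightarrow> nat \<Rightarrow> nat \<Rightarrow> nat \<Rightarrow> ('v, 'k) mpoly" where
  "cone_d nF dF dG \<phi> i =
     blk (nF i) (nF (Suc i)) (dF i) (- \<phi> i) (case i of 0 \<Rightarrow> 0 | Suc j \<Rightarrow> - dG j)"

lemma cone_n_simps [simp]: "cone_n nF nG 0 = nF 0" "cone_n nF nG (Suc i) = nF (Suc i) + nG i"
  by (simp_all add: cone_n_def)

lemma cpx_cone:
  assumes F: "cpx V nF sF dF" and G: "cpx V nG sG dG" and \<phi>: "chain_map V nG sG dG nF sF dF \<phi>"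
  shows "cpx V (cone_n nF nG) (cone_s nF sF sG) (cone_d nF dF dG \<phi>)"
proof -
  have dF: "hmat V (nF i) (sF i) (nF (Suc i)) (sF (Suc i)) (dF i)"
    and ddF: "mm (nF (Suc i)) (dF i) (dF (Suc i)) = 0" and nF0: "nF 0 = 1" for i
    using F by (simp_all add: cpx_def)
  have dG: "hmat V (nG i) (sG i) (nG (Suc i)) (sG (Suc i)) (dG i)"
    and ddG: "mm (nG (Suc i)) (dG i) (dG (Suc i)) = 0" for i
    using G by (simp_all add: cpx_def)
  have \<phi>1: "hmat V (nF i) (sF i) (nG i) (sG i) (\<phi> i)"
    and \<phi>2: "mm (nF (Suc i)) (dF i) (\<phi> (Suc i)) = mm (nG i) (\<phi> i) (dG i)" for i
    using \<phi> by (simp_all add: chain_map_def)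
  have "hmat V (cone_n nF nG i) (cone_s nF sF sG i) (cone_n nF nG (Suc i)) (cone_s nF sF sG (Suc i))
      (cone_d nF dF dG \<phi> i)" for i
    unfolding cone_n_def cone_s_def cone_d_def
    by (rule hmat_blk) (auto split: nat.split intro: dF hmat_uminus \<phi>1 dG)
  moreover have "mm (cone_n nF nG (Suc i)) (cone_d nF dF dG \<phi> i) (cone_d nF dF dG \<phi> (Suc i)) = 0" for i
  proof -
    have "mm (nG i) (case i of 0 \<Rightarrow> 0 | Suc j \<Rightarrow> - dG j) (- dG i) = 0"
      by (cases i) (simp_all add: mm_uminus_left mm_uminus_right ddG)
    then show ?thesis
      unfolding cone_d_def cone_n_simps mm_blk
      by (simp add: ddF mm_uminus_left mm_uminus_right \<phi>2) (simp add: blk_def fun_eq_iff)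
  qed
  ultimately show ?thesis by (simp add: cpx_def nF0)
qed

lemma resol_boundary_cyc:
  assumes "resol V M n s d" "g \<in> free_module V (n (Suc i))"
  shows "cyc M n d i (mv (n (Suc i)) (d i) g)"
  using assms mv_free_module[OF resolD(4)[OF assms(1)] assms(2)] unfolding resol_def by blast

text \<open>By \<open>colon\<close>, multiplication by \<open>u\<close> is injective from
  \<open>S/N\<close> to \<open>S/M\<close>; its cokernel is \<open>S\<close> modulo \<open>M\<close>
  and \<open>u\<close>. As \<open>\<phi>\<close> lifts it, the cone resolves the cokernel. The
  diagram chase replaces the long exact sequence.\<close>

theorem resol_cone:
  assumes F: "resol V M nF sF dF" and G: "resol V N nG sG dG"
    and \<phi>: "chain_map V nG (\<lambda>i a. sG i a + e) dG nF sF dF \<phi>" "\<phi> 0 = mat1 u"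
    and u: "u \<in> polys V" and M: "M \<subseteq> polys V"
    and colon: "\<And>g. g \<in> polys V \<Longrightarrow> u * g \<in> M \<Longrightarrow> g \<in> N"
  shows "resol V {m + g * u | m g. m \<in> M \<and> g \<in> polys V}
    (cone_n nF nG) (cone_s nF sF (\<lambda>i a. sG i a + e)) (cone_d nF dF dG \<phi>)"
proof -
  let ?n = "cone_n nF nG" and ?s = "cone_s nF sF (\<lambda>i a. sG i a + e)" and ?d = "cone_d nF dF dG \<phi>"
  let ?M = "{m + g * u | m g. m \<in> M \<and> g \<in> polys V}"
  have G': "cpx V nG (\<lambda>i a. sG i a + e) dG"
    using resolD(1)[OF G] by (simp add: cpx_def hmat_def)
  have cpx: "cpx V ?n ?s ?d"
    by (rule cpx_cone[OF resolD(1)[OF F] G' \<phi>(1)])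
  have \<phi>1: "hmat V (nF i) (sF i) (nG i) (\<lambda>a. sG i a + e) (\<phi> i)"
    and \<phi>2: "mm (nF (Suc i)) (dF i) (\<phi> (Suc i)) = mm (nG i) (\<phi> i) (dG i)" for i
    using \<phi>(1) by (simp_all add: chain_map_def)
  have mv: "mv (?n (Suc i)) (?d i) (join (nF (Suc i)) f g) =
      join (nF i) (mv (nF (Suc i)) (dF i) f - mv (nG i) (\<phi> i) g)
        (mv (nG i) (case i of 0 \<Rightarrow> 0 | Suc j \<Rightarrow> - dG j) g)" for i f g
    unfolding cone_d_def cone_n_simps mv_blk by (simp add: mv_uminus_left)
  have \<phi>0: "mv (nG 0) (\<phi> 0) g = (\<lambda>a. if a = 0 then u * g 0 else 0)" for g
    by (auto simp: \<phi>(2) mat1_def mv_def resolD(3)[OF G])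
  have "cyc ?M ?n ?d i (mv (?n (Suc i)) (?d i) h)" if h: "h \<in> free_module V (?n (Suc i))" for i h
  proof (cases i)
    case 0
    obtain f g where fg: "f \<in> free_module V (nF 1)" "g \<in> free_module V (nG 0)" "h = join (nF 1) f g"
      using free_module_joinE[of h V "nF 1" "nG 0"] h 0 by auto
    have "mv (nF 1) (dF 0) f 0 \<in> M"
      using resol_boundary_cyc[OF F fg(1)[unfolded One_nat_def]] by (simp add: cyc_def)
    moreover have "mv (?n (Suc 0)) (?d 0) h 0 = mv (nF 1) (dF 0) f 0 + (- g 0) * u"
      unfolding fg(3) One_nat_def mv \<phi>0 by (simp add: join_def resolD(3)[OF F] mult.commute)
    moreover have "- g 0 \<in> polys V" using fg(2) by (intro polys_uminus free_module_polys)
    ultimately have "mv (?n (Suc 0)) (?d 0) h 0 \<in> ?M" by blast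
    then show ?thesis unfolding 0 cyc_def nat.case .
  next
    case (Suc j)
    have "mm (?n (Suc j)) (?d j) (?d (Suc j)) = 0"
      using cpx unfolding cpx_def by blast
    then show ?thesis unfolding Suc cyc_def nat.case mv_mm by simp
  qed
  moreover have "\<exists>g\<in>free_module V (?n (Suc i)). h = mv (?n (Suc i)) (?d i) g"
    if h: "h \<in> free_module V (?n i)" and c: "cyc ?M ?n ?d i h" for i h
  proof (cases i)
    case 0
    then obtain m r where mr: "h 0 = m + r * u" "m \<in> M" "r \<in> polys V"
      using c by (auto simp: cyc_def)
    have "(\<lambda>a. if a = 0 then m else 0) \<in> free_module V (nF 0)"
      using mr(2) M resolD(3)[OF F] by (auto simp: free_module_def)
    then obtain f where f: "f \<in> free_module V (nF (Suc 0))"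
      "(\<lambda>a. if a = 0 then m else 0) = mv (nF (Suc 0)) (dF 0) f"
      by (rule resol_exact[OF F]) (simp add: cyc_def mr(2))
    \<comment> \<open>The sign compensates the block \<open>- \<phi> 0\<close> of the cone.\<close>
    define g where "g = (\<lambda>a::nat. if a = 0 then - r else 0)"
    have "g \<in> free_module V (nG 0)"
      using mr(3) resolD(3)[OF G] by (auto simp: free_module_def g_def polys_uminus)
    then have "join (nF (Suc 0)) f g \<in> free_module V (?n (Suc 0))"
      using f by (simp add: join_free_module)
    moreover have "h = mv (?n (Suc 0)) (?d 0) (join (nF (Suc 0)) f g)"
    proof
      fix a
      have "h a = 0" if "a \<noteq> 0"
        using h 0 that resolD(3)[OF F] by (simp add: free_module_def)
      then show "h a = mv (?n (Suc 0)) (?d 0) (join (nF (Suc 0)) f g) a"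
        unfolding mv \<phi>0 f(2)[symmetric]
        using mr(1) resolD(3)[OF F] by (auto simp: join_def g_def mult.commute)
    qed
    ultimately show ?thesis using 0 by blast
  next
    case (Suc j)
    obtain f g where fg: "f \<in> free_module V (nF i)" "g \<in> free_module V (nG j)" "h = join (nF i) f g"
      using free_module_joinE[of h V "nF i" "nG j"] h Suc by auto
    have eq: "join (nF j) (mv (nF (Suc j)) (dF j) f - mv (nG j) (\<phi> j) g)
        (mv (nG j) (case j of 0 \<Rightarrow> 0 | Suc k \<Rightarrow> - dG k) g) = 0"
      using c unfolding Suc cyc_def nat.case fg(3) mv by simp
    have eq1: "mv (nF (Suc j)) (dF j) f = mv (nG j) (\<phi> j) g"
    proof
      fix a
      show "mv (nF (Suc j)) (dF j) f a = mv (nG j) (\<phi> j) g a"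
      proof (cases "a < nF j")
        case True
        then show ?thesis using join_eq_0D(2)[OF eq] by simp
      next
        case False
        then have "mv (nF (Suc j)) (dF j) f a = 0" "mv (nG j) (\<phi> j) g a = 0"
          using hmatD(3)[OF resolD(4)[OF F], of j a] hmatD(3)[OF \<phi>1[of j], of a]
          by (simp_all add: mv_def)
        then show ?thesis by simp
      qed
    qed
    \<comment> \<open>In the lowest position this is where \<open>colon\<close> enters:
      \<open>u * g 0\<close> is a boundary of \<open>F\<close>, hence in \<open>M\<close>.\<close>
    have "cyc N nG dG j g"
    proof (cases j)
      case 0
      have "u * g 0 = mv (nF (Suc 0)) (dF 0) f 0" using eq1 unfolding 0 \<phi>0 by simp
      also have "\<dots> \<in> M"
        using resol_boundary_cyc[OF F, of f 0] fg(1) unfolding Suc 0 by (simp add: cyc_def)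
      finally have "g 0 \<in> N" using colon free_module_polys[OF fg(2)] by blast
      then show ?thesis by (simp add: cyc_def 0)
    next
      case (Suc k)
      then show ?thesis using join_eq_0D(1)[OF eq] by (simp add: cyc_def mv_uminus_left)
    qed
    then obtain y where y: "y \<in> free_module V (nG (Suc j))" "g = mv (nG (Suc j)) (dG j) y"
      by (rule resol_exact[OF G fg(2)])
    \<comment> \<open>Subtracting the image of \<open>y\<close> under \<open>\<phi>\<close> turns
      the first component into a cycle of \<open>F\<close>, to which exactness of \<open>F\<close>
      applies.\<close>
    define f' where "f' = f - mv (nG (Suc j)) (\<phi> (Suc j)) y"
    have "f' \<in> free_module V (nF (Suc j))"
      unfolding f'_def using fg(1) Suc by (intro free_module_diff mv_free_module[OF \<phi>1] y) simp
    moreover have "mv (nF (Suc j)) (dF j) f' = 0"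
      unfolding f'_def mv_diff eq1 mv_mm \<phi>2 y(2) by simp
    then have "cyc M nF dF (Suc j) f'" by (simp add: cyc_def)
    ultimately obtain x where x: "x \<in> free_module V (nF (Suc (Suc j)))"
      "f' = mv (nF (Suc (Suc j))) (dF (Suc j)) x"
      by (rule resol_exact[OF F])
    have "join (nF (Suc (Suc j))) x (- y) \<in> free_module V (?n (Suc i))"
      unfolding Suc cone_n_simps by (intro join_free_module x y free_module_uminus)
    moreover have "mv (?n (Suc i)) (?d i) (join (nF (Suc (Suc j))) x (- y)) = h"
      unfolding Suc mv x(2)[symmetric] fg(3) f'_def
      by (simp add: mv_uminus mv_uminus_left y(2))
    ultimately show ?thesis by metis
  qed
  moreover have "?s 0 0 = 0"
    using resolD(2,3)[OF F] by (simp add: cone_s_def join_def)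
  ultimately show ?thesis
    unfolding resol_def using cpx by blast
qed

text \<open>
  Adjoining a nonzerodivisor \<open>u\<close> modulo \<open>M\<close>: the lift of multiplication by \<open>u\<close> can be taken
  to be scalar, so it vanishes after tensoring with the residue field.
\<close>

lemma hzero_cone_scalar:
  assumes R: "resol V M n s d" and u: "const_coeff u = 0"
    and nz: "\<not> hzero n s d p j"
  shows "\<not> hzero (cone_n n n) (cone_s n s (\<lambda>i a. s i a + e))
    (cone_d n d d (\<lambda>i a b. u * idm (n i) a b)) (Suc p) (j + e)"
proof
  let ?n = "cone_n n n" and ?s = "cone_s n s (\<lambda>i a. s i a + e)"
    and ?d = "cone_d n d d (\<lambda>i a b. u * idm (n i) a b)"
  assume hz: "hzero ?n ?s ?d (Suc p) (j + e)"
  obtain w where w: "w \<in> tpart (n p) (s p) j" "\<And>q. p = Suc q \<Longrightarrow> mv (n p) (cc (d q)) w = 0"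
    "\<And>v. v \<in> tpart (n (Suc p)) (s (Suc p)) j \<Longrightarrow> w \<noteq> mv (n (Suc p)) (cc (d p)) v"
    using nz unfolding hzero_def by blast
  \<comment> \<open>The connecting block dies with the constant coefficient of \<open>u\<close>, so
    the tensored cone is a direct sum, whose second summand is the old complex up to sign, one
    position and \<open>e\<close> degrees further.\<close>
  have mv: "mv (?n (Suc i)) (cc (?d i)) (join (n (Suc i)) f g) =
      join (n i) (mv (n (Suc i)) (cc (d i)) f)
        (mv (n i) (case i of 0 \<Rightarrow> 0 | Suc j \<Rightarrow> - cc (d j)) g)" for i f g
  proof -
    have "cc (- (\<lambda>a b. u * idm (n i) a b)) = 0"
      by (simp add: cc_def fun_eq_iff fun_Compl_def const_coeff_uminus const_coeff_mult u)
    moreover have "cc (0 :: nat \<Rightarrow> nat \<Rightarrow> ('a, 'b) mpoly) = 0" by (simp add: cc_def fun_eq_iff)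
    ultimately show ?thesis
      unfolding cone_d_def cone_n_simps cc_blk mv_blk
      by (cases i) (simp_all add: cc_uminus)
  qed
  define w' where "w' = join (n (Suc p)) 0 w"
  have "w' \<in> tpart (?n (Suc p)) (?s (Suc p)) (j + e)"
    using w(1) by (auto simp: w'_def tpart_def join_def cone_s_def)
  moreover have "mv (?n (Suc p)) (cc (?d p)) w' = 0"
  proof -
    have "mv (n p) (case p of 0 \<Rightarrow> 0 | Suc j \<Rightarrow> - cc (d j)) w = 0"
      using w(2) by (cases p) (simp_all add: mv_uminus_left)
    then show ?thesis unfolding w'_def mv by (simp add: join_def fun_eq_iff)
  qed
  ultimately obtain v where v: "v \<in> tpart (?n (Suc (Suc p))) (?s (Suc (Suc p))) (j + e)"
    "w' = mv (?n (Suc (Suc p))) (cc (?d (Suc p))) v"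
    using hz unfolding hzero_def by blast
  define v1 where "v1 = (\<lambda>a. if a < n (Suc (Suc p)) then v a else 0)"
  define v2 where "v2 = (\<lambda>a. v (n (Suc (Suc p)) + a))"
  have vj: "v = join (n (Suc (Suc p))) v1 v2"
    by (auto simp: v1_def v2_def join_def)
  have "join (n (Suc p)) 0 w = join (n (Suc p)) (mv (n (Suc (Suc p))) (cc (d (Suc p))) v1)
      (mv (n (Suc p)) (- cc (d p)) v2)"
    using v(2) unfolding w'_def vj mv by simp
  then have "w = mv (n (Suc p)) (cc (d p)) (- v2)"
    using join_eq_0D(1)[of "n (Suc p)" _ "w - mv (n (Suc p)) (- cc (d p)) v2"]
    by (metis (no_types, lifting) join_diff diff_self eq_iff_diff_eq_0 mv_uminus mv_uminus_left)
  moreover have "- v2 \<in> tpart (n (Suc p)) (s (Suc p)) j"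
    unfolding tpart_def
  proof (intro CollectI allI impI)
    fix b
    assume "(- v2) b \<noteq> 0"
    then have "v (n (Suc (Suc p)) + b) \<noteq> 0" by (simp add: v2_def fun_Compl_def)
    then have "n (Suc (Suc p)) + b < ?n (Suc (Suc p)) \<and> ?s (Suc (Suc p)) (n (Suc (Suc p)) + b) = j + e"
      using v(1) unfolding tpart_def by blast
    then show "b < n (Suc p) \<and> s (Suc p) b = j" by (simp add: cone_s_def join_def)
  qed
  ultimately show False using w(3) by blast
qed

lemma chain_map_scalar:
  assumes C: "cpx V n s d" and u: "u \<in> polys V" "homogeneous e u"
  shows "chain_map V n (\<lambda>i a. s i a + e) d n s d (\<lambda>i a b. u * idm (n i) a b)"
  unfolding chain_map_def
proof (intro conjI allI)
  fix i
  show "hmat V (n i) (s i) (n i) (\<lambda>a. s i a + e) (\<lambda>a b. u * idm (n i) a b)"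
    using u by (auto simp: hmat_def idm_def)
  have h: "hmat V (n i) (s i) (n (Suc i)) (s (Suc i)) (d i)" using C by (simp add: cpx_def)
  have "mm (n (Suc i)) (d i) (\<lambda>a b. u * idm (n (Suc i)) a b) =
      (\<lambda>a b. u * mm (n (Suc i)) (d i) (idm (n (Suc i))) a b)"
    by (simp add: mm_def fun_eq_iff sum_distrib_left algebra_simps)
  also have "mm (n (Suc i)) (d i) (idm (n (Suc i))) = mm (n i) (idm (n i)) (d i)"
    using h by (simp add: mm_idm_left mm_idm_right hmat_def)
  also have "(\<lambda>a b. u * mm (n i) (idm (n i)) (d i) a b) = mm (n i) (\<lambda>a b. u * idm (n i) a b) (d i)"
    by (simp add: mm_def fun_eq_iff sum_distrib_left algebra_simps)
  finally show "mm (n (Suc i)) (d i) (\<lambda>a b. u * idm (n (Suc i)) a b) =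
    mm (n i) (\<lambda>a b. u * idm (n i) a b) (d i)" .
qed

subsection \<open>Squarefree monomial ideals\<close>

definition sqmon :: "'v set \<Rightarrow> 'v \<Rightarrow>\<^sub>0 nat" where
  "sqmon A = (\<Sum>v\<in>A. Poly_Mapping.single v 1)"

definition xmon :: "'v set \<Rightarrow> ('v, 'k::field) mpoly" where
  "xmon A = Poly_Mapping.single (sqmon A) 1"

lemma lookup_sqmon: "finite A \<Longrightarrow> Poly_Mapping.lookup (sqmon A) v = (if v \<in> A then 1 else 0)"
  by (simp add: sqmon_def lookup_sum lookup_single when_def)

lemma keys_sqmon: "finite A \<Longrightarrow> Poly_Mapping.keys (sqmon A) = A"
  by (auto simp: in_keys_iff lookup_sqmon split: if_splits)

lemma mono_degree_sqmon: "finite A \<Longrightarrow> mono_degree (sqmon A) = card A"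
  by (simp add: mono_degree_def keys_sqmon lookup_sqmon)

lemma keys_xmon: "Poly_Mapping.keys (xmon A :: ('v, 'k::field) mpoly) = {sqmon A}"
  by (simp add: xmon_def)

lemma xmon_polys: "finite A \<Longrightarrow> A \<subseteq> V \<Longrightarrow> xmon A \<in> polys V"
  by (simp add: polys_def keys_xmon keys_sqmon)

lemma homogeneous_xmon: "finite A \<Longrightarrow> homogeneous (int (card A)) (xmon A)"
  by (simp add: homogeneous_def keys_xmon mono_degree_sqmon)

lemma const_coeff_xmon:
  assumes "finite A" "A \<noteq> {}"
  shows "const_coeff (xmon A :: ('v, 'k::field) mpoly) = 0"
proof -
  have "sqmon A \<noteq> 0" using assms keys_sqmon[of A] by auto
  then show ?thesis by (simp add: const_coeff_def xmon_def lookup_single)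
qed

lemma var_mult_var: "x \<noteq> y \<Longrightarrow> var x * var y = xmon {x, y}"
  by (simp add: var_def xmon_def sqmon_def mult_single)

lemma lookup_single_mult:
  fixes p :: "('v, 'k::field) mpoly"
  shows "Poly_Mapping.lookup (Poly_Mapping.single m 1 * p) (m + k) = Poly_Mapping.lookup p k"
  by (simp add: lookup_mult lookup_single when_mult)

text \<open>
  A squarefree monomial ideal if \<open>Q\<close> is closed under supersets. Sums and colons with a
  squarefree monomial become operations on \<open>Q\<close>.
\<close>

definition supp_ideal :: "'v set \<Rightarrow> ('v set \<Rightarrow> bool) \<Rightarrow> ('v, 'k::field) mpoly set" where
  "supp_ideal V Q = {p \<in> polys V. \<forall>m\<in>Poly_Mapping.keys p. Q (Poly_Mapping.keys m)}"

lemma supp_ideal_polys: "supp_ideal V Q \<subseteq> polys V"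
  by (auto simp: supp_ideal_def)

text \<open>Multiplication by a monomial translates exponents injectively, so no terms cancel and
  every monomial of \<open>g\<close> shows up in the product.\<close>

lemma supp_ideal_colonD:
  assumes "finite A" "g \<in> polys V" "xmon A * g \<in> supp_ideal V Q"
  shows "g \<in> supp_ideal V (\<lambda>B. Q (A \<union> B))"
  unfolding supp_ideal_def
proof (intro CollectI conjI ballI)
  fix m
  assume "m \<in> Poly_Mapping.keys g"
  then have "sqmon A + m \<in> Poly_Mapping.keys (xmon A * g)"
    by (simp add: in_keys_iff xmon_def lookup_single_mult)
  then show "Q (A \<union> Poly_Mapping.keys m)"
    using assms by (auto simp: supp_ideal_def keys_nat_add keys_sqmon)
qed (fact assms)

lemma supp_ideal_colonI:
  assumes "finite A" "A \<subseteq> V" "g \<in> supp_ideal V (\<lambda>B. Q (A \<union> B))"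
  shows "xmon A * g \<in> supp_ideal V Q"
  using assms unfolding supp_ideal_def
  by (auto simp: polys_mult xmon_polys keys_xmon keys_nat_add keys_sqmon dest!: keys_multD)

lemma poly_eq_sum_single:
  "p = (\<Sum>m\<in>Poly_Mapping.keys p. Poly_Mapping.single m (Poly_Mapping.lookup p m))"
  for p :: "('v, 'k::field) mpoly"
  by (rule poly_mapping_eqI) (auto simp: lookup_sum lookup_single when_def in_keys_iff)

lemma xmon_dvd:
  fixes q :: "('v, 'k::field) mpoly"
  assumes "finite A" "q \<in> polys V" "\<And>m. m \<in> Poly_Mapping.keys q \<Longrightarrow> A \<subseteq> Poly_Mapping.keys m"
  obtains g where "g \<in> polys V" "q = g * xmon A"
proof
  \<comment> \<open>Subtraction of exponents is truncated, but exact here: each monomial of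
    \<open>q\<close> has exponent at least 1 on all of \<open>A\<close>.\<close>
  let ?g = "\<Sum>m\<in>Poly_Mapping.keys q. Poly_Mapping.single (m - sqmon A) (Poly_Mapping.lookup q m)"
  show "?g \<in> polys V"
  proof (rule polys_sum)
    fix m
    assume "m \<in> Poly_Mapping.keys q"
    then have "Poly_Mapping.keys m \<subseteq> V" using assms(2) by (simp add: polys_def)
    moreover have "Poly_Mapping.keys (m - sqmon A) \<subseteq> Poly_Mapping.keys m"
      by (auto simp: in_keys_iff lookup_minus)
    ultimately show "Poly_Mapping.single (m - sqmon A) (Poly_Mapping.lookup q m) \<in> polys V"
      by (auto simp: polys_def)
  qed
  have "m - sqmon A + sqmon A = m" if "m \<in> Poly_Mapping.keys q" for m
  proof (rule poly_mapping_eqI)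
    fix v
    show "Poly_Mapping.lookup (m - sqmon A + sqmon A) v = Poly_Mapping.lookup m v"
      using assms(3)[OF that] by (auto simp: lookup_add lookup_minus lookup_sqmon[OF assms(1)] in_keys_iff)
  qed
  then have "?g * xmon A = (\<Sum>m\<in>Poly_Mapping.keys q. Poly_Mapping.single m (Poly_Mapping.lookup q m))"
    by (simp add: xmon_def sum_distrib_right mult_single)
  then show "q = ?g * xmon A" by (simp add: poly_eq_sum_single[symmetric])
qed

text \<open>The monomials of \<open>p\<close> whose support fails \<open>Q\<close> all contain
  \<open>A\<close>, so their sum is a multiple of \<open>xmon A\<close>.\<close>

lemma supp_ideal_add:
  assumes "finite A" "A \<subseteq> V"
  shows "supp_ideal V (\<lambda>B. Q B \<or> A \<subseteq> B) =
    {m + g * xmon A | m g. m \<in> supp_ideal V Q \<and> g \<in> polys V}"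
proof (intro subset_antisym subsetI)
  fix p :: "('a, 'b) mpoly"
  assume p: "p \<in> supp_ideal V (\<lambda>B. Q B \<or> A \<subseteq> B)"
  let ?P = "\<lambda>m. Q (Poly_Mapping.keys m)"
  obtain g where g: "g \<in> polys V" "mono_filter (\<lambda>m. \<not> ?P m) p = g * xmon A"
  proof (rule xmon_dvd[OF assms(1), of "mono_filter (\<lambda>m. \<not> ?P m) p" V])
    show "mono_filter (\<lambda>m. \<not> ?P m) p \<in> polys V"
      using p by (simp add: supp_ideal_def polys_mono_filter)
  qed (use p in \<open>auto simp: supp_ideal_def keys_mono_filter\<close>)
  have "mono_filter ?P p \<in> supp_ideal V Q"
    using p by (simp add: supp_ideal_def polys_mono_filter) (simp add: keys_mono_filter)
  moreover have "p = mono_filter ?P p + g * xmon A"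
    using mono_filter_split[of p ?P] g(2) by simp
  ultimately show "p \<in> {m + g * xmon A | m g. m \<in> supp_ideal V Q \<and> g \<in> polys V}"
    using g(1) by blast
next
  fix p :: "('a, 'b) mpoly"
  assume "p \<in> {m + g * xmon A | m g. m \<in> supp_ideal V Q \<and> g \<in> polys V}"
  then obtain m g where p: "p = m + g * xmon A" "m \<in> supp_ideal V Q" "g \<in> polys V" by blast
  then have "p \<in> polys V"
    using assms by (simp add: supp_ideal_def polys_add polys_mult xmon_polys)
  moreover have "Q (Poly_Mapping.keys k) \<or> A \<subseteq> Poly_Mapping.keys k" if "k \<in> Poly_Mapping.keys p" for k
    using that p(2) assms(1) unfolding p(1)
    by (auto simp: supp_ideal_def keys_xmon keys_nat_add keys_sqmon dest!: subsetD[OF keys_add] keys_multD)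
  ultimately show "p \<in> supp_ideal V (\<lambda>B. Q B \<or> A \<subseteq> B)"
    by (simp add: supp_ideal_def)
qed

text \<open>A bound on the shifts of some resolution, not necessarily minimal. The lower bound on
  the shifts is carried along because the \<open>Max\<close> in \<open>regularity\<close> needs a
  finite set.\<close>

definition reg_bounded :: "'v set \<Rightarrow> ('v, 'k::field) mpoly set \<Rightarrow> int \<Rightarrow> bool" where
  "reg_bounded V M r \<longleftrightarrow> (\<exists>n s d. resol V M n s d \<and>
     (\<forall>i. \<forall>b<n (Suc i). int i \<le> s (Suc i) b \<and> s (Suc i) b \<le> int i + r))"

lemma resol_zero:
  "resol V {0 :: ('v, 'k::field) mpoly} (\<lambda>i. if i = 0 then 1 else 0) (\<lambda>_ _. 0) (\<lambda>_. 0)"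
proof -
  have "f = 0 \<longleftrightarrow> f 0 = 0" if "f \<in> free_module V (Suc 0)" for f :: "nat \<Rightarrow> ('v, 'k) mpoly"
    using that unfolding free_module_def fun_eq_iff
    by (metis (mono_tags, lifting) mem_Collect_eq not_less_eq_eq zero_fun_apply le0 not0_implies_Suc Suc_le_mono)
  then show ?thesis
    by (auto simp: resol_def cpx_def cyc_def free_module_def fun_eq_iff split: nat.splits)
qed

lemma reg_bounded_zero: "reg_bounded V {0} r"
  unfolding reg_bounded_def using resol_zero by force

text \<open>In the cone the resolution of the colon ideal sits one position later and
  \<open>card A\<close> degrees higher, whence \<open>t + card A - 1\<close>. Its position 0 becomes
  the new generator of degree \<open>card A\<close>, whence the second inequality.\<close>

lemma reg_bounded_add:
  assumes M: "reg_bounded V (supp_ideal V Q :: ('v, 'k::field) mpoly set) r"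
    and N: "reg_bounded V (supp_ideal V (\<lambda>B. Q (A \<union> B)) :: ('v, 'k) mpoly set) t"
    and A: "finite A" "A \<subseteq> V" "A \<noteq> {}"
    and le: "t + int (card A) - 1 \<le> r" "int (card A) \<le> r"
  shows "reg_bounded V (supp_ideal V (\<lambda>B. Q B \<or> A \<subseteq> B) :: ('v, 'k) mpoly set) r"
proof -
  obtain nF sF dF where F: "resol V (supp_ideal V Q :: ('v, 'k) mpoly set) nF sF dF"
    and sF: "\<And>i b. b < nF (Suc i) \<Longrightarrow> int i \<le> sF (Suc i) b \<and> sF (Suc i) b \<le> int i + r"
    using M unfolding reg_bounded_def by blast
  obtain nG sG dG where G: "resol V (supp_ideal V (\<lambda>B. Q (A \<union> B)) :: ('v, 'k) mpoly set) nG sG dG"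
    and sG: "\<And>i b. b < nG (Suc i) \<Longrightarrow> int i \<le> sG (Suc i) b \<and> sG (Suc i) b \<le> int i + t"
    using N unfolding reg_bounded_def by blast
  let ?e = "int (card A)"
  have e: "1 \<le> ?e" using A by (simp add: Suc_le_eq card_gt_0_iff)
  have G': "cpx V nG (\<lambda>i a. sG i a + ?e) dG"
    using resolD(1)[OF G] by (simp add: cpx_def hmat_def)
  obtain \<phi> where \<phi>: "chain_map V nG (\<lambda>i a. sG i a + ?e) dG nF sF dF \<phi>" "\<phi> 0 = mat1 (xmon A)"
  proof (rule chain_map_exists[OF G' F])
    show "xmon A \<in> (polys V :: ('v, 'k) mpoly set)" by (rule xmon_polys[OF A(1,2)])
    show "homogeneous (sG 0 0 + ?e) (xmon A :: ('v, 'k) mpoly)"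
      using homogeneous_xmon[OF A(1)] resolD(2)[OF G] by simp
    show "xmon A * dG 0 0 b \<in> supp_ideal V Q" for b
      by (rule supp_ideal_colonI[OF A(1,2) resol_aug_in[OF G]])
  qed
  have "resol V (supp_ideal V (\<lambda>B. Q B \<or> A \<subseteq> B) :: ('v, 'k) mpoly set)
      (cone_n nF nG) (cone_s nF sF (\<lambda>i a. sG i a + ?e)) (cone_d nF dF dG \<phi>)"
    unfolding supp_ideal_add[OF A(1,2)]
    by (rule resol_cone[OF F G \<phi> xmon_polys[OF A(1,2)] supp_ideal_polys])
      (rule supp_ideal_colonD[OF A(1)])
  moreover have "int i \<le> cone_s nF sF (\<lambda>i a. sG i a + ?e) (Suc i) b \<and>
      cone_s nF sF (\<lambda>i a. sG i a + ?e) (Suc i) b \<le> int i + r"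
    if b: "b < cone_n nF nG (Suc i)" for i b
  proof (cases "b < nF (Suc i)")
    case True
    then show ?thesis using sF by (simp add: cone_s_def join_def)
  next
    case False
    let ?b = "b - nF (Suc i)"
    have "int i - 1 + ?e \<le> sG i ?b + ?e \<and> sG i ?b + ?e \<le> int i + max ?e (t + ?e - 1)"
    proof (cases i)
      case 0
      then have "?b = 0" using b False resolD(3)[OF G] by simp
      then show ?thesis using 0 resolD(2)[OF G] by simp
    next
      case (Suc k)
      then have "int k \<le> sG (Suc k) ?b \<and> sG (Suc k) ?b \<le> int k + t" using sG b False by simp
      with Suc show ?thesis by (simp add: max_def)
    qed
    moreover have "max ?e (t + ?e - 1) \<le> r" using le by simp
    ultimately have "int i \<le> sG i ?b + ?e \<and> sG i ?b + ?e \<le> int i + r" using e by linarith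
    then show ?thesis using False by (simp add: cone_s_def join_def)
  qed
  ultimately show ?thesis unfolding reg_bounded_def by blast
qed

text \<open>Each \<open>z\<close> is a nonzerodivisor modulo the ideal reached so far: the colon
  ideal is that ideal itself, and adding a generator of degree 1 leaves the bound unchanged.\<close>

lemma reg_bounded_vars:
  assumes "finite Z" "Z \<subseteq> V" "1 \<le> r"
    and "\<And>z B. z \<in> Z \<Longrightarrow> Q (insert z B) = Q B"
    and "reg_bounded V (supp_ideal V Q :: ('v, 'k::field) mpoly set) r"
  shows "reg_bounded V (supp_ideal V (\<lambda>B. Q B \<or> Z \<inter> B \<noteq> {}) :: ('v, 'k) mpoly set) r"
  using assms(1,2,4)
proof (induction Z rule: finite_induct)
  case empty
  then show ?case using assms(5) by simp
next
  case (insert z Z)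
  let ?Q = "\<lambda>B. Q B \<or> Z \<inter> B \<noteq> {}"
  have IH: "reg_bounded V (supp_ideal V ?Q :: ('v, 'k) mpoly set) r"
    using insert.IH insert.prems by blast
  have "?Q ({z} \<union> B) = ?Q B" for B
    using insert.hyps(2) insert.prems(2)[of z B] by auto
  with IH have "reg_bounded V (supp_ideal V (\<lambda>B. ?Q ({z} \<union> B)) :: ('v, 'k) mpoly set) r"
    by simp
  from reg_bounded_add[OF IH this]
  have "reg_bounded V (supp_ideal V (\<lambda>B. ?Q B \<or> {z} \<subseteq> B) :: ('v, 'k) mpoly set) r"
    using insert.prems(1) assms(3) by simp
  moreover have "(\<lambda>B. ?Q B \<or> {z} \<subseteq> B) = (\<lambda>B. Q B \<or> insert z Z \<inter> B \<noteq> {})" by auto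
  ultimately show ?case by simp
qed

subsection \<open>Tor and regularity from an arbitrary resolution\<close>

definition aug_n :: "('v, 'k::field) graded_free_complex \<Rightarrow> nat \<Rightarrow> nat" where
  "aug_n F = case_nat 1 (rk F)"

definition aug_s :: "('v, 'k::field) graded_free_complex \<Rightarrow> nat \<Rightarrow> nat \<Rightarrow> int" where
  "aug_s F = case_nat (\<lambda>_. 0) (shift F)"

text \<open>The record leaves entries beyond the ranks arbitrary; they are set to 0 as
  \<open>hmat\<close> requires.\<close>

definition aug_d :: "('v, 'k::field) graded_free_complex \<Rightarrow> nat \<Rightarrow> nat \<Rightarrow> nat \<Rightarrow> ('v, 'k) mpoly" where
  "aug_d F i a b = (case i of
      0 \<Rightarrow> if a = 0 \<and> b < rk F 0 then aug F b else 0
    | Suc j \<Rightarrow> if a < rk F j \<and> b < rk F (Suc j) then dmat F j a b else 0)"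

lemma aug_n_simps [simp]: "aug_n F 0 = 1" "aug_n F (Suc i) = rk F i"
  by (simp_all add: aug_n_def)

lemma aug_s_simps [simp]: "aug_s F 0 = (\<lambda>_. 0)" "aug_s F (Suc i) = shift F i"
  by (simp_all add: aug_s_def)

lemma mv_aug_d_0: "mv (rk F 0) (aug_d F 0) f = (\<lambda>a. if a = 0 then aug_map F f else 0)"
  by (auto simp: mv_def aug_d_def aug_map_def fun_eq_iff mult.commute intro!: sum.cong)

lemma mv_aug_d_Suc: "mv (rk F (Suc i)) (aug_d F (Suc i)) f = diff_map F i f"
  by (auto simp: mv_def aug_d_def diff_map_def fun_eq_iff mult.commute intro!: sum.cong)

text \<open>That consecutive differentials compose to 0 follows from exactness: each column of a
  differential is the image of a unit vector, hence a cycle.\<close>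

lemma resolI:
  assumes n0: "n 0 = 1" "s 0 0 = 0"
    and d: "\<And>i. hmat V (n i) (s i) (n (Suc i)) (s (Suc i)) (d i)"
    and ex: "\<And>i f. f \<in> free_module V (n i) \<Longrightarrow>
      cyc M n d i f \<longleftrightarrow> (\<exists>g\<in>free_module V (n (Suc i)). f = mv (n (Suc i)) (d i) g)"
  shows "resol V M n s d"
proof -
  have "mm (n (Suc i)) (d i) (d (Suc i)) = 0" for i
  proof (intro ext)
    fix a c
    have "mv (n (Suc i)) (d i) (\<lambda>b. d (Suc i) b c) = 0"
    proof (cases "c < n (Suc (Suc i))")
      case True
      have "\<exists>g\<in>free_module V (n (Suc (Suc i))).
          (\<lambda>b. d (Suc i) b c) = mv (n (Suc (Suc i))) (d (Suc i)) g"
        by (rule bexI[OF _ unit_vector(1)[OF True]]) (rule unit_vector(2)[OF True, symmetric])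
      then have "cyc M n d (Suc i) (\<lambda>b. d (Suc i) b c)"
        unfolding ex[OF column_free_module[OF d]] .
      then show ?thesis by (simp add: cyc_def)
    next
      case False
      then show ?thesis using hmatD(4)[OF d[of "Suc i"], of c] by (simp add: mv_def fun_eq_iff)
    qed
    from fun_cong[OF this, of a] show "mm (n (Suc i)) (d i) (d (Suc i)) a c = 0 a c"
      by (simp add: mm_def mv_def)
  qed
  then show ?thesis using assms by (simp add: resol_def cpx_def)
qed

lemma resol_of_graded_free_resolution:
  fixes F :: "('v, 'k::field) graded_free_complex"
  assumes "graded_free_resolution V M F"
  shows "resol V M (aug_n F) (aug_s F) (aug_d F)"
proof (rule resolI)
  note R = assms[unfolded graded_free_resolution_def]
  have R0: "aug F b \<in> polys V \<and> homogeneous (shift F 0 b) (aug F b)" if "b < rk F 0" for b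
    using R[THEN conjunct1] that by blast
  have R1: "dmat F i a b \<in> polys V \<and> homogeneous (shift F (Suc i) b - shift F i a) (dmat F i a b)"
    if "a < rk F i" "b < rk F (Suc i)" for i a b
    using R[THEN conjunct2, THEN conjunct1] that by blast
  have RM: "aug_map F ` free_module V (rk F 0) = M"
    by (rule R[THEN conjunct2, THEN conjunct2, THEN conjunct1])
  have "{f \<in> free_module V (rk F 0). aug_map F f = 0} = diff_map F 0 ` free_module V (rk F 1)"
    by (rule R[THEN conjunct2, THEN conjunct2, THEN conjunct2, THEN conjunct1])
  then have R2: "diff_map F 0 ` free_module V (rk F (Suc 0)) = {f \<in> free_module V (rk F 0). aug_map F f = 0}"
    unfolding One_nat_def by (rule sym)
  have R3: "{f \<in> free_module V (rk F (Suc i)). diff_map F i f = (\<lambda>a. 0)} =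
      diff_map F (Suc i) ` free_module V (rk F (Suc (Suc i)))" for i
    by (rule R[THEN conjunct2, THEN conjunct2, THEN conjunct2, THEN conjunct2, THEN spec])
  show "hmat V (aug_n F i) (aug_s F i) (aug_n F (Suc i)) (aug_s F (Suc i)) (aug_d F i)" for i
    using R0 R1 by (cases i) (auto simp: hmat_def aug_d_def)
  fix i :: nat and f :: "nat \<Rightarrow> ('v, 'k) mpoly"
  assume f: "f \<in> free_module V (aug_n F i)"
  show "cyc M (aug_n F) (aug_d F) i f \<longleftrightarrow>
    (\<exists>g\<in>free_module V (aug_n F (Suc i)). f = mv (aug_n F (Suc i)) (aug_d F i) g)"
  proof (cases i)
    case 0
    have eq: "f = (\<lambda>a. if a = 0 then p else 0) \<longleftrightarrow> f 0 = p" for p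
      using f 0 by (auto simp: free_module_def fun_eq_iff)
    have "f 0 \<in> M \<longleftrightarrow> f 0 \<in> aug_map F ` free_module V (rk F 0)" unfolding RM ..
    then show ?thesis
      unfolding 0 cyc_def nat.case aug_n_simps mv_aug_d_0 eq by (simp only: image_iff)
  next
    case (Suc j)
    have z: "(\<lambda>a::nat. 0) = (0 :: nat \<Rightarrow> ('v, 'k) mpoly)" by (simp add: fun_eq_iff)
    have eq: "{f \<in> free_module V (rk F j). mv (rk F j) (aug_d F j) f = 0} =
        diff_map F j ` free_module V (rk F (Suc j))"
    proof (cases j)
      case 0
      have "mv (rk F 0) (aug_d F 0) f = 0 \<longleftrightarrow> aug_map F f = 0" for f
        unfolding mv_aug_d_0 by (auto simp: fun_eq_iff)
      then show ?thesis unfolding 0 R2 by (simp only:)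
    next
      case (Suc k)
      show ?thesis unfolding Suc R3[symmetric] mv_aug_d_Suc z ..
    qed
    have "cyc M (aug_n F) (aug_d F) i f \<longleftrightarrow> f \<in> {f \<in> free_module V (rk F j). mv (rk F j) (aug_d F j) f = 0}"
      using f unfolding Suc cyc_def nat.case aug_n_simps mem_Collect_eq by blast
    also have "\<dots> \<longleftrightarrow> f \<in> diff_map F j ` free_module V (rk F (Suc j))"
      unfolding eq ..
    also have "\<dots> \<longleftrightarrow> (\<exists>g\<in>free_module V (aug_n F (Suc i)). f = mv (aug_n F (Suc i)) (aug_d F i) g)"
      unfolding Suc aug_n_simps mv_aug_d_Suc by (rule image_iff)
    finally show ?thesis .
  qed
qed simp_all

text \<open>Guarantees that the choice of a resolution in \<open>tor_dim\<close> is made from a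
  nonempty collection.\<close>

lemma graded_free_resolution_of_resol:
  assumes R: "resol V M n s d" and M: "M \<subseteq> polys V"
  shows "graded_free_resolution V M
    \<lparr>rk = \<lambda>i. n (Suc i), shift = \<lambda>i. s (Suc i), aug = d 0 0, dmat = \<lambda>i. d (Suc i)\<rparr>"
    (is "graded_free_resolution V M ?F")
proof -
  note d = resolD(4)[OF R] and n0 = resolD(3)[OF R] and s0 = resolD(2)[OF R]
  have d0: "d 0 a b = 0" if "a \<noteq> 0" for a b
    using hmatD(3)[OF d[of 0], of a b] that n0 by simp
  have aug: "mv (n (Suc 0)) (d 0) f = (\<lambda>a. if a = 0 then aug_map ?F f else 0)" for f
    by (auto simp: mv_def aug_map_def fun_eq_iff mult.commute d0)
  have diff: "mv (n (Suc (Suc i))) (d (Suc i)) f = diff_map ?F i f" for i f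
    using hmatD(3)[OF d[of "Suc i"]]
    by (auto simp: mv_def diff_map_def fun_eq_iff mult.commute)
  have z: "(\<lambda>a::nat. 0) = (0 :: nat \<Rightarrow> ('a, 'b) mpoly)" by (simp add: fun_eq_iff)
  have ex: "{f \<in> free_module V (n i). cyc M n d i f} = mv (n (Suc i)) (d i) ` free_module V (n (Suc i))" for i
    using R mv_free_module[OF d[of i]] unfolding resol_def by blast
  have 1: "aug_map ?F ` free_module V (rk ?F 0) = M"
  proof (intro subset_antisym subsetI)
    fix p
    assume "p \<in> aug_map ?F ` free_module V (rk ?F 0)"
    then obtain f where f: "f \<in> free_module V (n (Suc 0))" "p = aug_map ?F f" by auto
    then have "cyc M n d 0 (mv (n (Suc 0)) (d 0) f)" by (intro resol_boundary_cyc[OF R])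
    then show "p \<in> M" using f(2) by (simp add: cyc_def aug)
  next
    fix p
    assume p: "p \<in> M"
    then have "(\<lambda>a. if a = 0 then p else 0) \<in> free_module V (n 0)" "cyc M n d 0 (\<lambda>a. if a = 0 then p else 0)"
      using M n0 by (auto simp: free_module_def cyc_def)
    then obtain g where g: "g \<in> free_module V (n (Suc 0))" "(\<lambda>a. if a = 0 then p else 0) = mv (n (Suc 0)) (d 0) g"
      by (rule resol_exact[OF R])
    have "g \<in> free_module V (rk ?F 0)" using g(1) by simp
    moreover have "p = aug_map ?F g"
      using fun_cong[OF g(2)[unfolded aug], of 0] by simp
    ultimately show "p \<in> aug_map ?F ` free_module V (rk ?F 0)" by blast
  qed
  have 2: "{f \<in> free_module V (rk ?F 0). aug_map ?F f = 0} =
      diff_map ?F 0 ` free_module V (rk ?F 1)"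
  proof -
    have "aug_map ?F f = 0 \<longleftrightarrow> cyc M n d (Suc 0) f" for f
      unfolding cyc_def nat.case aug by (auto simp: fun_eq_iff)
    then show ?thesis
      using ex[of "Suc 0"] unfolding diff[symmetric] by simp
  qed
  have 3: "{f \<in> free_module V (rk ?F (Suc i)). diff_map ?F i f = (\<lambda>a. 0)} =
      diff_map ?F (Suc i) ` free_module V (rk ?F (Suc (Suc i)))" for i
    using ex[of "Suc (Suc i)"] unfolding diff[symmetric] z by (simp add: cyc_def)
  have 4: "homogeneous (s (Suc 0) b) (d 0 0 b)" for b
    using hmatD(2)[OF d[of 0], of b 0] s0 by simp
  show ?thesis
    unfolding graded_free_resolution_def
    by (intro conjI allI impI;
      (rule 1 | rule 2 | rule 3 | simp only: graded_free_complex.simps 4 hmatD(1,2)[OF d]))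
qed

lemma tensor_part_eq: "tensor_part F i j = tpart (aug_n F (Suc i)) (aug_s F (Suc i)) j"
  by (simp add: tensor_part_def tpart_def)

lemma tensor_diff_eq: "tensor_diff F i = mv (aug_n F (Suc (Suc i))) (cc (aug_d F (Suc i)))"
  by (auto simp: tensor_diff_def mv_def cc_def aug_d_def fun_eq_iff mult.commute intro!: sum.cong)

text \<open>For \<open>i = 0\<close>, \<open>tensor_cycles\<close> imposes no condition whereas
  \<open>hzero\<close> asks for the kernel of the augmentation. They agree because the augmentation
  has entries in \<open>M\<close>, whose constant coefficients vanish.\<close>

lemma tensor_cycles_subset_boundaries_iff:
  assumes F: "graded_free_resolution V M F" and M: "\<And>p. p \<in> M \<Longrightarrow> const_coeff p = 0"
  shows "tensor_boundaries F i j \<subseteq> tensor_cycles F i j"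
    "tensor_cycles F i j \<subseteq> tensor_boundaries F i j \<longleftrightarrow> hzero (aug_n F) (aug_s F) (aug_d F) (Suc i) j"
proof -
  note R = resol_of_graded_free_resolution[OF F]
  have "const_coeff (aug_d F 0 a b) = 0" for a b
    using M[OF resol_aug_in[OF R, of b]] by (cases "a = 0") (simp_all add: aug_d_def)
  then have cc0: "cc (aug_d F 0) = 0" by (simp add: cc_def fun_eq_iff)
  have z: "(\<lambda>a::nat. 0) = (0 :: nat \<Rightarrow> 'b)" by (simp add: fun_eq_iff)
  have cyc: "w \<in> tensor_cycles F i j \<longleftrightarrow> w \<in> tpart (aug_n F (Suc i)) (aug_s F (Suc i)) j \<and>
      (\<forall>q. Suc i = Suc q \<longrightarrow> mv (aug_n F (Suc i)) (cc (aug_d F q)) w = 0)" for w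
    unfolding tensor_cycles_def tensor_part_eq tensor_diff_eq z
    by (cases i) (simp_all add: cc0)
  have dd: "mm (aug_n F (Suc i)) (cc (aug_d F i)) (cc (aug_d F (Suc i))) = 0"
    using resolD(5)[OF R, of i] unfolding cc_mm[symmetric] by (simp add: cc_def fun_eq_iff)
  show "tensor_boundaries F i j \<subseteq> tensor_cycles F i j"
    unfolding tensor_boundaries_def tensor_part_eq tensor_diff_eq
    using cc_tpart[OF resolD(4)[OF R, of "Suc i"]]
    by (auto simp: cyc mv_mm dd[unfolded aug_n_simps])
  show "tensor_cycles F i j \<subseteq> tensor_boundaries F i j \<longleftrightarrow> hzero (aug_n F) (aug_s F) (aug_d F) (Suc i) j"
    unfolding hzero_def tensor_boundaries_def tensor_part_eq tensor_diff_eq subset_iff cyc image_iff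
    by blast
qed

lemma sum_fun_apply: "(\<Sum>i\<in>A. f i) x = (\<Sum>i\<in>A. f i x)"
  for f :: "'i \<Rightarrow> 'x \<Rightarrow> 'a::comm_monoid_add"
  by (induction A rule: infinite_finite_induct) simp_all

lemma vector_space_fun: "vector_space (\<lambda>(c::'k::field) w (n::nat). c * w n)"
  by unfold_locales (auto simp: fun_eq_iff algebra_simps)

text \<open>\<open>tor_dim\<close> subtracts natural numbers, so strictness matters. A basis of
  \<open>S\<close>, extended inside \<open>T\<close>, must grow since \<open>S\<close> is its own
  span, and it stays finite within the span of \<open>r\<close> unit vectors.\<close>

lemma dim_k_less:
  assumes sub: "S \<subset> T" and T: "T \<subseteq> tpart r s j"
    and S: "0 \<in> S" "\<And>v w. v \<in> S \<Longrightarrow> w \<in> S \<Longrightarrow> v + w \<in> S" "\<And>c v. v \<in> S \<Longrightarrow> (\<lambda>n. c * v n) \<in> S"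
  shows "dim_k S < dim_k T"
proof -
  interpret v: vector_space "\<lambda>(c::'a) w (n::nat). c * w n" by (rule vector_space_fun)
  have S': "v.subspace S" using S by (simp add: v.subspace_def)
  obtain B where B: "B \<subseteq> S" "v.independent B" "S \<subseteq> v.span B"
    using v.maximal_independent_subset_extend[of "{}" S] v.independent_empty by auto
  obtain C where C: "B \<subseteq> C" "C \<subseteq> T" "v.independent C" "T \<subseteq> v.span C"
    using v.maximal_independent_subset_extend[of B T] B sub by blast
  let ?U = "(\<lambda>b n. if n = b then 1 else 0 :: 'a) ` {..<r}"
  have "T \<subseteq> v.span ?U"
  proof
    fix w
    assume "w \<in> T"
    then have "w = (\<Sum>b<r. (\<lambda>n. w b * (if n = b then 1 else 0)))"
      using T by (auto simp: tpart_def fun_eq_iff sum_fun_apply if_distrib[of "\<lambda>x. _ * x"] cong: if_cong)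
    also have "\<dots> \<in> v.span ?U"
      by (intro v.span_sum v.span_scale v.span_base) auto
    finally show "w \<in> v.span ?U" .
  qed
  then have "finite C"
    using v.independent_span_bound[of ?U C] C by blast
  moreover have "B \<noteq> C"
    using v.span_minimal[OF B(1) S'] C(4) sub by blast
  ultimately have "card B < card C" using C(1) by (simp add: psubset_card_mono psubset_eq)
  moreover have "v.dim S = card B" using v.basis_card_eq_dim B by metis
  moreover have "v.dim T = card C" using v.basis_card_eq_dim C by metis
  ultimately show ?thesis by (simp add: dim_k_def)
qed

text \<open>The resolution obtained is the one selected in \<open>tor_dim\<close>; \<open>R\<close>
  supplies existence. Passing to other resolutions is left to \<open>hzero_retract\<close>.\<close>

lemma tor_dim_eq_0_iff:
  assumes M: "M \<subseteq> polys V" "\<And>p. p \<in> M \<Longrightarrow> const_coeff p = 0"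
    and R: "resol V M n s d"
  obtains n' s' d' where "resol V M n' s' d'"
    "\<And>i j. tor_dim V M i j = 0 \<longleftrightarrow> hzero n' s' d' (Suc i) j"
proof
  let ?F = "SOME F. graded_free_resolution V M F"
  have F: "graded_free_resolution V M ?F"
    using graded_free_resolution_of_resol[OF R M(1)] by (rule someI)
  then show "resol V M (aug_n ?F) (aug_s ?F) (aug_d ?F)"
    by (rule resol_of_graded_free_resolution)
  fix i j
  let ?Z = "tensor_cycles ?F i j" and ?B = "tensor_boundaries ?F i j"
  note sub = tensor_cycles_subset_boundaries_iff[OF F M(2), of i j]
  have tor: "tor_dim V M i j = dim_k ?Z - dim_k ?B" by (simp add: tor_dim_def Let_def)
  show "tor_dim V M i j = 0 \<longleftrightarrow> hzero (aug_n ?F) (aug_s ?F) (aug_d ?F) (Suc i) j"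
  proof (cases "?Z \<subseteq> ?B")
    case True
    then have "?Z = ?B" using sub(1) by blast
    then show ?thesis using tor sub(2) True by simp
  next
    case False
    let ?P = "tensor_part ?F (Suc i) j"
    have "dim_k ?B < dim_k ?Z"
    proof (rule dim_k_less)
      show "?B \<subset> ?Z" using False sub(1) by blast
      show "?Z \<subseteq> tpart (aug_n ?F (Suc i)) (aug_s ?F (Suc i)) j"
        unfolding tensor_cycles_def tensor_part_eq by blast
      have 0: "0 \<in> ?P" by (simp add: tensor_part_def)
      have add: "v + w \<in> ?P" if "v \<in> ?P" "w \<in> ?P" for v w
        using that by (auto simp: tensor_part_def) (metis add.right_neutral)+
      have scale: "(\<lambda>n. c * v n) \<in> ?P" if "v \<in> ?P" for c v
        using that by (auto simp: tensor_part_def)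
      show "0 \<in> ?B" unfolding tensor_boundaries_def tensor_diff_eq
        using 0 mv_0_right by (metis image_eqI)
      show "v + w \<in> ?B" if "v \<in> ?B" "w \<in> ?B" for v w
        using that add unfolding tensor_boundaries_def tensor_diff_eq by (auto simp: mv_add[symmetric])
      show "(\<lambda>n. c * v n) \<in> ?B" if v: "v \<in> ?B" for c v
      proof -
        obtain w where w: "w \<in> ?P" "v = tensor_diff ?F i w"
          using v unfolding tensor_boundaries_def by blast
        have "(\<lambda>n. c * v n) = tensor_diff ?F i (\<lambda>n. c * w n)"
          unfolding w(2) tensor_diff_eq by (simp add: mv_def fun_eq_iff sum_distrib_left algebra_simps)
        then show ?thesis using scale[OF w(1)] unfolding tensor_boundaries_def by blast
      qed
    qed
    then show ?thesis using tor sub(2) False by simp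
  qed
qed

theorem regularity_eqI:
  assumes M: "M \<subseteq> polys V" "\<And>p. p \<in> M \<Longrightarrow> const_coeff p = 0" "M \<noteq> {0}"
    and bound: "reg_bounded V M r"
    and nz: "\<And>n s d. resol V M n s d \<Longrightarrow> \<not> hzero n s d (Suc i) (int i + r)"
  shows "regularity V M = r"
proof -
  obtain n s d where R: "resol V M n s d"
    and s: "\<And>i b. b < n (Suc i) \<Longrightarrow> int i \<le> s (Suc i) b \<and> s (Suc i) b \<le> int i + r"
    using bound unfolding reg_bounded_def by blast
  obtain n' s' d' where R': "resol V M n' s' d'"
    and tor: "\<And>i j. tor_dim V M i j = 0 \<longleftrightarrow> hzero n' s' d' (Suc i) j"
    using tor_dim_eq_0_iff[OF M(1,2) R] by metis
  let ?A = "{j - int i | i j. tor_dim V M i j \<noteq> 0}"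
  have "0 \<le> j - int i \<and> j - int i \<le> r" if "tor_dim V M i j \<noteq> 0" for i j
  proof (rule ccontr)
    assume "\<not> (0 \<le> j - int i \<and> j - int i \<le> r)"
    \<comment> \<open>Outside the strip of shifts the resolution has no basis element of degree
      \<open>j\<close> in this position.\<close>
    then have "tpart (n (Suc i)) (s (Suc i)) j = {0 :: nat \<Rightarrow> 'b}"
      using s[of _ i] by (auto simp: tpart_def fun_eq_iff) force+
    moreover have "0 \<in> tpart (n (Suc (Suc i))) (s (Suc (Suc i))) j" by (simp add: tpart_def)
    ultimately have "hzero n s d (Suc i) j"
      unfolding hzero_def by (metis mv_0_right singletonD)
    \<comment> \<open>Restriction to \<open>V\<close> itself is the identity, so
      \<open>hzero_retract\<close> here compares two resolutions of the same ideal.\<close>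
    moreover have "restr V ` M \<subseteq> M" using M(1) restr_id by (metis (no_types, lifting) image_subsetI subsetD)
    ultimately have "hzero n' s' d' (Suc i) j"
      using hzero_retract[OF R R'] by blast
    with that show False unfolding tor[symmetric] by simp
  qed
  then have "?A \<subseteq> {0..r}" by auto
  then have "finite ?A" by (rule finite_subset) simp
  moreover have "x \<le> r" if "x \<in> ?A" for x
    using subsetD[OF \<open>?A \<subseteq> {0..r}\<close> that] by simp
  moreover have "tor_dim V M i (int i + r) \<noteq> 0" using tor nz[OF R'] by blast
  then have "r \<in> ?A" by force
  ultimately have "Max ?A = r" by (intro Max_eqI) auto
  then show ?thesis using M(3) by (simp add: regularity_def)
qed

subsection \<open>Edge ideals of ordered graphs\<close>

definition ends :: "'v \<times> 'v \<Rightarrow> 'v set" where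
  "ends e = {fst e, snd e}"

definition has_edge :: "('v \<times> 'v) set \<Rightarrow> 'v set \<Rightarrow> bool" where
  "has_edge E B \<longleftrightarrow> (\<exists>e\<in>E. ends e \<subseteq> B)"

definition edge_ideal :: "'v set \<Rightarrow> ('v \<times> 'v) set \<Rightarrow> ('v, 'k::field) mpoly set" where
  "edge_ideal V E = supp_ideal V (has_edge E)"

text \<open>Edges are ordered pairs; as \<open>e\<close> and \<open>f\<close> range over both
  orders, a joining edge of either orientation is excluded.\<close>

definition induced_matching :: "('v \<times> 'v) set \<Rightarrow> ('v \<times> 'v) set \<Rightarrow> bool" where
  "induced_matching E M \<longleftrightarrow> M \<subseteq> E \<and>
     (\<forall>e\<in>M. \<forall>f\<in>M. e \<noteq> f \<longrightarrow> (\<forall>a\<in>ends e. \<forall>b\<in>ends f. a \<noteq> b \<and> (a, b) \<notin> E))"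

lemma induced_matching_subset: "induced_matching E M \<Longrightarrow> M \<subseteq> E"
  by (simp add: induced_matching_def)

lemma induced_matchingD:
  assumes "induced_matching E M" "e \<in> M" "f \<in> M" "e \<noteq> f" "a \<in> ends e" "b \<in> ends f"
  shows "a \<noteq> b" "(a, b) \<notin> E" "(b, a) \<notin> E"
proof -
  note * = assms(1)[unfolded induced_matching_def, THEN conjunct2]
  show "a \<noteq> b" "(a, b) \<notin> E"
    using *[THEN bspec, OF assms(2), THEN bspec, OF assms(3)] assms(4-6) by simp_all
  show "(b, a) \<notin> E"
    using *[THEN bspec, OF assms(3), THEN bspec, OF assms(2)] assms(4-6) by auto
qed

lemma has_edge_insert: "has_edge (insert e E) B \<longleftrightarrow> has_edge E B \<or> ends e \<subseteq> B"
  by (auto simp: has_edge_def)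

lemma edge_ideal_empty: "edge_ideal V {} = {0}"
  by (auto simp: edge_ideal_def has_edge_def supp_ideal_def)

text \<open>The ideal of \<open>r\<close> disjoint edges is a complete intersection of quadrics.\<close>

lemma disjoint_edges_hzero:
  assumes "finite M" "\<And>e. e \<in> M \<Longrightarrow> fst e \<noteq> snd e \<and> ends e \<subseteq> W"
    and "\<And>e f. e \<in> M \<Longrightarrow> f \<in> M \<Longrightarrow> e \<noteq> f \<Longrightarrow> ends e \<inter> ends f = {}"
  shows "\<exists>n s d. resol W (edge_ideal W M :: ('v, 'k::field) mpoly set) n s d \<and>
    \<not> hzero n s d (card M) (2 * int (card M))"
  using assms
proof (induction M rule: finite_induct)
  case empty
  let ?n = "\<lambda>i::nat. if i = 0 then 1 else 0 :: nat" and ?s = "\<lambda>_ _. 0 :: int"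
    and ?d = "\<lambda>_. 0 :: nat \<Rightarrow> nat \<Rightarrow> ('v, 'k) mpoly"
  have "resol W (edge_ideal W {} :: ('v, 'k) mpoly set) ?n ?s ?d"
    unfolding edge_ideal_empty by (rule resol_zero)
  \<comment> \<open>The class of 1 in position 0, degree 0. Each further edge moves it one position
    and two degrees.\<close>
  moreover have "\<not> hzero ?n ?s ?d 0 0"
  proof
    assume h: "hzero ?n ?s ?d 0 0"
    let ?w = "\<lambda>a::nat. if a = 0 then 1 else 0 :: 'k"
    have "?w \<in> tpart (?n 0) (?s 0) 0" by (simp add: tpart_def)
    then have "\<exists>v. ?w = mv (?n (Suc 0)) (cc (?d 0)) v"
      using h unfolding hzero_def by blast
    then have "?w = 0" by (simp add: mv_def fun_eq_iff)
    from fun_cong[OF this, of 0] show False by simp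
  qed
  ultimately show ?case unfolding card.empty of_nat_0 mult_zero_right by blast
next
  case (insert e M)
  let ?I = "edge_ideal W M :: ('v, 'k) mpoly set" and ?u = "xmon (ends e) :: ('v, 'k) mpoly"
  obtain n s d where R: "resol W ?I n s d" and nz: "\<not> hzero n s d (card M) (2 * int (card M))"
    using insert.IH insert.prems by blast
  have e: "finite (ends e)" "ends e \<subseteq> W" "card (ends e) = 2" "ends e \<noteq> {}"
    using insert.prems(1)[of e] by (auto simp: ends_def)
  have disj: "ends e \<inter> ends f = {}" if "f \<in> M" for f
    using insert.prems(2)[of e f] insert.hyps(2) that by auto
  \<comment> \<open>Disjointness makes the monomial of \<open>e\<close> a nonzerodivisor modulo the
    ideal of \<open>M\<close>, so the cone can use the same resolution twice.\<close>
  then have "has_edge M (ends e \<union> B) = has_edge M B" for B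
    unfolding has_edge_def by blast
  then have colon: "g \<in> ?I" if "g \<in> polys W" "?u * g \<in> ?I" for g
    using supp_ideal_colonD[OF e(1), of g W "has_edge M"] that by (simp add: edge_ideal_def)
  have u: "?u \<in> polys W" "homogeneous 2 ?u"
    using xmon_polys[OF e(1,2)] homogeneous_xmon[OF e(1)] e(3) by simp_all
  let ?\<phi> = "\<lambda>i a b. ?u * idm (n i) a b"
  have "?\<phi> 0 = mat1 ?u"
    using resolD(3)[OF R] by (auto simp: mat1_def idm_def fun_eq_iff)
  from resol_cone[OF R R chain_map_scalar[OF resolD(1)[OF R] u] this u(1) _ colon]
  have r: "resol W {m + g * ?u | m g. m \<in> ?I \<and> g \<in> polys W}
      (cone_n n n) (cone_s n s (\<lambda>i a. s i a + 2)) (cone_d n d d ?\<phi>)"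
    by (simp add: edge_ideal_def supp_ideal_polys)
  have eq: "{m + g * ?u | m g. m \<in> ?I \<and> g \<in> polys W} = edge_ideal W (insert e M)"
    unfolding edge_ideal_def has_edge_insert supp_ideal_add[OF e(1,2)] ..
  have h: "\<not> hzero (cone_n n n) (cone_s n s (\<lambda>i a. s i a + 2)) (cone_d n d d ?\<phi>)
      (Suc (card M)) (2 * int (card M) + 2)"
    by (rule hzero_cone_scalar[OF R const_coeff_xmon[OF e(1,4)] nz])
  have c: "card (insert e M) = Suc (card M)" "2 * int (Suc (card M)) = 2 * int (card M) + 2"
    using insert.hyps by simp_all
  show ?case
    unfolding c using r[unfolded eq] h by blast
qed

text \<open>
  This covers the graphs of both kinds; for the bipartite ones transitivity is vacuous.
\<close>

locale ordered_graph =
  fixes \<rho> :: "'v \<Rightarrow> nat" and E :: "('v \<times> 'v) set"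
  assumes inj: "inj \<rho>"
    and finite_E: "finite E"
    and ord: "(a, b) \<in> E \<Longrightarrow> \<rho> a < \<rho> b"
    and trans_E: "(a, b) \<in> E \<Longrightarrow> (b, c) \<in> E \<Longrightarrow> (a, c) \<in> E"
    and corner: "(i, y) \<in> E \<Longrightarrow> (m, y) \<in> E \<Longrightarrow> (m, j) \<in> E \<Longrightarrow> \<rho> i < \<rho> m \<Longrightarrow> \<rho> y < \<rho> j \<Longrightarrow> (i, j) \<in> E"

text \<open>Each closure rule yields an edge whose ends already lie on the edges it starts from, so
  the rules pass to induced subgraphs.\<close>

lemma ordered_graph_restrict:
  assumes "ordered_graph \<rho> E"
  shows "ordered_graph \<rho> {e \<in> E. ends e \<inter> N = {}}"
proof -
  interpret ordered_graph \<rho> E by fact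
  show ?thesis
    by unfold_locales (auto simp: ends_def inj finite_E intro: ord trans_E corner)
qed

context ordered_graph
begin

text \<open>
  Removing the leftmost cell \<open>(m, y)\<close> of the last nonempty row creates no new induced
  matching: no two edges are joined by \<open>(m, y)\<close> only.
\<close>

lemma exists_removable_edge:
  assumes "E \<noteq> {}"
  obtains m y where "(m, y) \<in> E" "ordered_graph \<rho> (E - {(m, y)})"
    "\<And>M. induced_matching (E - {(m, y)}) M \<Longrightarrow> induced_matching E M"
proof -
  have "\<exists>m\<in>fst ` E. \<forall>i\<in>fst ` E. \<rho> i \<le> \<rho> m"
  proof -
    have "Max (\<rho> ` fst ` E) \<in> \<rho> ` fst ` E" using assms finite_E by (intro Max_in) auto
    then obtain m where m: "Max (\<rho> ` fst ` E) = \<rho> m" "m \<in> fst ` E" by (rule imageE)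
    have "\<rho> i \<le> \<rho> m" if "i \<in> fst ` E" for i
      unfolding m(1)[symmetric] using that finite_E by (intro Max_ge) auto
    with m(2) show ?thesis by blast
  qed
  then obtain m where m1: "m \<in> fst ` E" "\<forall>i\<in>fst ` E. \<rho> i \<le> \<rho> m" by blast
  have m2: "\<rho> i \<le> \<rho> m" if "(i, j) \<in> E" for i j
    using bspec[OF m1(2) imageI[OF that, of fst]] by simp
  have "E `` {m} \<subseteq> snd ` E" by (auto intro: rev_image_eqI)
  then have fin: "finite (E `` {m})" using finite_E finite_subset by blast
  obtain y where y: "(m, y) \<in> E" "\<And>j. (m, j) \<in> E \<Longrightarrow> \<rho> y \<le> \<rho> j"
  proof -
    have "Min (\<rho> ` (E `` {m})) \<in> \<rho> ` (E `` {m})" using m1(1) fin by (intro Min_in) auto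
    then obtain y where y: "Min (\<rho> ` (E `` {m})) = \<rho> y" "y \<in> E `` {m}" by (rule imageE)
    have "\<rho> y \<le> \<rho> j" if "(m, j) \<in> E" for j
      unfolding y(1)[symmetric] using that fin by (intro Min_le) auto
    with y(2) show ?thesis using that by blast
  qed
  let ?E = "E - {(m, y)}"
  show thesis
  proof (rule that[OF y(1)])
    show "ordered_graph \<rho> ?E"
    proof
      fix a b c
      assume "(a, b) \<in> ?E" "(b, c) \<in> ?E"
      \<comment> \<open>The new edge cannot be \<open>(m, y)\<close>: for \<open>a = m\<close> the
        edge \<open>(b, c)\<close> would start in a row after the last one. The corner rule survives
        for the same reason.\<close>
      then show "(a, c) \<in> ?E"
        using trans_E[of a b c] m2[of b c] ord[of a b] by auto
    next
      fix i z k j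
      assume "(i, z) \<in> ?E" "(k, z) \<in> ?E" "(k, j) \<in> ?E" "\<rho> i < \<rho> k" "\<rho> z < \<rho> j"
      then show "(i, j) \<in> ?E"
        using corner[of i z k j] m2[of k z] by auto
    next
      show "\<rho> a < \<rho> b" if "(a, b) \<in> ?E" for a b using ord that by blast
    qed (simp_all add: inj finite_E)
    fix M
    assume M: "induced_matching ?E M"
    \<comment> \<open>Suppose \<open>(m, y)\<close> joins \<open>e\<close> and \<open>f\<close>. As
      \<open>y\<close> comes after every row, \<open>f = (i, y)\<close>. If
      \<open>e = (m, j)\<close>, the corner rule gives \<open>(i, j)\<close>; if
      \<open>e = (k, m)\<close>, transitivity gives \<open>(k, y)\<close>. Either one still joins
      them.\<close>
    have key: False if ef: "e \<in> M" "f \<in> M" "e \<noteq> f" "m \<in> ends e" "y \<in> ends f" for e f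
    proof -
      have eE: "e \<in> ?E" "f \<in> ?E" using M ef(1,2) unfolding induced_matching_def by blast+
      have no: "(a, b) \<notin> ?E" "(b, a) \<notin> ?E" "a \<noteq> b" if "a \<in> ends e" "b \<in> ends f" for a b
        by (rule induced_matchingD[OF M ef(1-3) that])+
      have "fst f \<noteq> y" using eE(2) m2[of "fst f" "snd f"] ord[OF y(1)] by auto
      then have "snd f = y" using ef(5) by (simp add: ends_def)
      then obtain i where i: "f = (i, y)" by (cases f) simp
      have im: "\<rho> i < \<rho> m"
        using eE(2) m2[of i y] inj i by (auto simp: le_less inj_eq)
      show False
      proof (cases "fst e = m")
        case True
        then obtain j where j: "e = (m, j)" by (cases e) auto
        have "\<rho> y < \<rho> j" using y(2)[of j] eE(1) j inj by (auto simp: le_less inj_eq)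
        then have "(i, j) \<in> ?E" using corner[OF _ y(1), of i j] eE i j im by auto
        then show False using no(2)[of j i] i j by (auto simp: ends_def)
      next
        case False
        then obtain k where k: "e = (k, m)" using ef(4) by (cases e) (auto simp: ends_def)
        then have "(k, y) \<in> ?E" using trans_E[OF _ y(1), of k] eE(1) ord[of k m] by auto
        then show False using no(1)[of k y] i k by (auto simp: ends_def)
      qed
    qed
    show "induced_matching E M"
      unfolding induced_matching_def
    proof (intro conjI ballI impI)
      show "M \<subseteq> E" using M unfolding induced_matching_def by blast
      fix e f a b
      assume *: "e \<in> M" "f \<in> M" "e \<noteq> f" "a \<in> ends e" "b \<in> ends f"
      then have "(a, b) \<notin> ?E" and "a \<noteq> b" using induced_matchingD[OF M] by metis+
      moreover have "(a, b) \<noteq> (m, y)" using key * by blast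
      ultimately show "a \<noteq> b" "(a, b) \<notin> E" by auto
    qed
  qed
qed

end

theorem edge_ideal_reg_bounded:
  assumes "ordered_graph \<rho> E" "E \<subseteq> V \<times> V" "\<And>M. induced_matching E M \<Longrightarrow> card M \<le> r"
  shows "reg_bounded V (edge_ideal V E :: ('v, 'k::field) mpoly set) (int r + 1)"
proof -
  have "finite E" using assms(1) by (simp add: ordered_graph_def)
  then show ?thesis using assms
  proof (induction E arbitrary: r rule: finite_psubset_induct)
    case (psubset E r)
    interpret ordered_graph \<rho> E by (rule psubset.prems(1))
    show ?case
    proof (cases "E = {}")
      case True
      show ?thesis unfolding True edge_ideal_empty by (rule reg_bounded_zero)
    next
      case False
      then obtain m y where e: "(m, y) \<in> E" "ordered_graph \<rho> (E - {(m, y)})"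
        "\<And>M. induced_matching (E - {(m, y)}) M \<Longrightarrow> induced_matching E M"
        using exists_removable_edge by metis
      let ?E1 = "E - {(m, y)}" and ?A = "{m, y}"
      have my: "m \<noteq> y" using ord[OF e(1)] by auto
      \<comment> \<open>The vertices joined to \<open>m\<close> or \<open>y\<close> by an edge other
        than \<open>(m, y)\<close>.\<close>
      define N where "N = {z. \<exists>w\<in>?A. (z, w) \<in> ?E1 \<or> (w, z) \<in> ?E1}"
      define E2 where "E2 = {f \<in> E. ends f \<inter> (?A \<union> N) = {}}"
      have IH1: "reg_bounded V (edge_ideal V ?E1 :: ('v, 'k) mpoly set) (int r + 1)"
        using psubset.IH[of ?E1 r] e psubset.prems(2,3) by blast
      have "induced_matching E {(m, y)}" using e(1) by (simp add: induced_matching_def)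
      then have "1 \<le> r" using psubset.prems(3) by force
      then obtain q where q: "r = Suc q" by (cases r) auto
      \<comment> \<open>No vertex on an edge of \<open>E2\<close> is joined to \<open>m\<close> or
        \<open>y\<close>, so adding \<open>(m, y)\<close> gives an induced matching of
        \<open>E\<close>.\<close>
      have "card M \<le> q" if M: "induced_matching E2 M" for M
      proof -
        have ME: "M \<subseteq> E2" using M by (simp add: induced_matching_def)
        have cross: "a \<noteq> b \<and> (a, b) \<notin> E \<and> (b, a) \<notin> E" if "f \<in> M" "a \<in> ?A" "b \<in> ends f" for a b f
        proof -
          have "b \<notin> ?A \<union> N" using that ME by (auto simp: E2_def)
          then show ?thesis using that(2) unfolding N_def by blast
        qed
        have "induced_matching E (insert (m, y) M)"
          unfolding induced_matching_def
        proof (intro conjI ballI impI)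
          show "insert (m, y) M \<subseteq> E" using ME e(1) by (auto simp: E2_def)
          fix f g a b
          assume *: "f \<in> insert (m, y) M" "g \<in> insert (m, y) M" "f \<noteq> g" "a \<in> ends f" "b \<in> ends g"
          have "a \<noteq> b \<and> (a, b) \<notin> E"
          proof (cases "f \<in> M \<and> g \<in> M")
            case True
            then have **: "a \<noteq> b" "(a, b) \<notin> E2" using induced_matchingD(1,2)[OF M _ _ *(3-5)] by blast+
            have "a \<notin> ?A \<union> N" "b \<notin> ?A \<union> N" using True * ME by (auto simp: E2_def)
            then show ?thesis using ** by (auto simp: E2_def ends_def)
          next
            case False
            have "ends (m, y) = ?A" by (simp add: ends_def)
            then show ?thesis using False * cross[of g a b] cross[of f b a] by auto
          qed
          then show "a \<noteq> b" "(a, b) \<notin> E" by auto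
        qed
        then have "card (insert (m, y) M) \<le> r" by (rule psubset.prems(3))
        moreover have "(m, y) \<notin> M" using ME by (auto simp: E2_def ends_def)
        moreover have "finite M" using ME finite_subset[of M E] finite_E by (auto simp: E2_def)
        ultimately show ?thesis by (simp add: q)
      qed
      moreover have "ordered_graph \<rho> E2"
        unfolding E2_def by (rule ordered_graph_restrict[OF psubset.prems(1)])
      moreover have "(m, y) \<notin> E2" "E2 \<subseteq> E" by (auto simp: E2_def ends_def)
      then have "E2 \<subset> E" using e(1) by blast
      ultimately have "reg_bounded V (edge_ideal V E2 :: ('v, 'k) mpoly set) (int q + 1)"
        using psubset.IH psubset.prems(2) by (metis (no_types, lifting) order_trans psubset_imp_subset)
      then have IH2: "reg_bounded V (supp_ideal V (has_edge E2) :: ('v, 'k) mpoly set) (int r)"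
        by (simp add: edge_ideal_def q add.commute)
      have "N \<subseteq> fst ` E \<union> snd ` E" by (force simp: N_def)
      then have "finite N" using finite_E finite_subset by blast
      moreover have "N \<subseteq> V" using psubset.prems(2) by (auto simp: N_def)
      \<comment> \<open>The vertices of \<open>N\<close> lie on no edge of \<open>E2\<close>, so
        they can be adjoined as variables at no cost.\<close>
      moreover have "has_edge E2 (insert z B) = has_edge E2 B" if "z \<in> N" for z B
        using that by (auto simp: has_edge_def E2_def)
      ultimately have "reg_bounded V
          (supp_ideal V (\<lambda>B. has_edge E2 B \<or> N \<inter> B \<noteq> {}) :: ('v, 'k) mpoly set) (int r)"
        using reg_bounded_vars[OF _ _ _ _ IH2, of N] \<open>1 \<le> r\<close> by simp
      \<comment> \<open>The colon ideal: an edge meeting \<open>{m, y}\<close> contributes its other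
        end, a member of \<open>N\<close>. Edges that meet \<open>N\<close> but not
        \<open>{m, y}\<close> are redundant; the remaining ones form \<open>E2\<close>.\<close>
      moreover have "has_edge ?E1 (?A \<union> B) \<longleftrightarrow> has_edge E2 B \<or> N \<inter> B \<noteq> {}" for B
      proof
        assume "has_edge ?E1 (?A \<union> B)"
        then obtain e' where e': "e' \<in> ?E1" "ends e' \<subseteq> ?A \<union> B" unfolding has_edge_def by blast
        obtain a b where e'_eq: "e' = (a, b)" by (cases e')
        have ab: "(a, b) \<in> ?E1" "a \<in> ?A \<union> B" "b \<in> ?A \<union> B"
          using e' unfolding e'_eq ends_def by auto
        have "\<not> (a \<in> ?A \<and> b \<in> ?A)" using ab(1) ord[of a b] ord[OF e(1)] by auto
        moreover have "b \<in> N" if "a \<in> ?A" using ab(1) that by (auto simp: N_def)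
        moreover have "a \<in> N" if "b \<in> ?A" using ab(1) that by (auto simp: N_def)
        moreover have "has_edge E2 B" if "a \<notin> ?A \<union> N" "b \<notin> ?A \<union> N"
          using ab that by (auto simp: has_edge_def E2_def ends_def intro!: bexI[of _ "(a, b)"])
        ultimately show "has_edge E2 B \<or> N \<inter> B \<noteq> {}" using ab(2,3) by blast
      next
        assume "has_edge E2 B \<or> N \<inter> B \<noteq> {}"
        then show "has_edge ?E1 (?A \<union> B)"
        proof
          assume "has_edge E2 B"
          then show ?thesis by (force simp: has_edge_def E2_def ends_def)
        next
          assume "N \<inter> B \<noteq> {}"
          then obtain z w where zw: "z \<in> B" "w \<in> ?A" "(z, w) \<in> ?E1 \<or> (w, z) \<in> ?E1"
            unfolding N_def by blast
          then have "ends (z, w) \<subseteq> ?A \<union> B" "ends (w, z) \<subseteq> ?A \<union> B" by (auto simp: ends_def)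
          with zw(3) show ?thesis unfolding has_edge_def by blast
        qed
      qed
      ultimately have colon: "reg_bounded V
          (supp_ideal V (\<lambda>B. has_edge ?E1 (?A \<union> B)) :: ('v, 'k) mpoly set) (int r)"
        by simp
      have "?A \<subseteq> V" using e(1) psubset.prems(2) by auto
      \<comment> \<open>The monomial of the edge has degree 2, so the colon bound \<open>r\<close>
        becomes \<open>r + 2 - 1\<close>.\<close>
      then have "reg_bounded V
          (supp_ideal V (\<lambda>B. has_edge ?E1 B \<or> ?A \<subseteq> B) :: ('v, 'k) mpoly set) (int r + 1)"
        using my \<open>1 \<le> r\<close> reg_bounded_add[OF IH1[unfolded edge_ideal_def] colon] by simp
      moreover have "(\<lambda>B. has_edge ?E1 B \<or> ?A \<subseteq> B) = has_edge E"
        using e(1) has_edge_insert[of "(m, y)" ?E1] by (simp add: fun_eq_iff insert_absorb ends_def)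
      ultimately show ?thesis by (simp add: edge_ideal_def)
    qed
  qed
qed

theorem regularity_edge_ideal:
  assumes G: "ordered_graph \<rho> E" and EV: "E \<subseteq> V \<times> V"
    and max: "\<And>M. induced_matching E M \<Longrightarrow> card M \<le> r"
    and M: "induced_matching E M" "card M = r"
  shows "regularity V (edge_ideal V E :: ('v, 'k::field) mpoly set) = int r + 1"
proof (cases "E = {}")
  case True
  \<comment> \<open>Without edges the ideal is zero, and the convention for its regularity matches
    \<open>r = 0\<close>.\<close>
  have "r = 0" using M True by (auto simp: induced_matching_def)
  then show ?thesis unfolding True edge_ideal_empty by (simp add: regularity_def)
next
  case False
  interpret ordered_graph \<rho> E by fact
  let ?I = "edge_ideal V E :: ('v, 'k) mpoly set"
  obtain e where e: "e \<in> E" using False by blast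
  have "induced_matching E {e}" using e by (simp add: induced_matching_def)
  then have "1 \<le> r" using max by force
  then obtain q where q: "r = Suc q" by (cases r) auto
  have noloop: "fst e \<noteq> snd e" if "e \<in> E" for e using ord[of "fst e" "snd e"] that by auto
  show ?thesis
  proof (rule regularity_eqI)
    show "?I \<subseteq> polys V" by (simp add: edge_ideal_def supp_ideal_polys)
    show "const_coeff p = 0" if "p \<in> ?I" for p
    proof (rule ccontr)
      assume "const_coeff p \<noteq> 0"
      then have "0 \<in> Poly_Mapping.keys p" by (simp add: const_coeff_def in_keys_iff)
      then have "has_edge E {}" using that by (force simp: edge_ideal_def supp_ideal_def)
      then show False by (auto simp: has_edge_def ends_def)
    qed
    have "ends e \<subseteq> V" "finite (ends e)" using e EV by (auto simp: ends_def)
    then have "xmon (ends e) \<in> ?I"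
      using e by (auto simp: edge_ideal_def supp_ideal_def xmon_polys keys_xmon keys_sqmon has_edge_def)
    moreover have "xmon (ends e) \<noteq> (0 :: ('v, 'k) mpoly)"
      using keys_xmon[of "ends e"] by (metis empty_not_insert keys_zero)
    ultimately show "?I \<noteq> {0}" by blast
    show "reg_bounded V ?I (int r + 1)" by (rule edge_ideal_reg_bounded[OF G EV max])
    fix n s d
    assume R: "resol V ?I n s d"
    define W where "W = \<Union> (ends ` M)"
    let ?J = "edge_ideal W M :: ('v, 'k) mpoly set"
    have ME: "M \<subseteq> E" using M(1) by (simp add: induced_matching_def)
    then have WV: "W \<subseteq> V" using EV by (auto simp: W_def ends_def)
    have "finite M" using ME finite_E by (rule finite_subset)
    moreover have "fst e \<noteq> snd e \<and> ends e \<subseteq> W" if "e \<in> M" for e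
      using that noloop ME by (auto simp: W_def)
    moreover have "ends e \<inter> ends f = {}" if "e \<in> M" "f \<in> M" "e \<noteq> f" for e f
      using induced_matchingD(1)[OF M(1) that] by blast
    ultimately obtain n' s' d' where R': "resol W ?J n' s' d'"
      and nz: "\<not> hzero n' s' d' (card M) (2 * int (card M))"
      using disjoint_edges_hzero[of M W] by blast
    have "?J \<subseteq> ?I"
      using polys_mono[OF WV] ME unfolding edge_ideal_def supp_ideal_def has_edge_def by blast
    \<comment> \<open>An edge of \<open>E\<close> between vertices of the matching joins the two
      ends of a single member of \<open>M\<close>, so restriction to \<open>W\<close> leaves only
      the edges of \<open>M\<close>.\<close>
    moreover have "has_edge M B" if B: "B \<subseteq> W" "has_edge E B" for B
    proof -
      obtain a b where ab: "(a, b) \<in> E" "a \<in> B" "b \<in> B"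
        using B(2) by (auto simp: has_edge_def ends_def)
      obtain e f where ef: "e \<in> M" "f \<in> M" "a \<in> ends e" "b \<in> ends f"
        using ab B(1) unfolding W_def by blast
      then have "e = f" using induced_matchingD(2)[OF M(1)] ab(1) by blast
      moreover have "a \<noteq> b" using ord[OF ab(1)] by auto
      ultimately have "ends e \<subseteq> B" using ef ab by (auto simp: ends_def)
      then show ?thesis using ef(1) by (auto simp: has_edge_def)
    qed
    then have "restr W ` ?I \<subseteq> ?J"
      by (auto simp: edge_ideal_def supp_ideal_def restr_in_polys)
        (auto simp: restr_def keys_mono_filter)
    ultimately have "\<not> hzero n s d (Suc q) (2 * int (card M))"
      using hzero_retract[OF R R' WV] nz M(2) q by metis
    \<comment> \<open>The class lies in position \<open>r = q + 1\<close>, hence in homological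
      degree \<open>q\<close>, and in internal degree \<open>2 r\<close>.\<close>
    moreover have "2 * int (card M) = int q + (int r + 1)" using M(2) q by simp
    ultimately show "\<not> hzero n s d (Suc q) (int q + (int r + 1))" by simp
  qed
qed

subsection \<open>Rectangularity\<close>

text \<open>\<open>row\<close> expresses that the right ends \<open>i + lam i\<close> weakly
  decrease down the rows. In \<open>col\<close> the left ends weakly decrease too while
  \<open>mu\<close> is positive; afterwards they follow the diagonal, whence the condition
  \<open>x < j\<close>.\<close>

locale skew_shape =
  fixes D :: "(nat \<times> nat) set"
  assumes strictly_upper: "(i, j) \<in> D \<Longrightarrow> i < j"
    and row: "(i, j) \<in> D \<Longrightarrow> (i', j') \<in> D \<Longrightarrow> i \<le> i' \<Longrightarrow> j \<le> t \<Longrightarrow> t \<le> j' \<Longrightarrow> (i, t) \<in> D"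
    and col: "(i, j) \<in> D \<Longrightarrow> (i', j') \<in> D \<Longrightarrow> i \<le> x \<Longrightarrow> x \<le> i' \<Longrightarrow> x < j \<Longrightarrow> j \<le> j' \<Longrightarrow> (x, j) \<in> D"

text \<open>A strictly decreasing sequence of naturals loses at least 1 per step, as much as the
  index gains.\<close>

lemma strict_antimono_on_add_le:
  fixes f :: "nat \<Rightarrow> nat"
  assumes "strict_antimono_on {1..l} f" "1 \<le> i" "i \<le> k" "k \<le> l"
  shows "k + f k \<le> i + f i"
  using assms(3,4)
proof (induction k rule: dec_induct)
  case (step k)
  have "f (Suc k) < f k"
    using assms(1,2) step.hyps step.prems by (auto simp: monotone_on_def)
  with step show ?case by simp
qed simp

lemma skew_shape_of_diagram:
  assumes "shifted_skew_diagram D"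
  shows "skew_shape D"
proof -
  obtain l r lam mu where lam: "strict_antimono_on {1..l} lam"
    and mu: "strict_antimono_on {1..r} mu" "\<forall>i>r. mu i = 0"
    and D: "D = {(i, j). i \<in> {1..l} \<and> i + mu i + 1 \<le> j \<and> j \<le> i + lam i}"
    using assms unfolding shifted_skew_diagram_def by blast
  have R: "k + lam k \<le> i + lam i" if "1 \<le> i" "i \<le> k" "k \<le> l" for i k
    by (rule strict_antimono_on_add_le[OF lam that])
  have L: "x + mu x + 1 \<le> j" if "1 \<le> i" "i \<le> x" "i + mu i + 1 \<le> j" "x < j" for i x j
  proof (cases "x \<le> r")
    case True
    then show ?thesis using strict_antimono_on_add_le[OF mu(1) that(1,2)] that(3) by simp
  next
    case False
    then show ?thesis using mu(2) that(4) by simp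
  qed
  show ?thesis
  proof
    fix i j i' j' t
    assume "(i, j) \<in> D" "(i', j') \<in> D" "i \<le> i'" "j \<le> t" "t \<le> j'"
    then show "(i, t) \<in> D" using R[of i i'] by (auto simp: D)
  next
    fix i j i' j' x
    assume "(i, j) \<in> D" "(i', j') \<in> D" "i \<le> x" "x \<le> i'" "x < j" "j \<le> j'"
    then show "(x, j) \<in> D" using R[of x i'] L[of i x j] by (auto simp: D)
  qed (auto simp: D)
qed

text \<open>For cells of \<open>D\<close> this also forces distinct rows and distinct columns, since
  otherwise the crossing cell would be one of the two cells.\<close>

definition cross_free :: "(nat \<times> nat) set \<Rightarrow> (nat \<times> nat) set \<Rightarrow> bool" where
  "cross_free D M \<longleftrightarrow> (\<forall>e\<in>M. \<forall>f\<in>M. e \<noteq> f \<longrightarrow> (fst e, snd f) \<notin> D)"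

lemma cross_freeD:
  "cross_free D M \<Longrightarrow> e \<in> M \<Longrightarrow> f \<in> M \<Longrightarrow> e \<noteq> f \<Longrightarrow> (fst e, snd f) \<notin> D"
  by (simp add: cross_free_def)

lemma rect_bip_rec:
  assumes "finite X" "finite Y"
  shows "rect_bip D X Y =
    (if \<not> has_top_cell D X Y \<and> empty_rows D X Y = {} \<and> empty_cols D X Y = {} then 0
     else if X = {} \<and> Y = {} then 0
     else if \<not> has_top_cell D X Y then rect_bip D (X - empty_rows D X Y) (Y - empty_cols D X Y)
     else if (last_row D X Y, first_col D X Y) \<in> D
       then Suc (rect_bip D (X - top_rows D X Y) (Y - top_cols D X Y))
     else 1)"
  unfolding rect_bip_def by (subst rect_decomposition.simps) (simp add: assms)

lemma last_row:
  assumes "finite X" "has_top_cell D X Y"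
  shows "last_row D X Y \<in> X" "(last_row D X Y, Max Y) \<in> D"
    "\<And>x. x \<in> X \<Longrightarrow> (x, Max Y) \<in> D \<Longrightarrow> x \<le> last_row D X Y"
proof -
  let ?A = "{x \<in> X. (x, Max Y) \<in> D}"
  have "Min X \<in> ?A" using assms by (simp add: has_top_cell_def)
  then have A: "?A \<noteq> {}" "finite ?A" using assms(1) by auto
  have "last_row D X Y \<in> ?A" and ge: "\<And>x. x \<in> ?A \<Longrightarrow> x \<le> last_row D X Y"
    unfolding last_row_def using Max_in[OF A(2,1)] Max_ge[OF A(2)] by blast+
  then show "last_row D X Y \<in> X" "(last_row D X Y, Max Y) \<in> D" by auto
  show "x \<le> last_row D X Y" if "x \<in> X" "(x, Max Y) \<in> D" for x using ge that by simp
qed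

lemma first_col:
  assumes "finite Y" "has_top_cell D X Y"
  shows "first_col D X Y \<in> Y" "(Min X, first_col D X Y) \<in> D"
    "\<And>y. y \<in> Y \<Longrightarrow> (Min X, y) \<in> D \<Longrightarrow> first_col D X Y \<le> y"
proof -
  let ?A = "{y \<in> Y. (Min X, y) \<in> D}"
  have "Max Y \<in> ?A" using assms by (simp add: has_top_cell_def)
  then have A: "?A \<noteq> {}" "finite ?A" using assms(1) by auto
  have "first_col D X Y \<in> ?A" and le: "\<And>y. y \<in> ?A \<Longrightarrow> first_col D X Y \<le> y"
    unfolding first_col_def using Min_in[OF A(2,1)] Min_le[OF A(2)] by blast+
  then show "first_col D X Y \<in> Y" "(Min X, first_col D X Y) \<in> D" by auto
  show "first_col D X Y \<le> y" if "y \<in> Y" "(Min X, y) \<in> D" for y using le that by simp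
qed

context skew_shape
begin

text \<open>Row \<open>a\<close> reaches at least as far right as the lower row \<open>a'\<close>,
  so the missing \<open>(a, b')\<close> can only lie to the left of all cells of row
  \<open>a\<close>.\<close>

lemma crossD:
  assumes "(a, b) \<in> D" "(a', b') \<in> D" "(a, b') \<notin> D" "a < a'"
  shows "b' < b" "\<And>t. t \<le> b' \<Longrightarrow> (a, t) \<notin> D"
proof -
  show "b' < b" using row[of a b a' b' b'] assms by (auto simp: not_le[symmetric])
  show "(a, t) \<notin> D" if "t \<le> b'" for t using row[of a t a' b' b'] assms that by auto
qed

lemma covered_cells_cross_less:
  assumes fin: "finite X" "finite Y" and top: "has_top_cell D X Y"
    and cells: "(a, b) \<in> D" "(a', b') \<in> D" "a \<in> X" "b \<in> Y" "a' \<in> X" "b' \<in> Y" "a < a'"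
    and cov: "a' \<in> top_rows D X Y \<or> b' \<in> top_cols D X Y"
    and nc: "(a, b') \<notin> D" "(a', b) \<notin> D"
  shows False
proof -
  have b: "b' < b" using crossD(1)[OF cells(1,2) nc(1) cells(7)] .
  have x1: "Min X \<le> a" and yn: "b \<le> Max Y" "b' \<le> Max Y" using cells fin by auto
  from cov show False
  proof
    assume "a' \<in> top_rows D X Y"
    then have "a' \<le> last_row D X Y" by (simp add: top_rows_def)
    then have "(a', b) \<in> D"
      using row[OF cells(2) last_row(2)[OF fin(1) top], of b] b yn by simp
    with nc show False by simp
  next
    assume "b' \<in> top_cols D X Y"
    then have "first_col D X Y \<le> b'" by (simp add: top_cols_def)
    then have "(Min X, b') \<in> D"
      using row[OF first_col(2)[OF fin(2) top], of "Min X" "Max Y" b'] top yn(2)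
      by (simp add: has_top_cell_def)
    moreover have "a < b'" using strictly_upper[OF cells(2)] cells(7) by simp
    ultimately have "(a, b') \<in> D"
      using col[of "Min X" b' a' b' a] cells(2,7) x1 by simp
    with nc show False by simp
  qed
qed

lemma card_covered_le_1:
  assumes fin: "finite X" "finite Y" and top: "has_top_cell D X Y"
    and M: "M \<subseteq> D \<inter> X \<times> Y" "cross_free D M"
    and cov: "\<And>a b. (a, b) \<in> M \<Longrightarrow> a \<in> top_rows D X Y \<or> b \<in> top_cols D X Y"
  shows "card M \<le> 1"
proof -
  have "e = f" if "e \<in> M" "f \<in> M" for e f
  proof (rule ccontr)
    assume ne: "e \<noteq> f"
    obtain a b where e: "e = (a, b)" by (cases e)
    obtain a' b' where f: "f = (a', b')" by (cases f)
    have nc: "(a, b') \<notin> D" "(a', b) \<notin> D"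
      using M(2) that ne unfolding cross_free_def e f by fastforce+
    have in': "(a, b) \<in> D" "(a', b') \<in> D" "a \<in> X" "b \<in> Y" "a' \<in> X" "b' \<in> Y"
      using M(1) that e f by auto
    have "a \<noteq> a'" using nc in' by auto
    then consider "a < a'" | "a' < a" by linarith
    then show False
    proof cases
      case 1
      then show False
        using covered_cells_cross_less[OF fin top in' 1 _ nc] cov that e f by blast
    next
      case 2
      then show False
        using covered_cells_cross_less[OF fin top in'(2,1,5,6,3,4) 2 _ nc(2,1)] cov that e f by blast
    qed
  qed
  moreover have "finite M" using M(1) fin by (meson finite_Int finite_SigmaI finite_subset)
  ultimately show ?thesis by (simp add: card_le_Suc0_iff_eq)
qed

text \<open>With both sets nonempty, the first row and the last column would each contain a cell,
  and \<open>row\<close> would then put a cell into their common corner.\<close>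

lemma no_top_cell_cases:
  assumes "finite X" "finite Y" "\<not> has_top_cell D X Y"
    "empty_rows D X Y = {}" "empty_cols D X Y = {}"
  shows "X = {} \<or> Y = {}"
proof (rule ccontr)
  assume ne: "\<not> (X = {} \<or> Y = {})"
  then have "Min X \<in> X" "Max Y \<in> Y" using assms(1,2) by simp_all
  have "Min X \<notin> empty_rows D X Y" "Max Y \<notin> empty_cols D X Y" using assms(4,5) by simp_all
  then obtain x y where "y \<in> Y" "(Min X, y) \<in> D" "x \<in> X" "(x, Max Y) \<in> D"
    using \<open>Min X \<in> X\<close> \<open>Max Y \<in> Y\<close> assms(1,2)
    unfolding empty_rows_def empty_cols_def
    by (smt (verit) Max_ge Min_le mem_Collect_eq order_antisym)
  then have "(Min X, Max Y) \<in> D"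
    using row[of "Min X" y x "Max Y" "Max Y"] assms(1,2) by simp
  then show False using ne assms(3) by (simp add: has_top_cell_def)
qed

text \<open>By \<open>col\<close>, the corner \<open>(p, q)\<close> of a pedestal is missing only if
  \<open>q \<le> p\<close>. A cell outside its rows and columns would satisfy
  \<open>b < q \<le> p < a\<close>, below the diagonal.\<close>

lemma pedestal_covers:
  assumes fin: "finite X" "finite Y" and top: "has_top_cell D X Y"
    and ped: "(last_row D X Y, first_col D X Y) \<notin> D"
    and ab: "(a, b) \<in> D" "a \<in> X" "b \<in> Y"
  shows "a \<in> top_rows D X Y \<or> b \<in> top_cols D X Y"
proof (rule ccontr)
  let ?p = "last_row D X Y" and ?q = "first_col D X Y"
  assume "\<not> ?thesis"
  then have "?p < a" "b < ?q" using ab by (auto simp: top_rows_def top_cols_def)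
  moreover have "?q \<le> ?p"
  proof (rule ccontr)
    assume "\<not> ?q \<le> ?p"
    moreover have "Min X \<le> ?p" "?q \<le> Max Y"
      using fin last_row(1)[OF fin(1) top] first_col(1)[OF fin(2) top] by simp_all
    ultimately have "(?p, ?q) \<in> D"
      using col[OF first_col(2)[OF fin(2) top] last_row(2)[OF fin(1) top], of ?p] by simp
    with ped show False by simp
  qed
  ultimately show False using strictly_upper[OF ab(1)] by simp
qed

end

lemma cross_free_subset: "cross_free D M \<Longrightarrow> N \<subseteq> M \<Longrightarrow> cross_free D N"
  unfolding cross_free_def by blast

lemma card_cross_free_le_rect:
  assumes "skew_shape D" "finite X" "finite Y" "M \<subseteq> D \<inter> X \<times> Y" "cross_free D M"
  shows "card M \<le> rect_bip D X Y"
  using assms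
proof (induction D X Y arbitrary: M rule: rect_decomposition.induct)
  case (1 D X Y)
  interpret skew_shape D by (rule 1)
  have finM: "finite M" using 1 by (meson finite_Int finite_SigmaI finite_subset)
  note fin = "1.prems"(2,3) and M = "1.prems"(4,5)
  consider (stop) "\<not> has_top_cell D X Y" "empty_rows D X Y = {}" "empty_cols D X Y = {}"
    | (empty) "X = {}" "Y = {}"
    | (no_top) "\<not> has_top_cell D X Y" "\<not> (empty_rows D X Y = {} \<and> empty_cols D X Y = {})"
        "\<not> (X = {} \<and> Y = {})"
    | (top) "has_top_cell D X Y" "\<not> (X = {} \<and> Y = {})" by blast
  then show ?case
  proof cases
    case stop
    then have "M = {}" using no_top_cell_cases[OF fin stop] M(1) by auto
    then show ?thesis by simp
  next
    case empty
    then have "M = {}" using M(1) by auto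
    then show ?thesis by simp
  next
    case no_top
    have "M \<subseteq> D \<inter> (X - empty_rows D X Y) \<times> (Y - empty_cols D X Y)"
      using M(1) unfolding empty_rows_def empty_cols_def by fastforce
    then have "card M \<le> rect_bip D (X - empty_rows D X Y) (Y - empty_cols D X Y)"
      using "1.IH"(1) no_top fin M(2) "1.prems"(1) by auto
    then show ?thesis using no_top by (subst rect_bip_rec[OF fin]) auto
  next
    case top
    let ?X = "top_rows D X Y" and ?Y = "top_cols D X Y"
    let ?N = "{e \<in> M. fst e \<in> ?X \<or> snd e \<in> ?Y}"
    have N: "card ?N \<le> 1"
      using M by (intro card_covered_le_1[OF fin top(1)]) (auto intro: cross_free_subset)
    show ?thesis
    proof (cases "(last_row D X Y, first_col D X Y) \<in> D")
      case True
      have "M - ?N \<subseteq> D \<inter> (X - ?X) \<times> (Y - ?Y)" using M(1) by auto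
      moreover have "cross_free D (M - ?N)" using M(2) by (rule cross_free_subset) blast
      ultimately have "card (M - ?N) \<le> rect_bip D (X - ?X) (Y - ?Y)"
        using "1.IH"(2) True top fin "1.prems"(1) by auto
      moreover have "card M = card ?N + card (M - ?N)"
        using finM by (subst card_Un_disjoint[symmetric]) (auto intro: arg_cong[of _ _ card])
      ultimately show ?thesis using N True top by (subst rect_bip_rec[OF fin]) auto
    next
      case False
      \<comment> \<open>The decomposition stops at a pedestal, so nothing of \<open>M\<close> may be
        left over.\<close>
      have "fst e \<in> ?X \<or> snd e \<in> ?Y" if "e \<in> M" for e
        using pedestal_covers[OF fin top(1) False, of "fst e" "snd e"] subsetD[OF M(1) that]
        by (simp add: mem_Times_iff)
      then have "?N = M" by blast
      then show ?thesis using N False top by (subst rect_bip_rec[OF fin]) auto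
    qed
  qed
qed

lemma exists_cross_free_rect:
  assumes "finite X" "finite Y"
  shows "\<exists>M. M \<subseteq> D \<inter> X \<times> Y \<and> cross_free D M \<and> card M = rect_bip D X Y"
  using assms
proof (induction D X Y rule: rect_decomposition.induct)
  case (1 D X Y)
  note fin = "1.prems"
  have triv: "\<exists>M. M \<subseteq> D \<inter> X \<times> Y \<and> cross_free D M \<and> card M = 0"
    by (intro exI[of _ "{}"]) (simp add: cross_free_def)
  consider (stop) "\<not> has_top_cell D X Y" "empty_rows D X Y = {}" "empty_cols D X Y = {}"
    | (empty) "X = {}" "Y = {}"
    | (no_top) "\<not> has_top_cell D X Y" "\<not> (empty_rows D X Y = {} \<and> empty_cols D X Y = {})"
        "\<not> (X = {} \<and> Y = {})"
    | (top) "has_top_cell D X Y" "\<not> (X = {} \<and> Y = {})" by blast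
  then show ?case
  proof cases
    case stop
    then show ?thesis using triv by (subst rect_bip_rec[OF fin]) auto
  next
    case empty
    then have "rect_bip D X Y = 0" by (subst rect_bip_rec[OF fin]) simp
    then show ?thesis using triv by simp
  next
    case no_top
    then obtain M where "M \<subseteq> D \<inter> (X - empty_rows D X Y) \<times> (Y - empty_cols D X Y)"
      "cross_free D M" "card M = rect_bip D (X - empty_rows D X Y) (Y - empty_cols D X Y)"
      using "1.IH"(1) fin by auto
    moreover have "rect_bip D X Y = rect_bip D (X - empty_rows D X Y) (Y - empty_cols D X Y)"
      using no_top by (subst rect_bip_rec[OF fin]) auto
    ultimately show ?thesis by (intro exI[of _ M]) auto
  next
    case top
    let ?X = "top_rows D X Y" and ?Y = "top_cols D X Y" and ?e = "(Min X, Max Y)"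
    have e: "?e \<in> D \<inter> X \<times> Y" using top(1) fin by (simp add: has_top_cell_def)
    show ?thesis
    proof (cases "(last_row D X Y, first_col D X Y) \<in> D")
      case True
      then obtain M where M: "M \<subseteq> D \<inter> (X - ?X) \<times> (Y - ?Y)" "cross_free D M"
        "card M = rect_bip D (X - ?X) (Y - ?Y)"
        using "1.IH"(2) top fin by auto
      \<comment> \<open>The remaining columns lie left of the first cell of the top row, and the
        remaining rows below the last cell of the last column.\<close>
      have new: "(Min X, b) \<notin> D \<and> (a, Max Y) \<notin> D" if "(a, b) \<in> M" for a b
        using M(1) that last_row(3)[OF fin(1) top(1), of a] first_col(3)[OF fin(2) top(1), of b]
        by (auto simp: top_rows_def top_cols_def)
      have "cross_free D (insert ?e M)"
        using M(2) new unfolding cross_free_def by (metis insert_iff fst_conv snd_conv prod.collapse)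
      moreover have "?e \<notin> M" using new e by blast
      moreover have "finite M" using M(1) fin by (meson finite_Int finite_SigmaI finite_subset finite_Diff)
      moreover have "rect_bip D X Y = Suc (rect_bip D (X - ?X) (Y - ?Y))"
        using True top by (subst rect_bip_rec[OF fin]) auto
      ultimately show ?thesis using M(1,3) e by (intro exI[of _ "insert ?e M"]) auto
    next
      case False
      then have "rect_bip D X Y = 1" using top by (subst rect_bip_rec[OF fin]) auto
      then show ?thesis using e by (intro exI[of _ "{?e}"]) (simp add: cross_free_def)
    qed
  qed
qed

section \<open>Generated ideals and the two kinds of graphs\<close>

lemma zero_in_ideal_generated: "0 \<in> ideal_generated V G"
  unfolding ideal_generated_def by (intro CollectI exI[of _ "{}"]) simp

lemma ideal_generated_mono: "G \<subseteq> H \<Longrightarrow> ideal_generated V G \<subseteq> ideal_generated V H"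
  unfolding ideal_generated_def by blast

lemma ideal_generated_add_multiple:
  assumes "p \<in> ideal_generated V G" "u \<in> G" "r \<in> polys V"
  shows "p + r * u \<in> ideal_generated V G"
proof -
  obtain A c where p: "p = (\<Sum>g\<in>A. c g * g)" "finite A" "A \<subseteq> G" "\<forall>g\<in>A. c g \<in> polys V"
    using assms(1) unfolding ideal_generated_def by blast
  \<comment> \<open>\<open>u\<close> may already belong to \<open>A\<close>; its two coefficients
    are then added.\<close>
  let ?c = "\<lambda>g. (if g \<in> A then c g else 0) + (if g = u then r else 0)"
  have "(\<Sum>g\<in>insert u A. ?c g * g) =
      (\<Sum>g\<in>insert u A. if g \<in> A then c g * g else 0) + (\<Sum>g\<in>insert u A. if g = u then r * g else 0)"
    unfolding sum.distrib[symmetric] by (intro sum.cong) (auto simp: distrib_right)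
  also have "(\<Sum>g\<in>insert u A. if g \<in> A then c g * g else 0) = (\<Sum>g\<in>A. c g * g)"
    using p(2) by (intro sum.mono_neutral_cong_right) auto
  also have "(\<Sum>g\<in>insert u A. if g = u then r * g else 0) = r * u"
    using p(2) by simp
  finally have sum: "p + r * u = (\<Sum>g\<in>insert u A. ?c g * g)" using p(1) by simp
  have "\<forall>g\<in>insert u A. ?c g \<in> polys V"
    using p(4) assms(3) by (auto intro!: polys_add)
  moreover have "finite (insert u A)" "insert u A \<subseteq> G" using p(2,3) assms(2) by auto
  ultimately show ?thesis
    unfolding ideal_generated_def sum by (intro CollectI exI[of _ "insert u A"] exI[of _ ?c] conjI refl)
qed

lemma ideal_generated_edges:
  assumes "finite E" "\<And>e. e \<in> E \<Longrightarrow> ends e \<subseteq> V"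
  shows "ideal_generated V ((\<lambda>e. xmon (ends e)) ` E) = (edge_ideal V E :: ('v, 'k::field) mpoly set)"
proof (intro subset_antisym)
  have fin: "finite (ends e)" for e :: "'v \<times> 'v" by (simp add: ends_def)
  have mult: "r * xmon (ends e) \<in> edge_ideal V E" if "e \<in> E" "r \<in> polys V" for e and r :: "('v, 'k) mpoly"
    using that assms(2)[of e] unfolding edge_ideal_def supp_ideal_def has_edge_def
    by (auto simp: polys_mult xmon_polys fin keys_xmon keys_nat_add keys_sqmon dest!: keys_multD)
  have add: "p + q \<in> edge_ideal V E" if "p \<in> edge_ideal V E" "q \<in> edge_ideal V E"
    for p q :: "('v, 'k) mpoly"
    using that unfolding edge_ideal_def supp_ideal_def
    by (auto simp: polys_add dest!: subsetD[OF keys_add])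
  have sum: "(\<Sum>g\<in>A. f g) \<in> edge_ideal V E" if "\<And>g. g \<in> A \<Longrightarrow> f g \<in> edge_ideal V E"
    for A and f :: "_ \<Rightarrow> ('v, 'k) mpoly"
  proof -
    have "0 \<in> (edge_ideal V E :: ('v, 'k) mpoly set)" by (simp add: edge_ideal_def supp_ideal_def)
    then show ?thesis using that
      by (induction A rule: infinite_finite_induct) (simp_all add: add)
  qed
  show "ideal_generated V ((\<lambda>e. xmon (ends e)) ` E) \<subseteq> (edge_ideal V E :: ('v, 'k) mpoly set)"
    unfolding ideal_generated_def by (auto intro!: sum mult)
  show "(edge_ideal V E :: ('v, 'k) mpoly set) \<subseteq> ideal_generated V ((\<lambda>e. xmon (ends e)) ` E)"
    using assms
  proof (induction E rule: finite_induct)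
    case empty
    then show ?case by (simp add: edge_ideal_empty zero_in_ideal_generated)
  next
    case (insert e E)
    show ?case
    proof
      fix p :: "('v, 'k) mpoly"
      assume "p \<in> edge_ideal V (insert e E)"
      then have "p \<in> {m + g * xmon (ends e) | m g. m \<in> supp_ideal V (has_edge E) \<and> g \<in> polys V}"
        unfolding edge_ideal_def has_edge_insert supp_ideal_add[OF fin insert.prems[OF insertI1]] .
      then obtain m g where p: "p = m + g * xmon (ends e)" "m \<in> edge_ideal V E" "g \<in> polys V"
        unfolding edge_ideal_def by blast
      have "m \<in> ideal_generated V ((\<lambda>e. xmon (ends e)) ` insert e E)"
        using insert.IH insert.prems p(2)
          ideal_generated_mono[of "(\<lambda>e. xmon (ends e)) ` E" "(\<lambda>e. xmon (ends e)) ` insert e E" V]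
        by blast
      then show "p \<in> ideal_generated V ((\<lambda>e. xmon (ends e)) ` insert e E)"
        unfolding p(1) using p(3) by (intro ideal_generated_add_multiple) auto
    qed
  qed
qed

theorem regularity_nonbip:
  assumes D: "skew_shape D" and X: "finite X"
  shows "regularity X (nonbip_ideal D X :: (nat, 'k::field) mpoly set) = int (rect_nonbip D X) + 1"
proof -
  interpret skew_shape D by (rule D)
  define E where "E = D \<inter> X \<times> X"
  have finE: "finite E" using X by (simp add: E_def)
  have EX: "E \<subseteq> X \<times> X" by (auto simp: E_def)
  have gens: "{var x * var x' | x x'. x \<in> X \<and> x' \<in> X \<and> (x, x') \<in> D} =
      (\<lambda>e. xmon (ends e) :: (nat, 'k) mpoly) ` E"
  proof -
    have "var x * var x' = (xmon (ends (x, x')) :: (nat, 'k) mpoly)" if "(x, x') \<in> D" for x x'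
      using strictly_upper[OF that] by (simp add: var_mult_var ends_def)
    then show ?thesis unfolding E_def by (auto simp: image_iff) (metis IntI SigmaI)+
  qed
  have ideal: "nonbip_ideal D X = (edge_ideal X E :: (nat, 'k) mpoly set)"
    unfolding nonbip_ideal_def
  proof -
    have "ends e \<subseteq> X" if "e \<in> E" for e using that EX by (auto simp: ends_def)
    then show "ideal_generated X {var x * var x' | x x'. x \<in> X \<and> x' \<in> X \<and> (x, x') \<in> D} =
        (edge_ideal X E :: (nat, 'k) mpoly set)"
      unfolding gens by (rule ideal_generated_edges[OF finE])
  qed
  have graph: "ordered_graph (\<lambda>x. x) E"
  proof
    show "inj (\<lambda>x::nat. x)" by simp
    show "finite E" by (rule finE)
    show "a < b" if "(a, b) \<in> E" for a b using that strictly_upper by (simp add: E_def)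
    show "(a, c) \<in> E" if "(a, b) \<in> E" "(b, c) \<in> E" for a b c
      using that row[of a b b c c] strictly_upper[of a b] strictly_upper[of b c] by (auto simp: E_def)
    show "(i, j) \<in> E" if "(i, y) \<in> E" "(m, y) \<in> E" "(m, j) \<in> E" "i < m" "y < j" for i y m j
      using that row[of i y m j j] by (auto simp: E_def)
  qed
  have max: "card M \<le> rect_bip D X X" if M: "induced_matching E M" for M
  proof (rule card_cross_free_le_rect[OF D X X])
    show sub: "M \<subseteq> D \<inter> X \<times> X" using induced_matching_subset[OF M] by (simp add: E_def)
    have "(fst e, snd f) \<notin> D" if "e \<in> M" "f \<in> M" "e \<noteq> f" for e f
    proof -
      have "(fst e, snd f) \<notin> E"
        by (rule induced_matchingD(2)[OF M that]) (simp_all add: ends_def)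
      moreover have "(fst e, snd f) \<in> X \<times> X" using sub that by auto
      ultimately show ?thesis by (simp add: E_def)
    qed
    then show "cross_free D M" by (simp add: cross_free_def)
  qed
  obtain M where M: "M \<subseteq> D \<inter> X \<times> X" "cross_free D M" "card M = rect_bip D X X"
    using exists_cross_free_rect[OF X X] by blast
  have ind: "induced_matching E M"
    unfolding induced_matching_def
  proof (intro conjI ballI impI)
    show "M \<subseteq> E" using M(1) by (simp add: E_def)
    fix e f u v
    assume *: "e \<in> M" "f \<in> M" "e \<noteq> f" "u \<in> ends e" "v \<in> ends f"
    obtain a b where e: "e = (a, b)" by (cases e)
    obtain a' b' where f: "f = (a', b')" by (cases f)
    have nc: "(a, b') \<notin> D" "(a', b) \<notin> D"
      using M(2) * unfolding cross_free_def e f by fastforce+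
    have in': "(a, b) \<in> D" "(a', b') \<in> D" using M(1) * e f by auto
    have less: "a < b" "a' < b'" using in' strictly_upper by auto
    have "a \<noteq> a'" using nc in' by auto
    then consider "a < a'" | "a' < a" by linarith
    then have "u \<noteq> v \<and> (u, v) \<notin> D"
    proof cases
      case 1
      note c = crossD[OF in' nc(1) 1]
      \<comment> \<open>Here \<open>a < a' < b' < b\<close>: \<open>a'\<close> is left of
        \<open>b'\<close>, hence of all cells of row \<open>a\<close>, and pairs starting with the
        largest index \<open>b\<close> are not above the diagonal.\<close>
      have "(a, a') \<notin> D" using c(2) less by simp
      moreover have "(b, a') \<notin> D" "(b, b') \<notin> D"
        using strictly_upper[of b a'] strictly_upper[of b b'] c(1) less by auto
      ultimately show ?thesis using * nc 1 less c(1) by (auto simp: e f ends_def)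
    next
      case 2
      note c = crossD[OF in'(2,1) nc(2) 2]
      \<comment> \<open>Now \<open>a' < a < b < b'\<close>. A cell \<open>(b, b')\<close> would
        extend row \<open>a\<close> to the crossing cell \<open>(a, b')\<close>.\<close>
      have "(b, b') \<notin> D" using row[of a b b b' b'] in' nc(1) less c(1) by auto
      moreover have "(a, a') \<notin> D" "(b, a') \<notin> D"
        using strictly_upper[of a a'] strictly_upper[of b a'] 2 less by auto
      ultimately show ?thesis using * nc 2 less c(1) by (auto simp: e f ends_def)
    qed
    then show "u \<noteq> v" "(u, v) \<notin> E" by (auto simp: E_def)
  qed
  show ?thesis
    unfolding ideal rect_nonbip_def by (rule regularity_edge_ideal[OF graph EX max ind M(3)])
qed

theorem regularity_bip:
  assumes D: "skew_shape D" and X: "finite X" and Y: "finite Y"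
  shows "regularity (X <+> Y) (bip_ideal D X Y :: (nat + nat, 'k::field) mpoly set) =
    int (rect_bip D X Y) + 1"
proof -
  interpret skew_shape D by (rule D)
  let ?i = "\<lambda>e. (Inl (fst e), Inr (snd e)) :: (nat + nat) \<times> (nat + nat)"
  define E where "E = ?i ` (D \<inter> X \<times> Y)"
  have E_iff: "(u, v) \<in> E \<longleftrightarrow> (\<exists>x y. u = Inl x \<and> v = Inr y \<and> (x, y) \<in> D \<and> x \<in> X \<and> y \<in> Y)" for u v
    by (force simp: E_def)
  have inj: "inj_on ?i A" for A by (auto simp: inj_on_def prod_eq_iff)
  have finE: "finite E" using X Y by (simp add: E_def)
  have EX: "E \<subseteq> (X <+> Y) \<times> (X <+> Y)" by (auto simp: E_def)
  have gens: "{var (Inl x) * var (Inr y) | x y. x \<in> X \<and> y \<in> Y \<and> (x, y) \<in> D} =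
      (\<lambda>e. xmon (ends e) :: (nat + nat, 'k) mpoly) ` E"
    unfolding E_def image_image by (force simp: var_mult_var ends_def)
  have ideal: "bip_ideal D X Y = (edge_ideal (X <+> Y) E :: (nat + nat, 'k) mpoly set)"
    unfolding bip_ideal_def
  proof -
    have "ends e \<subseteq> X <+> Y" if "e \<in> E" for e using that EX by (auto simp: ends_def)
    then show "ideal_generated (X <+> Y)
        {var (Inl x) * var (Inr y) | x y. x \<in> X \<and> y \<in> Y \<and> (x, y) \<in> D} =
        (edge_ideal (X <+> Y) E :: (nat + nat, 'k) mpoly set)"
      unfolding gens by (rule ideal_generated_edges[OF finE])
  qed
  \<comment> \<open>Interleaving keeps the order among rows and among columns, separates the two
    kinds by parity, and turns \<open>x < y\<close> into \<open>2 * x < 2 * y + 1\<close>.\<close>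
  let ?\<rho> = "case_sum (\<lambda>x. 2 * x) (\<lambda>y. 2 * y + 1) :: nat + nat \<Rightarrow> nat"
  have graph: "ordered_graph ?\<rho> E"
  proof
    show "inj ?\<rho>"
    proof (rule injI)
      fix u v :: "nat + nat"
      assume "?\<rho> u = ?\<rho> v"
      then show "u = v" by (cases u; cases v) (simp_all, presburger+)
    qed
    show "finite E" by (rule finE)
    show "?\<rho> a < ?\<rho> b" if "(a, b) \<in> E" for a b
      using that strictly_upper by (fastforce simp: E_iff)
    show "(a, c) \<in> E" if "(a, b) \<in> E" "(b, c) \<in> E" for a b c
      using that by (auto simp: E_iff)
    show "(i, j) \<in> E"
      if *: "(i, y) \<in> E" "(m, y) \<in> E" "(m, j) \<in> E" "?\<rho> i < ?\<rho> m" "?\<rho> y < ?\<rho> j" for i y m j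
    proof -
      obtain i' y' m' j' where "i = Inl i'" "y = Inr y'" "m = Inl m'" "j = Inr j'"
        using *(1-3) by (auto simp: E_iff)
      then show ?thesis using * row[of i' y' m' j' j'] by (auto simp: E_iff)
    qed
  qed
  have max: "card M \<le> rect_bip D X Y" if M: "induced_matching E M" for M
  proof -
    obtain N where N: "M = ?i ` N" "N \<subseteq> D \<inter> X \<times> Y"
      using induced_matching_subset[OF M] unfolding E_def subset_image_iff by blast
    have "(fst e, snd f) \<notin> D" if "e \<in> N" "f \<in> N" "e \<noteq> f" for e f
    proof -
      have "?i e \<noteq> ?i f" using that(3) by (auto simp: prod_eq_iff)
      moreover have "?i e \<in> M" "?i f \<in> M" using that N(1) by auto
      ultimately have "(Inl (fst e), Inr (snd f)) \<notin> E"
        using induced_matchingD(2)[OF M, of "?i e" "?i f"] by (simp add: ends_def)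
      moreover have "fst e \<in> X" "snd f \<in> Y" using N(2) that by auto
      ultimately show ?thesis by (simp add: E_iff)
    qed
    then have "card N \<le> rect_bip D X Y"
      by (intro card_cross_free_le_rect[OF D X Y N(2)]) (simp add: cross_free_def)
    then show ?thesis by (simp add: N(1) card_image inj)
  qed
  obtain N where N: "N \<subseteq> D \<inter> X \<times> Y" "cross_free D N" "card N = rect_bip D X Y"
    using exists_cross_free_rect[OF X Y] by blast
  have ind: "induced_matching E (?i ` N)"
    unfolding induced_matching_def
  proof (intro conjI ballI impI)
    show "?i ` N \<subseteq> E" using N(1) by (auto simp: E_def)
    fix e' f' u v
    assume *: "e' \<in> ?i ` N" "f' \<in> ?i ` N" "e' \<noteq> f'" "u \<in> ends e'" "v \<in> ends f'"
    then obtain e f where ef: "e \<in> N" "f \<in> N" "e' = ?i e" "f' = ?i f" "e \<noteq> f" by auto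
    have nc: "(fst e, snd f) \<notin> D" "(fst f, snd e) \<notin> D"
      using cross_freeD[OF N(2)] ef(1,2,5) by metis+
    have "(fst e, snd e) \<in> D" "(fst f, snd f) \<in> D" using N(1) ef(1,2) by auto
    \<comment> \<open>A shared row or column would make a crossing cell equal to \<open>e\<close> or
      \<open>f\<close>.\<close>
    then have "fst e \<noteq> fst f" "snd e \<noteq> snd f" using nc by metis+
    then show "u \<noteq> v" "(u, v) \<notin> E" using *(4,5) nc by (auto simp: ef ends_def E_iff)
  qed
  have "card (?i ` N) = rect_bip D X Y" by (simp add: card_image inj N(3))
  from regularity_edge_ideal[OF graph EX max ind this] show ?thesis
    unfolding ideal .
qed

theorem theorem2p24:
  fixes D :: "(nat \<times> nat) set" and X Y :: "nat set"
  assumes "shifted_skew_diagram D"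
    and "finite X" and "finite Y"
    and "\<forall>x\<in>X. x > 0" and "\<forall>y\<in>Y. y > 0"
  shows "(X \<noteq> {} \<or> Y \<noteq> {} \<longrightarrow>
            regularity (X <+> Y) (bip_ideal D X Y :: (nat + nat, 'k::field) mpoly set)
              = int (rect_bip D X Y) + 1) \<and>
         (X \<noteq> {} \<longrightarrow>
            regularity X (nonbip_ideal D X :: (nat, 'k) mpoly set)
              = int (rect_nonbip D X) + 1)"
  using regularity_bip[OF skew_shape_of_diagram[OF assms(1)] assms(2,3)]
    regularity_nonbip[OF skew_shape_of_diagram[OF assms(1)] assms(2)] by blast

end
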